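(* The functor $\mathcal{F}^m:\mathbf{Pcoh}_!\to\mathbf{Cstab_m}$ defined by $\mathcal{F}^mX=$ the measurable cone $\mathcal{F}^mX$ and $\mathcal{F}^mf=\hat f$ is full and faithful.
   Context: PCS $X=(|X|,\mathcal{P}(X))$: $|X|$ countable, $\mathcal{P}(X)\subseteq\mathbb{R}_{\ge0}^{|X|}$, $\mathcal{P}(X)^{\perp\perp}=\mathcal{P}(X)$ with $S^\perp=\{u:\sum_au_av_a\le1\ \forall v\in S\}$, each $a$ having $\lambda>0$ with $\lambda e_a\in\mathcal{P}(X)$ and a bound on $u_a$ over $\mathcal{P}(X)$. $\mathbf{Pcoh}_!$: objects PCSs; $\mathbf{Pcoh}_!(X,Y)$ = matrices $f\in\mathbb{R}_{\ge0}^{\mathcal{M}_{fin}(|X|)\times|Y|}$ with $\hat f(x):=f\cdot x^!\in\mathcal{P}(Y)$ for all $x\in\mathcal{P}(X)$, $(f\cdot x^!)_b=\sum_\mu f_{\mu,b}\prod_ax_a^{\mu(a)}$; composition corresponds to composition of the maps $\hat f$. Cone $\mathcal{F}X=\{\alpha x:\alpha\ge0,x\in\mathcal{P}(X)\}$, pointwise operations, norm $\inf\{1/r:r>0,rx\in\mathcal{P}(X)\}$, unit ball $\mathcal{P}(X)$. Measurable cone: a sequentially complete cone $C$ with families $\mathcal{M}_n(C)$ of functions from $\mathbb{R}^n$ to linear Scott-continuous maps $C\to\mathbb{R}_{\ge0}$, containing $0$, closed under precomposition with Borel measurable maps $\mathbb{R}^p\to\mathbb{R}^n$, and with $\vec u\mapsto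 l(\vec u)(x)$ measurable. Measurable path of arity $n$: $\gamma:\mathbb{R}^n\to C$ with bounded image, $(\vec r,\vec s)\mapsto l(\vec r)(\gamma(\vec s))$ Borel measurable for all $l\in\mathcal{M}_k(C)$; unitary if image in the unit ball. $\mathbf{Cstab_m}$: objects measurable cones; morphisms $C\to D$ are stable functions (pre-stable: $\sum_{I\subseteq\{1..n\},\,n-|I|\text{ odd}}f(x+\sum_{i\in I}u_i)\le\sum_{I,\,n-|I|\text{ even}}f(x+\sum_{i\in I}u_i)$ whenever $x+\sum u_i$ is in the unit ball; preserving lubs of nondecreasing sequences; bounded) from the unit ball of $C$ into the unit ball of $D$ that send unitary measurable paths of $C$ to measurable paths of $D$. The measurable cone $\mathcal{F}^mX$ is $\mathcal{F}X$ with tests $\mathcal{M}_n=\{0\}\cup\{\epsilon_a:a\in|X|\}$, $\epsilon_a(\vec r)(x)=x_a$. *)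

theory Defs
  imports "HOL-Analysis.Analysis" "HOL-Algebra.Module" "HOL-Library.Multiset"
begin

section \<open>Categories and functors\<close>

text \<open>The composite of \<open>f : A \<rightarrow> B\<close> and \<open>g : B \<rightarrow> C\<close> is \<open>Comp \<K> A B C g f\<close>.\<close>

record ('o, 'm) category =
  Obj :: "'o set"
  Hom :: "'o \<Rightarrow> 'o \<Rightarrow> 'm set"
  Id :: "'o \<Rightarrow> 'm"
  Comp :: "'o \<Rightarrow> 'o \<Rightarrow> 'o \<Rightarrow> 'm \<Rightarrow> 'm \<Rightarrow> 'm"

definition is_category :: "('o, 'm) category \<Rightarrow> bool" where
  "is_category \<K> \<longleftrightarrow>
     (\<forall>A\<in>Obj \<K>. Id \<K> A \<in> Hom \<K> A A) \<and>
     (\<forall>A\<in>Obj \<K>. \<forall>B\<in>Obj \<K>. \<forall>C\<in>Obj \<K>. \<forall>f\<in>Hom \<K> A B. \<forall>g\<in>Hom \<K> B C.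
        Comp \<K> A B C g f \<in> Hom \<K> A C) \<and>
     (\<forall>A\<in>Obj \<K>. \<forall>B\<in>Obj \<K>. \<forall>f\<in>Hom \<K> A B.
        Comp \<K> A A B f (Id \<K> A) = f \<and> Comp \<K> A B B (Id \<K> B) f = f) \<and>
     (\<forall>A\<in>Obj \<K>. \<forall>B\<in>Obj \<K>. \<forall>C\<in>Obj \<K>. \<forall>D\<in>Obj \<K>.
        \<forall>f\<in>Hom \<K> A B. \<forall>g\<in>Hom \<K> B C. \<forall>h\<in>Hom \<K> C D.
        Comp \<K> A C D h (Comp \<K> A B C g f) = Comp \<K> A B D (Comp \<K> B C D h g) f)"

definition is_functor ::
  "('o, 'm) category \<Rightarrow> ('p, 'n) category \<Rightarrow> ('o \<Rightarrow> 'p) \<Rightarrow> ('o \<Rightarrow> 'o \<Rightarrow> 'm \<Rightarrow> 'n) \<Rightarrow> bool" where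
  "is_functor \<K> \<L> F\<^sub>o F\<^sub>m \<longleftrightarrow>
     is_category \<K> \<and> is_category \<L> \<and>
     (\<forall>A\<in>Obj \<K>. F\<^sub>o A \<in> Obj \<L>) \<and>
     (\<forall>A\<in>Obj \<K>. \<forall>B\<in>Obj \<K>. \<forall>f\<in>Hom \<K> A B. F\<^sub>m A B f \<in> Hom \<L> (F\<^sub>o A) (F\<^sub>o B)) \<and>
     (\<forall>A\<in>Obj \<K>. F\<^sub>m A A (Id \<K> A) = Id \<L> (F\<^sub>o A)) \<and>
     (\<forall>A\<in>Obj \<K>. \<forall>B\<in>Obj \<K>. \<forall>C\<in>Obj \<K>. \<forall>f\<in>Hom \<K> A B. \<forall>g\<in>Hom \<K> B C.
        F\<^sub>m A C (Comp \<K> A B C g f) = Comp \<L> (F\<^sub>o A) (F\<^sub>o B) (F\<^sub>o C) (F\<^sub>m B C g) (F\<^sub>m A B f))"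

definition is_full ::
  "('o, 'm) category \<Rightarrow> ('p, 'n) category \<Rightarrow> ('o \<Rightarrow> 'p) \<Rightarrow> ('o \<Rightarrow> 'o \<Rightarrow> 'm \<Rightarrow> 'n) \<Rightarrow> bool" where
  "is_full \<K> \<L> F\<^sub>o F\<^sub>m \<longleftrightarrow>
     (\<forall>A\<in>Obj \<K>. \<forall>B\<in>Obj \<K>. \<forall>g\<in>Hom \<L> (F\<^sub>o A) (F\<^sub>o B). \<exists>f\<in>Hom \<K> A B. F\<^sub>m A B f = g)"

definition is_faithful ::
  "('o, 'm) category \<Rightarrow> ('o \<Rightarrow> 'o \<Rightarrow> 'm \<Rightarrow> 'n) \<Rightarrow> bool" where
  "is_faithful \<K> F\<^sub>m \<longleftrightarrow> (\<forall>A\<in>Obj \<K>. \<forall>B\<in>Obj \<K>. inj_on (F\<^sub>m A B) (Hom \<K> A B))"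


section \<open>Probabilistic coherence spaces\<close>

record 'a pcs =
  web :: "'a set"
  pts :: "('a \<Rightarrow> real) set"

text \<open>Families over a set \<open>A\<close> of nonnegative reals, represented as functions vanishing
  outside \<open>A\<close>, so that each family has exactly one representative and the pointwise operations
  need no restriction.\<close>

definition nnvec :: "'a set \<Rightarrow> ('a \<Rightarrow> real) set" where
  "nnvec A = {u. (\<forall>a\<in>A. 0 \<le> u a) \<and> (\<forall>a. a \<notin> A \<longrightarrow> u a = 0)}"

definition polar :: "'a set \<Rightarrow> ('a \<Rightarrow> real) set \<Rightarrow> ('a \<Rightarrow> real) set" where
  "polar A S = {u \<in> nnvec A. \<forall>v\<in>S. (\<Sum>\<^sub>\<infinity>a\<in>A. ennreal (u a * v a)) \<le> 1}"

definition is_pcs :: "'a pcs \<Rightarrow> bool" where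
  "is_pcs X \<longleftrightarrow>
     countable (web X) \<and>
     pts X \<subseteq> nnvec (web X) \<and>
     polar (web X) (polar (web X) (pts X)) = pts X \<and>
     (\<forall>a\<in>web X. \<exists>c>0. (\<lambda>b. if b = a then c else 0) \<in> pts X) \<and>
     (\<forall>a\<in>web X. \<exists>M. \<forall>u\<in>pts X. u a \<le> M)"

definition mfin :: "'a set \<Rightarrow> 'a multiset set" where
  "mfin A = {\<mu>. set_mset \<mu> \<subseteq> A}"

definition monomial :: "('a \<Rightarrow> real) \<Rightarrow> 'a multiset \<Rightarrow> real" where
  "monomial x \<mu> = (\<Prod>a\<in>set_mset \<mu>. x a ^ count \<mu> a)"

text \<open>The power series of a matrix is evaluated in \<open>[0, \<infinity>]\<close>; its finiteness is part of being a
  morphism, so that \<open>enn2real\<close> in \<open>hat\<close> loses nothing there.\<close>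

definition series :: "'a pcs \<Rightarrow> ('a multiset \<Rightarrow> 'b \<Rightarrow> real) \<Rightarrow> ('a \<Rightarrow> real) \<Rightarrow> 'b \<Rightarrow> ennreal" where
  "series X f x b = (\<Sum>\<^sub>\<infinity>\<mu>\<in>mfin (web X). ennreal (f \<mu> b * monomial x \<mu>))"

definition hat :: "'a pcs \<Rightarrow> ('a multiset \<Rightarrow> 'b \<Rightarrow> real) \<Rightarrow> ('a \<Rightarrow> real) \<Rightarrow> 'b \<Rightarrow> real" where
  "hat X f x = (\<lambda>b. enn2real (series X f x b))"

definition pcoh_hom :: "'a pcs \<Rightarrow> 'b pcs \<Rightarrow> ('a multiset \<Rightarrow> 'b \<Rightarrow> real) set" where
  "pcoh_hom X Y =
     {f. (\<forall>\<mu>\<in>mfin (web X). \<forall>b\<in>web Y. 0 \<le> f \<mu> b) \<and>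
         (\<forall>\<mu> b. \<mu> \<notin> mfin (web X) \<or> b \<notin> web Y \<longrightarrow> f \<mu> b = 0) \<and>
         (\<forall>x\<in>pts X. (\<forall>b\<in>web Y. series X f x b < \<infinity>) \<and> hat X f x \<in> pts Y)}"

definition pcoh_id :: "'a pcs \<Rightarrow> 'a multiset \<Rightarrow> 'a \<Rightarrow> real" where
  "pcoh_id X = (\<lambda>\<mu> a. if a \<in> web X \<and> \<mu> = {#a#} then 1 else 0)"

text \<open>Composition of matrices is the one that corresponds to composition of the associated
  maps. That such a matrix exists and is unique is part of \<open>Pcoh\<close> being a category and
  \<open>f \<mapsto> hat X f\<close> being functorial.\<close>

definition pcoh_comp ::
  "'a pcs \<Rightarrow> 'b pcs \<Rightarrow> 'c pcs \<Rightarrow> ('b multiset \<Rightarrow> 'c \<Rightarrow> real) \<Rightarrow> ('a multiset \<Rightarrow> 'b \<Rightarrow> real)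
     \<Rightarrow> ('a multiset \<Rightarrow> 'c \<Rightarrow> real)" where
  "pcoh_comp X Y Z g f =
     (THE h. h \<in> pcoh_hom X Z \<and> (\<forall>x\<in>pts X. hat X h x = hat Y g (hat X f x)))"

definition Pcoh :: "('a pcs, 'a multiset \<Rightarrow> 'a \<Rightarrow> real) category" where
  "Pcoh = \<lparr>Obj = {X. is_pcs X}, Hom = pcoh_hom, Id = pcoh_id, Comp = pcoh_comp\<rparr>"


section \<open>Cones\<close>

text \<open>Cones live on the library's module record; its fields \<open>mult\<close> and \<open>one\<close> play no role, and
  only nonnegative scalars are relevant.\<close>

record 'c cone = "(real, 'c) module" +
  cnorm :: "'c \<Rightarrow> real"

locale normed_cone = abelian_monoid C for C :: "('c, 'm) cone_scheme" (structure) +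
  assumes smult_closed: "\<lbrakk>0 \<le> \<alpha>; x \<in> carrier C\<rbrakk> \<Longrightarrow> \<alpha> \<odot> x \<in> carrier C"
    and smult_l_distr: "\<lbrakk>0 \<le> \<alpha>; 0 \<le> \<beta>; x \<in> carrier C\<rbrakk> \<Longrightarrow> (\<alpha> + \<beta>) \<odot> x = \<alpha> \<odot> x \<oplus> \<beta> \<odot> x"
    and smult_r_distr: "\<lbrakk>0 \<le> \<alpha>; x \<in> carrier C; y \<in> carrier C\<rbrakk> \<Longrightarrow> \<alpha> \<odot> (x \<oplus> y) = \<alpha> \<odot> x \<oplus> \<alpha> \<odot> y"
    and smult_assoc: "\<lbrakk>0 \<le> \<alpha>; 0 \<le> \<beta>; x \<in> carrier C\<rbrakk> \<Longrightarrow> (\<alpha> * \<beta>) \<odot> x = \<alpha> \<odot> (\<beta> \<odot> x)"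
    and smult_one: "x \<in> carrier C \<Longrightarrow> 1 \<odot> x = x"
    and add_cancel: "\<lbrakk>x \<in> carrier C; y \<in> carrier C; z \<in> carrier C; x \<oplus> y = x \<oplus> z\<rbrakk> \<Longrightarrow> y = z"
    and cnorm_nonneg: "x \<in> carrier C \<Longrightarrow> 0 \<le> cnorm C x"
    and cnorm_smult: "\<lbrakk>0 \<le> \<alpha>; x \<in> carrier C\<rbrakk> \<Longrightarrow> cnorm C (\<alpha> \<odot> x) = \<alpha> * cnorm C x"
    and cnorm_triangle: "\<lbrakk>x \<in> carrier C; y \<in> carrier C\<rbrakk> \<Longrightarrow> cnorm C (x \<oplus> y) \<le> cnorm C x + cnorm C y"
    and cnorm_eq_0: "\<lbrakk>x \<in> carrier C; cnorm C x = 0\<rbrakk> \<Longrightarrow> x = \<zero>"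
    and cnorm_mono: "\<lbrakk>x \<in> carrier C; y \<in> carrier C\<rbrakk> \<Longrightarrow> cnorm C x \<le> cnorm C (x \<oplus> y)"

definition cone_ball :: "('c, 'm) cone_scheme \<Rightarrow> 'c set" where
  "cone_ball C = {x \<in> carrier C. cnorm C x \<le> 1}"

definition cone_le :: "('c, 'm) cone_scheme \<Rightarrow> 'c \<Rightarrow> 'c \<Rightarrow> bool" where
  "cone_le C x y \<longleftrightarrow> (\<exists>z\<in>carrier C. y = x \<oplus>\<^bsub>C\<^esub> z)"

definition cone_incseq :: "('c, 'm) cone_scheme \<Rightarrow> (nat \<Rightarrow> 'c) \<Rightarrow> bool" where
  "cone_incseq C s \<longleftrightarrow> (\<forall>n. cone_le C (s n) (s (Suc n)))"

definition cone_lub :: "('c, 'm) cone_scheme \<Rightarrow> (nat \<Rightarrow> 'c) \<Rightarrow> 'c \<Rightarrow> bool" where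
  "cone_lub C s x \<longleftrightarrow> x \<in> carrier C \<and> (\<forall>n. cone_le C (s n) x) \<and>
     (\<forall>y\<in>carrier C. (\<forall>n. cone_le C (s n) y) \<longrightarrow> cone_le C x y)"

locale seq_complete_cone = normed_cone +
  assumes seq_complete: "\<lbrakk>range s \<subseteq> cone_ball C; cone_incseq C s\<rbrakk> \<Longrightarrow> \<exists>x\<in>cone_ball C. cone_lub C s x"

definition cone_dual :: "('c, 'm) cone_scheme \<Rightarrow> ('c \<Rightarrow> real) set" where
  "cone_dual C = {l \<in> carrier C \<rightarrow>\<^sub>E {0..}.
     (\<forall>x\<in>carrier C. \<forall>y\<in>carrier C. l (x \<oplus>\<^bsub>C\<^esub> y) = l x + l y) \<and>
     (\<forall>\<alpha>\<ge>0. \<forall>x\<in>carrier C. l (\<alpha> \<odot>\<^bsub>C\<^esub> x) = \<alpha> * l x) \<and>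
     (\<forall>s x. range s \<subseteq> carrier C \<longrightarrow> cone_incseq C s \<longrightarrow> cone_lub C s x \<longrightarrow> l x = (SUP n. l (s n)))}"


section \<open>Measurable cones\<close>

abbreviation RR :: "nat \<Rightarrow> (nat \<Rightarrow> real) measure" where
  "RR n \<equiv> (\<Pi>\<^sub>M i\<in>{..<n}. borel)"

record 'c mcone = "'c cone" +
  tests :: "nat \<Rightarrow> ((nat \<Rightarrow> real) \<Rightarrow> 'c \<Rightarrow> real) set"

locale measurable_cone = seq_complete_cone C for C :: "('c, 'm) mcone_scheme" (structure) +
  assumes tests_dual: "tests C n \<subseteq> space (RR n) \<rightarrow>\<^sub>E cone_dual C"
    and tests_zero: "(\<lambda>r\<in>space (RR n). \<lambda>x\<in>carrier C. 0) \<in> tests C n"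
    and tests_comp: "\<lbrakk>l \<in> tests C n; h \<in> RR p \<rightarrow>\<^sub>M RR n\<rbrakk> \<Longrightarrow> (\<lambda>r\<in>space (RR p). l (h r)) \<in> tests C p"
    and tests_measurable: "\<lbrakk>l \<in> tests C n; x \<in> carrier C\<rbrakk> \<Longrightarrow> (\<lambda>r. l r x) \<in> borel_measurable (RR n)"

definition measurable_path :: "('c, 'm) mcone_scheme \<Rightarrow> nat \<Rightarrow> ((nat \<Rightarrow> real) \<Rightarrow> 'c) \<Rightarrow> bool" where
  "measurable_path C n \<gamma> \<longleftrightarrow>
     \<gamma> \<in> space (RR n) \<rightarrow> carrier C \<and>
     (\<exists>M. \<forall>s\<in>space (RR n). cnorm C (\<gamma> s) \<le> M) \<and>
     (\<forall>k. \<forall>l\<in>tests C k. (\<lambda>(r, s). l r (\<gamma> s)) \<in> borel_measurable (RR k \<Otimes>\<^sub>M RR n))"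

definition unitary_path :: "('c, 'm) mcone_scheme \<Rightarrow> nat \<Rightarrow> ((nat \<Rightarrow> real) \<Rightarrow> 'c) \<Rightarrow> bool" where
  "unitary_path C n \<gamma> \<longleftrightarrow> measurable_path C n \<gamma> \<and> \<gamma> \<in> space (RR n) \<rightarrow> cone_ball C"


section \<open>Stable functions\<close>

definition prestable :: "('c, 'm) cone_scheme \<Rightarrow> ('d, 'n) cone_scheme \<Rightarrow> ('c \<Rightarrow> 'd) \<Rightarrow> bool" where
  "prestable C D f \<longleftrightarrow>
     (\<forall>n x u. x \<in> carrier C \<longrightarrow> u \<in> {1..n} \<rightarrow> carrier C \<longrightarrow>
        x \<oplus>\<^bsub>C\<^esub> (\<Oplus>\<^bsub>C\<^esub>i\<in>{1..n}. u i) \<in> cone_ball C \<longrightarrow>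
        cone_le D
          (\<Oplus>\<^bsub>D\<^esub>I\<in>{I. I \<subseteq> {1..n} \<and> odd (n - card I)}. f (x \<oplus>\<^bsub>C\<^esub> (\<Oplus>\<^bsub>C\<^esub>i\<in>I. u i)))
          (\<Oplus>\<^bsub>D\<^esub>I\<in>{I. I \<subseteq> {1..n} \<and> even (n - card I)}. f (x \<oplus>\<^bsub>C\<^esub> (\<Oplus>\<^bsub>C\<^esub>i\<in>I. u i))))"

definition stable :: "('c, 'm) cone_scheme \<Rightarrow> ('d, 'n) cone_scheme \<Rightarrow> ('c \<Rightarrow> 'd) \<Rightarrow> bool" where
  "stable C D f \<longleftrightarrow>
     f \<in> cone_ball C \<rightarrow> carrier D \<and>
     prestable C D f \<and>
     (\<forall>s. \<forall>x\<in>cone_ball C. range s \<subseteq> cone_ball C \<longrightarrow> cone_incseq C s \<longrightarrow> cone_lub C s x \<longrightarrow>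
        cone_lub D (\<lambda>n. f (s n)) (f x)) \<and>
     (\<exists>M. \<forall>x\<in>cone_ball C. cnorm D (f x) \<le> M)"

definition cstabm_hom :: "('c, 'm) mcone_scheme \<Rightarrow> ('d, 'n) mcone_scheme \<Rightarrow> ('c \<Rightarrow> 'd) set" where
  "cstabm_hom C D =
     {f \<in> cone_ball C \<rightarrow>\<^sub>E cone_ball D.
        stable C D f \<and>
        (\<forall>n \<gamma>. unitary_path C n \<gamma> \<longrightarrow> measurable_path D n (\<lambda>r. f (\<gamma> r)))}"

definition Cstabm :: "('c mcone, 'c \<Rightarrow> 'c) category" where
  "Cstabm = \<lparr>Obj = {C. measurable_cone C}, Hom = cstabm_hom,
     Id = (\<lambda>C. \<lambda>x\<in>cone_ball C. x), Comp = (\<lambda>C D E g f. compose (cone_ball C) g f)\<rparr>"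


section \<open>The functor\<close>

definition Fm_carrier :: "'a pcs \<Rightarrow> ('a \<Rightarrow> real) set" where
  "Fm_carrier X = {(\<lambda>a. \<alpha> * x a) | \<alpha> x. 0 \<le> \<alpha> \<and> x \<in> pts X}"

definition Fm_obj :: "'a pcs \<Rightarrow> ('a \<Rightarrow> real) mcone" where
  "Fm_obj X =
     \<lparr>carrier = Fm_carrier X,
      mult = (\<lambda>_ _. undefined), one = undefined,
      zero = (\<lambda>_. 0), add = (\<lambda>x y a. x a + y a),
      smult = (\<lambda>\<alpha> x a. \<alpha> * x a),
      cnorm = (\<lambda>x. Inf {1 / r | r. 0 < r \<and> (\<lambda>a. r * x a) \<in> pts X}),
      tests = (\<lambda>n. {\<lambda>r\<in>space (RR n). \<lambda>x\<in>Fm_carrier X. 0} \<union>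
                   {(\<lambda>r\<in>space (RR n). \<lambda>x\<in>Fm_carrier X. x a) | a. a \<in> web X})\<rparr>"

definition Fm_mor :: "'a pcs \<Rightarrow> 'b pcs \<Rightarrow> ('a multiset \<Rightarrow> 'b \<Rightarrow> real) \<Rightarrow> ('a \<Rightarrow> real) \<Rightarrow> 'b \<Rightarrow> real" where
  "Fm_mor X Y f = (\<lambda>x\<in>pts X. hat X f x)"

end

theory Submission
  imports Defs "HOL-Complex_Analysis.Great_Picard"
begin

text \<open>
  A function \<open>f\<close> between cones is pre-stable iff each of its cubes \<open>I \<mapsto> f (x + \<Sum>i\<in>I. u i)\<close> is of the
  form \<open>I \<mapsto> \<Sum>J\<subseteq>I. d J\<close> with \<open>d J\<close> in the cone (\<open>cube_dec\<close>): the \<open>d J\<close> are the iterated differences.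
  In this form closure under composition only requires grouping the increments of the outer
  function by the union of their index sets, and power series with nonnegative coefficients are
  seen to be pre-stable.

  For fullness, fix a coordinate \<open>\<phi>\<close> of a stable map and expand it at dyadic points of mesh
  \<open>2\<^sup>-\<^sup>n\<close> by Newton's formula; the coefficients are iterated differences, hence nonnegative.
  Rescaled, they are bounded for each multi-index, so a diagonal subsequence converges to
  coefficients \<open>f \<nu>\<close>. Multiplying a dyadic point \<open>x\<close> by \<open>r < 1\<close> shrinks the terms of degree
  greater than \<open>p\<close> by \<open>r\<^sup>p\<close>, so the expansions converge at \<open>r x\<close>, and Scott continuity extends the
  resulting power series to all points. Faithfulness is the uniqueness of power series
  coefficients, by induction on the number of variables. Existence of composites of matrices
  follows from fullness.
\<close>

section \<open>Pre-stable functions and composition\<close>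

text \<open>The expansion result is Bernstein's theorem on absolutely monotone functions, in
  countably many variables. Two obstacles shape the proof. A cone has no subtraction, so
  inclusion-exclusion is carried out as a comparison of two nonnegative sums, one over even and one
  over odd index sets, followed by cancellation. And as the mesh shrinks, the mass of the Newton
  expansions could escape to ever higher degrees; the limits of the coefficients would then say
  nothing about \<phi>. The factor \<open>r\<close> excludes this, because its bound on the part of
  high degree is uniform in the mesh. Dyadic meshes are taken because each one refines the previous
  ones, and factors \<open>r = 1 - 2^-q\<close> because they send dyadic points to dyadic points. A
  convergent subsequence of the coefficients is enough, since its limit only has to represent
  \<phi>. The web may be infinite, but a dyadic point has finite support, so each expansion is a
  finite sum.\<close>

text \<open>Toggling a fixed element of \<open>I - K\<close> is an involution that flips the parity.
  This is the cancellation behind Moebius inversion.\<close>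

lemma card_interval_parity:
  assumes "finite I" "K \<subset> I"
  shows "card {J. K \<subseteq> J \<and> J \<subseteq> I \<and> even (card J)} = card {J. K \<subseteq> J \<and> J \<subseteq> I \<and> odd (card J)}"
proof -
  obtain i where i: "i \<in> I" "i \<notin> K" using assms by blast
  define t where "t J = (if i \<in> J then J - {i} else insert i J)" for J
  have tt: "t (t J) = J" for J by (auto simp: t_def)
  have tin: "K \<subseteq> t J \<and> t J \<subseteq> I \<and> even (card (t J)) = odd (card J)" if "K \<subseteq> J" "J \<subseteq> I" for J
  proof -
    have "finite J" using that assms finite_subset by auto
    then show ?thesis using that i
      by (cases "i \<in> J") (auto simp: t_def card_Diff_singleton card_gt_0_iff dest: card_gt_0_iff[THEN iffD2])
  qed
  have "bij_betw t {J. K \<subseteq> J \<and> J \<subseteq> I \<and> even (card J)} {J. K \<subseteq> J \<and> J \<subseteq> I \<and> odd (card J)}"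
    by (rule bij_betw_byWitness[where f' = t]) (use tin tt in auto)
  then show ?thesis by (rule bij_betw_same_card)
qed

text \<open>\<open>d\<close> is the Moebius inverse of \<open>F\<close>. Membership in the carrier
  is the real condition: in a cone it says that all differences are nonnegative. Only addition is
  involved, hence the type \<open>ring_scheme\<close> on which \<open>abelian_monoid\<close> is
  built.\<close>

definition cube_dec :: "('c, 'm) ring_scheme \<Rightarrow> 'i set \<Rightarrow> ('i set \<Rightarrow> 'c) \<Rightarrow> ('i set \<Rightarrow> 'c) \<Rightarrow> bool" where
  "cube_dec G N F d \<longleftrightarrow> d \<in> Pow N \<rightarrow> carrier G \<and> (\<forall>I. I \<subseteq> N \<longrightarrow> F I = (\<Oplus>\<^bsub>G\<^esub>J\<in>Pow I. d J))"

context abelian_monoid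
begin

lemma finsum_swap:
  assumes "finite A" "finite B" "\<And>a b. a \<in> A \<Longrightarrow> b \<in> B \<Longrightarrow> h a b \<in> carrier G"
  shows "(\<Oplus>a\<in>A. \<Oplus>b\<in>B. h a b) = (\<Oplus>b\<in>B. \<Oplus>a\<in>A. h a b)"
  using assms(1,3)
proof (induction A rule: finite_induct)
  case empty
  then show ?case by simp
next
  case (insert x F)
  have 1: "(\<lambda>a. \<Oplus>b\<in>B. h a b) \<in> F \<rightarrow> carrier G"
    using insert.prems by (auto intro!: finsum_closed)
  have 2: "(\<Oplus>b\<in>B. h x b) \<in> carrier G"
    using insert.prems by (auto intro!: finsum_closed)
  have "(\<Oplus>b\<in>B. \<Oplus>a\<in>insert x F. h a b) = (\<Oplus>b\<in>B. h x b \<oplus> (\<Oplus>a\<in>F. h a b))"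
    by (rule finsum_cong') (use insert in \<open>auto intro!: finsum_closed finsum_insert\<close>)
  also have "\<dots> = (\<Oplus>b\<in>B. h x b) \<oplus> (\<Oplus>b\<in>B. \<Oplus>a\<in>F. h a b)"
    by (rule finsum_addf) (use insert in \<open>auto intro!: finsum_closed\<close>)
  finally show ?case
    using insert 1 2 by simp
qed

lemma finsum_filter:
  assumes "finite B" "\<And>b. b \<in> B \<Longrightarrow> h b \<in> carrier G"
  shows "(\<Oplus>b\<in>{b\<in>B. P b}. h b) = (\<Oplus>b\<in>B. if P b then h b else \<zero>)"
  by (rule add.finprod_mono_neutral_cong_left) (use assms in auto)

lemma finsum_filter_const:
  assumes "finite A" "c \<in> carrier G"
  shows "(\<Oplus>a\<in>A. if P a then c else \<zero>) = add_pow G (card {a\<in>A. P a}) c"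
proof -
  have "(\<Oplus>a\<in>{a\<in>A. P a}. c) = add_pow G (card {a\<in>A. P a}) c"
    using assms by (simp add: add.finprod_const)
  then show ?thesis using finsum_filter[of A "\<lambda>_. c" P] assms by simp
qed

text \<open>Without signs, multiplicities have to be kept as \<open>add_pow\<close>. Both directions
  of the inversion below come down to comparing two such families of multiplicities.\<close>

lemma finsum_double_count:
  assumes "finite A" "finite B" "\<And>b. b \<in> B \<Longrightarrow> h b \<in> carrier G"
  shows "(\<Oplus>a\<in>A. \<Oplus>b\<in>{b\<in>B. R a b}. h b) = (\<Oplus>b\<in>B. add_pow G (card {a\<in>A. R a b}) (h b))"
proof -
  have "(\<Oplus>a\<in>A. \<Oplus>b\<in>{b\<in>B. R a b}. h b) = (\<Oplus>a\<in>A. \<Oplus>b\<in>B. if R a b then h b else \<zero>)"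
    by (rule finsum_cong') (use assms in \<open>auto intro!: finsum_closed finsum_filter\<close>)
  also have "\<dots> = (\<Oplus>b\<in>B. \<Oplus>a\<in>A. if R a b then h b else \<zero>)"
    by (rule finsum_swap) (use assms in auto)
  also have "\<dots> = (\<Oplus>b\<in>B. add_pow G (card {a\<in>A. R a b}) (h b))"
    by (rule finsum_cong') (use assms in \<open>auto intro!: finsum_filter_const\<close>)
  finally show ?thesis .
qed

text \<open>To be used with \<open>e K\<close> and \<open>o' K\<close> the numbers of sets between
  \<open>K\<close> and \<open>N\<close> of even and of odd corank. They agree by
  \<open>card_interval_parity\<close>, except at \<open>K = N\<close>, where the interval is the
  single set \<open>N\<close> of corank 0.\<close>

lemma finsum_even_odd:
  assumes N: "finite N" and H: "H \<in> Pow N \<rightarrow> carrier G"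
    and e: "\<And>K. K \<subset> N \<Longrightarrow> e K = o' K" and eN: "e N = 1" "o' N = (0::nat)"
  shows "(\<Oplus>K\<in>Pow N. add_pow G (e K) (H K)) = H N \<oplus> (\<Oplus>K\<in>Pow N. add_pow G (o' K) (H K))"
proof -
  have P: "Pow N = insert N {K. K \<subset> N}" by auto
  have fin: "finite {K. K \<subset> N}" using N by (auto intro: finite_subset[of _ "Pow N"])
  have HK: "K \<subseteq> N \<Longrightarrow> H K \<in> carrier G" for K using H by auto
  have "(\<Oplus>K\<in>{K. K \<subset> N}. add_pow G (e K) (H K)) = (\<Oplus>K\<in>{K. K \<subset> N}. add_pow G (o' K) (H K))"
    by (rule finsum_cong') (auto simp: e HK)
  moreover have "(\<Oplus>K\<in>{K. K \<subset> N}. add_pow G (o' K) (H K)) \<in> carrier G"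
    by (rule finsum_closed) (auto simp: HK)
  ultimately show ?thesis
    unfolding P using fin HK eN by (subst (1 2) finsum_insert) auto
qed

text \<open>Expanding each \<open>F I\<close>, the term \<open>d K\<close> is counted once for every
  \<open>I\<close> between \<open>K\<close> and \<open>N\<close>. Even and odd counts balance unless
  \<open>K = N\<close>, so the even sum exceeds the odd one by \<open>d N\<close>.\<close>

lemma cube_dec_alternating:
  assumes N: "finite N" and F: "cube_dec G N F d"
  shows "(\<Oplus>I\<in>{I. I \<subseteq> N \<and> even (card N - card I)}. F I) =
         (\<Oplus>I\<in>{I. I \<subseteq> N \<and> odd (card N - card I)}. F I) \<oplus> d N"
proof -
  have dc: "J \<subseteq> N \<Longrightarrow> d J \<in> carrier G" for J using F by (auto simp: cube_dec_def)
  have *: "(\<Oplus>I\<in>{I. I \<subseteq> N \<and> P (card N - card I)}. F I) =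
     (\<Oplus>K\<in>Pow N. add_pow G (card {I. K \<subseteq> I \<and> I \<subseteq> N \<and> P (card N - card I)}) (d K))" for P
  proof -
    have "(\<Oplus>I\<in>{I. I \<subseteq> N \<and> P (card N - card I)}. F I) =
      (\<Oplus>I\<in>{I. I \<subseteq> N \<and> P (card N - card I)}. \<Oplus>K\<in>{K\<in>Pow N. K \<subseteq> I}. d K)"
    proof (rule finsum_cong')
      fix I assume "I \<in> {I. I \<subseteq> N \<and> P (card N - card I)}"
      moreover from this have "{K\<in>Pow N. K \<subseteq> I} = Pow I" by auto
      ultimately show "F I = (\<Oplus>K\<in>{K\<in>Pow N. K \<subseteq> I}. d K)" using F by (simp add: cube_dec_def)
    qed (auto intro!: finsum_closed simp: dc)
    also have "\<dots> = (\<Oplus>K\<in>Pow N. add_pow G (card {I\<in>{I. I \<subseteq> N \<and> P (card N - card I)}. K \<subseteq> I}) (d K))"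
      by (rule finsum_double_count) (use N dc in auto)
    also have "(\<lambda>K. {I\<in>{I. I \<subseteq> N \<and> P (card N - card I)}. K \<subseteq> I}) =
       (\<lambda>K. {I. K \<subseteq> I \<and> I \<subseteq> N \<and> P (card N - card I)})" by auto
    then have "(\<Oplus>K\<in>Pow N. add_pow G (card {I\<in>{I. I \<subseteq> N \<and> P (card N - card I)}. K \<subseteq> I}) (d K)) =
      (\<Oplus>K\<in>Pow N. add_pow G (card {I. K \<subseteq> I \<and> I \<subseteq> N \<and> P (card N - card I)}) (d K))" by metis
    finally show ?thesis .
  qed
  \<comment> \<open>The sums are governed by the parity of the corank,
    \<open>card_interval_parity\<close> by that of the cardinality. They agree up to one global
    flip, whence the later case split on \<open>card N\<close>.\<close>
  have par: "even (card N - card I) = (even (card I) = even (card N))" if "I \<subseteq> N" for I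
    using that N card_mono[OF N that] by auto
  have 1: "card {I. K \<subseteq> I \<and> I \<subseteq> N \<and> even (card N - card I)} =
           card {I. K \<subseteq> I \<and> I \<subseteq> N \<and> odd (card N - card I)}" if "K \<subset> N" for K
    using card_interval_parity[OF N that]
    by (cases "even (card N)") (auto simp: par simp del: even_diff_nat cong: conj_cong)
  have 2: "{I. N \<subseteq> I \<and> I \<subseteq> N \<and> even (card N - card I)} = {N}" "{I. N \<subseteq> I \<and> I \<subseteq> N \<and> odd (card N - card I)} = {}"
    by auto
  have 3: "(\<Oplus>K\<in>Pow N. add_pow G (card {I. K \<subseteq> I \<and> I \<subseteq> N \<and> odd (card N - card I)}) (d K)) \<in> carrier G"
    by (rule finsum_closed) (auto simp: dc)
  have "(\<Oplus>K\<in>Pow N. add_pow G (card {I. K \<subseteq> I \<and> I \<subseteq> N \<and> even (card N - card I)}) (d K)) =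
    d N \<oplus> (\<Oplus>K\<in>Pow N. add_pow G (card {I. K \<subseteq> I \<and> I \<subseteq> N \<and> odd (card N - card I)}) (d K))"
    by (rule finsum_even_odd[OF N], use dc in blast, erule 1, unfold 2) simp_all
  then show ?thesis unfolding *[of even] *[of odd] using 3 dc by (simp add: a_comm)
qed

text \<open>The converse inversion. Adding up the alternating identities over all \<open>J\<close>
  contained in \<open>I\<close>, the terms \<open>F K\<close> balance in the same way; what remains
  is \<open>F I\<close> on one side, the sum of the \<open>d J\<close> on the other, and a common
  summand \<open>?O\<close> to cancel.\<close>

lemma cube_decI_alternating:
  assumes N: "finite N" and F: "F \<in> Pow N \<rightarrow> carrier G" and d: "d \<in> Pow N \<rightarrow> carrier G"
    and cancel: "\<And>x y z. x \<in> carrier G \<Longrightarrow> y \<in> carrier G \<Longrightarrow> z \<in> carrier G \<Longrightarrow> x \<oplus> y = x \<oplus> z \<Longrightarrow> y = z"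
    and alt: "\<And>J. J \<subseteq> N \<Longrightarrow> (\<Oplus>I\<in>{I. I \<subseteq> J \<and> even (card J - card I)}. F I) =
         (\<Oplus>I\<in>{I. I \<subseteq> J \<and> odd (card J - card I)}. F I) \<oplus> d J"
  shows "cube_dec G N F d"
  unfolding cube_dec_def
proof (intro conjI allI impI d)
  fix I assume I: "I \<subseteq> N"
  have fI: "finite I" using I N finite_subset by auto
  have Fc: "K \<subseteq> I \<Longrightarrow> F K \<in> carrier G" for K using F I by auto
  have dc: "K \<subseteq> I \<Longrightarrow> d K \<in> carrier G" for K using d I by auto
  have *: "(\<Oplus>J\<in>Pow I. \<Oplus>K\<in>{K. K \<subseteq> J \<and> P (card J - card K)}. F K) =
     (\<Oplus>K\<in>Pow I. add_pow G (card {J. K \<subseteq> J \<and> J \<subseteq> I \<and> P (card J - card K)}) (F K))" for P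
  proof -
    have "(\<Oplus>J\<in>Pow I. \<Oplus>K\<in>{K. K \<subseteq> J \<and> P (card J - card K)}. F K) =
      (\<Oplus>J\<in>Pow I. \<Oplus>K\<in>{K\<in>Pow I. K \<subseteq> J \<and> P (card J - card K)}. F K)"
    proof (rule finsum_cong')
      fix J assume "J \<in> Pow I"
      then have "{K\<in>Pow I. K \<subseteq> J \<and> P (card J - card K)} = {K. K \<subseteq> J \<and> P (card J - card K)}" by auto
      then show "(\<Oplus>K\<in>{K. K \<subseteq> J \<and> P (card J - card K)}. F K) = (\<Oplus>K\<in>{K\<in>Pow I. K \<subseteq> J \<and> P (card J - card K)}. F K)" by simp
    qed (auto intro!: finsum_closed simp: Fc)
    also have "\<dots> = (\<Oplus>K\<in>Pow I. add_pow G (card {J\<in>Pow I. K \<subseteq> J \<and> P (card J - card K)}) (F K))"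
      by (rule finsum_double_count) (use fI Fc in auto)
    also have "(\<lambda>K. {J\<in>Pow I. K \<subseteq> J \<and> P (card J - card K)}) =
       (\<lambda>K. {J. K \<subseteq> J \<and> J \<subseteq> I \<and> P (card J - card K)})" by auto
    then have "(\<Oplus>K\<in>Pow I. add_pow G (card {J\<in>Pow I. K \<subseteq> J \<and> P (card J - card K)}) (F K)) =
      (\<Oplus>K\<in>Pow I. add_pow G (card {J. K \<subseteq> J \<and> J \<subseteq> I \<and> P (card J - card K)}) (F K))" by metis
    finally show ?thesis .
  qed
  have par: "even (card J - card K) = (even (card J) = even (card K))" if "K \<subseteq> J" "J \<subseteq> I" for J K
    using that card_mono[OF finite_subset[OF that(2) fI] that(1)] by auto
  have 1: "card {J. K \<subseteq> J \<and> J \<subseteq> I \<and> even (card J - card K)} =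
           card {J. K \<subseteq> J \<and> J \<subseteq> I \<and> odd (card J - card K)}" if "K \<subset> I" for K
    using card_interval_parity[OF fI that]
    by (cases "even (card K)") (auto simp: par simp del: even_diff_nat cong: conj_cong)
  have 2: "{J. I \<subseteq> J \<and> J \<subseteq> I \<and> even (card J - card I)} = {I}" "{J. I \<subseteq> J \<and> J \<subseteq> I \<and> odd (card J - card I)} = {}"
    by auto
  let ?O = "\<Oplus>K\<in>Pow I. add_pow G (card {J. K \<subseteq> J \<and> J \<subseteq> I \<and> odd (card J - card K)}) (F K)"
  have 3: "?O \<in> carrier G"
    by (rule finsum_closed) (auto simp: Fc)
  have 4: "(\<Oplus>J\<in>Pow I. d J) \<in> carrier G" by (rule finsum_closed) (auto simp: dc)
  have "(\<Oplus>J\<in>Pow I. \<Oplus>K\<in>{K. K \<subseteq> J \<and> even (card J - card K)}. F K) =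
    (\<Oplus>J\<in>Pow I. (\<Oplus>K\<in>{K. K \<subseteq> J \<and> odd (card J - card K)}. F K) \<oplus> d J)"
    by (rule finsum_cong') (use alt I in \<open>auto intro!: finsum_closed a_closed simp: Fc dc\<close>)
  also have "\<dots> = (\<Oplus>J\<in>Pow I. (\<Oplus>K\<in>{K. K \<subseteq> J \<and> odd (card J - card K)}. F K)) \<oplus> (\<Oplus>J\<in>Pow I. d J)"
    by (rule finsum_addf) (auto intro!: finsum_closed simp: Fc dc)
  finally have "(\<Oplus>K\<in>Pow I. add_pow G (card {J. K \<subseteq> J \<and> J \<subseteq> I \<and> even (card J - card K)}) (F K)) =
     ?O \<oplus> (\<Oplus>J\<in>Pow I. d J)"
    unfolding *[of even] *[of odd] .
  moreover have "(\<Oplus>K\<in>Pow I. add_pow G (card {J. K \<subseteq> J \<and> J \<subseteq> I \<and> even (card J - card K)}) (F K)) = F I \<oplus> ?O"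
    by (rule finsum_even_odd[OF fI], use Fc in blast, erule 1, unfold 2) simp_all
  ultimately have "?O \<oplus> F I = ?O \<oplus> (\<Oplus>J\<in>Pow I. d J)"
    using 3 Fc[of I] by (simp add: a_comm)
  then show "F I = (\<Oplus>J\<in>Pow I. d J)"
    using cancel 3 4 Fc by blast
qed

end


text \<open>Affine cubes have no differences of order two or more. This is the pre-stability of the
  identity.\<close>

lemma (in abelian_monoid) cube_dec_single:
  assumes N: "finite N" and x: "x \<in> carrier G" and u: "u \<in> N \<rightarrow> carrier G"
  shows "\<exists>d. cube_dec G N (\<lambda>I. x \<oplus> (\<Oplus>i\<in>I. u i)) d"
proof -
  define d where "d J = (if J = {} then x else if is_singleton J then u (the_elem J) else \<zero>)" for J
  have dJ: "d \<in> Pow N \<rightarrow> carrier G"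
    using x funcset_mem[OF u] by (auto simp: d_def is_singleton_def)
  have "x \<oplus> (\<Oplus>i\<in>I. u i) = (\<Oplus>J\<in>Pow I. d J)" if I: "I \<subseteq> N" for I
  proof -
    have fI: "finite I" using N I finite_subset by auto
    have uI: "u \<in> I \<rightarrow> carrier G" using u I by auto
    have dI: "d \<in> Pow I \<rightarrow> carrier G" using dJ I by auto
    have "(\<Oplus>J\<in>Pow I. d J) = (\<Oplus>J\<in>insert {} ((\<lambda>i. {i}) ` I). d J)"
      by (rule add.finprod_mono_neutral_cong_right)
         (use fI dI in \<open>auto simp: d_def is_singleton_def\<close>)
    also have "\<dots> = d {} \<oplus> (\<Oplus>J\<in>(\<lambda>i. {i}) ` I. d J)"
      by (rule finsum_insert) (use fI dI in auto)
    also have "(\<Oplus>J\<in>(\<lambda>i. {i}) ` I. d J) = (\<Oplus>i\<in>I. d {i})"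
      by (rule finsum_reindex) (use dI in auto)
    also have "\<dots> = (\<Oplus>i\<in>I. u i)"
      by (rule finsum_cong') (use uI in \<open>auto simp: d_def\<close>)
    finally show ?thesis by (simp add: d_def)
  qed
  then show ?thesis using dJ by (auto simp: cube_dec_def)
qed

section \<open>Pre-stability as existence of nonnegative differences\<close>

context normed_cone
begin

text \<open>By monotonicity of the norm, all vertices of a cube are in the ball once the top one
  is.\<close>

lemma ball_subsum:
  assumes "finite N" "x \<in> carrier C" "u \<in> N \<rightarrow> carrier C" "x \<oplus> (\<Oplus>i\<in>N. u i) \<in> cone_ball C" "I \<subseteq> N"
  shows "x \<oplus> (\<Oplus>i\<in>I. u i) \<in> cone_ball C"
proof -
  have I: "finite I" "u \<in> I \<rightarrow> carrier C" "finite (N - I)" "u \<in> (N - I) \<rightarrow> carrier C"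
    using assms finite_subset by auto
  have c: "(\<Oplus>i\<in>I. u i) \<in> carrier C" "(\<Oplus>i\<in>N-I. u i) \<in> carrier C"
    using I by (auto intro!: finsum_closed)
  have "(\<Oplus>i\<in>I \<union> (N - I). u i) = (\<Oplus>i\<in>I. u i) \<oplus> (\<Oplus>i\<in>N-I. u i)"
    by (rule finsum_Un_disjoint) (use I in auto)
  also have "I \<union> (N - I) = N" using assms by auto
  finally have "x \<oplus> (\<Oplus>i\<in>N. u i) = (x \<oplus> (\<Oplus>i\<in>I. u i)) \<oplus> (\<Oplus>i\<in>N-I. u i)"
    using c assms(2) by (simp add: a_assoc)
  then show ?thesis
    using assms(2,4) c cnorm_mono[of "x \<oplus> (\<Oplus>i\<in>I. u i)" "\<Oplus>i\<in>N-I. u i"]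
    by (auto simp: cone_ball_def)
qed

end

text \<open>Pre-stability only yields the difference over a full index set \<open>{1..n}\<close>.
  Applied to every subset \<open>J\<close> of \<open>N\<close>, renumbered as
  \<open>{1..card J}\<close>, it yields all \<open>d J\<close>, and
  \<open>cube_decI_alternating\<close> assembles them. Index sets of arbitrary type are essential
  later: subsets of \<open>{1..n}\<close> in the composition, labelled steps in the Newton
  expansion.\<close>

lemma prestable_imp_cube_dec:
  assumes C: "normed_cone C" and D: "normed_cone D"
    and f: "f \<in> cone_ball C \<rightarrow> carrier D" and ps: "prestable C D f"
    and N: "finite N" and x: "x \<in> carrier C" and u: "u \<in> N \<rightarrow> carrier C"
    and b: "x \<oplus>\<^bsub>C\<^esub> (\<Oplus>\<^bsub>C\<^esub>i\<in>N. u i) \<in> cone_ball C"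
  shows "\<exists>d. cube_dec D N (\<lambda>I. f (x \<oplus>\<^bsub>C\<^esub> (\<Oplus>\<^bsub>C\<^esub>i\<in>I. u i))) d"
proof -
  interpret C: normed_cone C by fact
  interpret D: normed_cone D by fact
  let ?F = "\<lambda>I. f (x \<oplus>\<^bsub>C\<^esub> (\<Oplus>\<^bsub>C\<^esub>i\<in>I. u i))"
  have Fc: "I \<subseteq> N \<Longrightarrow> ?F I \<in> carrier D" for I
    using C.ball_subsum[OF N x u b] f by auto
  have "\<exists>z\<in>carrier D. (\<Oplus>\<^bsub>D\<^esub>I\<in>{I. I \<subseteq> J \<and> even (card J - card I)}. ?F I) =
         (\<Oplus>\<^bsub>D\<^esub>I\<in>{I. I \<subseteq> J \<and> odd (card J - card I)}. ?F I) \<oplus>\<^bsub>D\<^esub> z" if J: "J \<subseteq> N" for J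
  proof -
    have fJ: "finite J" using J N finite_subset by auto
    then obtain h where h: "bij_betw h {1..card J} J"
      using ex_bij_betw_nat_finite_1 by blast
    have hi: "inj_on h I" if "I \<subseteq> {1..card J}" for I
      using h that by (auto simp: bij_betw_def inj_on_subset)
    have hJ: "I \<subseteq> {1..card J} \<Longrightarrow> h ` I \<subseteq> J" for I using h by (auto simp: bij_betw_def)
    have uJ: "u \<in> J \<rightarrow> carrier C" using u J by auto
    have uh: "(\<Oplus>\<^bsub>C\<^esub>i\<in>I. u (h i)) = (\<Oplus>\<^bsub>C\<^esub>i\<in>h ` I. u i)" if "I \<subseteq> {1..card J}" for I
      by (rule C.finsum_reindex[symmetric]) (use hi[OF that] hJ[OF that] uJ in auto)
    \<comment> \<open>Renumbering along \<open>h\<close> preserves cardinalities, hence maps each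
      parity class of subsets onto the corresponding one.\<close>
    have P: "bij_betw ((`) h) {I. I \<subseteq> {1..card J} \<and> P (card J - card I)} {I. I \<subseteq> J \<and> P (card J - card I)}" for P
    proof (rule bij_betw_byWitness[where f' = "\<lambda>I. {i\<in>{1..card J}. h i \<in> I}"])
      show "\<forall>I\<in>{I. I \<subseteq> {1..card J} \<and> P (card J - card I)}. {i \<in> {1..card J}. h i \<in> h ` I} = I"
      proof (intro ballI)
        fix I assume "I \<in> {I. I \<subseteq> {1..card J} \<and> P (card J - card I)}"
        then have I: "I \<subseteq> {1..card J}" by simp
        have "h i \<in> h ` I \<longleftrightarrow> i \<in> I" if "i \<in> {1..card J}" for i
          using inj_on_image_mem_iff[OF hi[OF subset_refl] that I] .
        then show "{i \<in> {1..card J}. h i \<in> h ` I} = I" using I by blast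
      qed
      have s: "h ` {i \<in> {1..card J}. h i \<in> I} = I" if "I \<subseteq> J" for I
      proof -
        have "h ` {i \<in> {1..card J}. h i \<in> I} = h ` {1..card J} \<inter> I" by blast
        then show ?thesis using bij_betw_imp_surj_on[OF h] that by (simp add: Int_absorb1)
      qed
      then show "\<forall>I\<in>{I. I \<subseteq> J \<and> P (card J - card I)}. h ` {i \<in> {1..card J}. h i \<in> I} = I" by blast
      show "(`) h ` {I. I \<subseteq> {1..card J} \<and> P (card J - card I)} \<subseteq> {I. I \<subseteq> J \<and> P (card J - card I)}"
        using hJ by (auto simp: card_image[OF hi])
      show "(\<lambda>I. {i \<in> {1..card J}. h i \<in> I}) ` {I. I \<subseteq> J \<and> P (card J - card I)} \<subseteq>
         {I. I \<subseteq> {1..card J} \<and> P (card J - card I)}"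
      proof (rule image_subsetI)
        fix I assume I: "I \<in> {I. I \<subseteq> J \<and> P (card J - card I)}"
        have "card (h ` {i \<in> {1..card J}. h i \<in> I}) = card {i \<in> {1..card J}. h i \<in> I}"
          by (rule card_image) (auto intro: hi)
        then show "{i \<in> {1..card J}. h i \<in> I} \<in> {I. I \<subseteq> {1..card J} \<and> P (card J - card I)}"
          using s[of I] I by (simp add: subset_iff)
      qed
    qed
    have FhI: "?F (h ` I) \<in> carrier D" if "I \<subseteq> {1..card J}" for I
      using Fc hJ[OF that] J by (meson order_trans)
    have *: "(\<Oplus>\<^bsub>D\<^esub>I\<in>{I. I \<subseteq> {1..card J} \<and> P (card J - card I)}. f (x \<oplus>\<^bsub>C\<^esub> (\<Oplus>\<^bsub>C\<^esub>i\<in>I. u (h i)))) =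
        (\<Oplus>\<^bsub>D\<^esub>I\<in>{I. I \<subseteq> J \<and> P (card J - card I)}. ?F I)" for P
    proof -
      have "(\<Oplus>\<^bsub>D\<^esub>I\<in>{I. I \<subseteq> {1..card J} \<and> P (card J - card I)}. f (x \<oplus>\<^bsub>C\<^esub> (\<Oplus>\<^bsub>C\<^esub>i\<in>I. u (h i)))) =
          (\<Oplus>\<^bsub>D\<^esub>I\<in>{I. I \<subseteq> {1..card J} \<and> P (card J - card I)}. ?F (h ` I))"
        by (rule D.finsum_cong') (simp, use FhI in blast, simp only: uh mem_Collect_eq)
      also have "\<dots> = (\<Oplus>\<^bsub>D\<^esub>I\<in>(`) h ` {I. I \<subseteq> {1..card J} \<and> P (card J - card I)}. ?F I)"
        by (rule D.finsum_reindex[symmetric]) (use FhI in blast, rule bij_betw_imp_inj_on[OF P])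
      also have "(`) h ` {I. I \<subseteq> {1..card J} \<and> P (card J - card I)} = {I. I \<subseteq> J \<and> P (card J - card I)}"
        using P[of P] by (simp add: bij_betw_def)
      finally show ?thesis .
    qed
    have im: "h ` {1..card J} = J" using h by (simp add: bij_betw_def)
    have "x \<oplus>\<^bsub>C\<^esub> (\<Oplus>\<^bsub>C\<^esub>i\<in>{1..card J}. u (h i)) \<in> cone_ball C"
      using C.ball_subsum[OF N x u b J] uh[of "{1..card J}"] im by simp
    moreover have "(\<lambda>i. u (h i)) \<in> {1..card J} \<rightarrow> carrier C"
      using uJ im by auto
    ultimately have "cone_le D
          (\<Oplus>\<^bsub>D\<^esub>I\<in>{I. I \<subseteq> {1..card J} \<and> odd (card J - card I)}. f (x \<oplus>\<^bsub>C\<^esub> (\<Oplus>\<^bsub>C\<^esub>i\<in>I. u (h i))))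
          (\<Oplus>\<^bsub>D\<^esub>I\<in>{I. I \<subseteq> {1..card J} \<and> even (card J - card I)}. f (x \<oplus>\<^bsub>C\<^esub> (\<Oplus>\<^bsub>C\<^esub>i\<in>I. u (h i))))"
      using ps x unfolding prestable_def by blast
    then show ?thesis unfolding *[of odd] *[of even] cone_le_def by auto
  qed
  then have "\<forall>J\<in>Pow N. \<exists>z. z \<in> carrier D \<and> (\<Oplus>\<^bsub>D\<^esub>I\<in>{I. I \<subseteq> J \<and> even (card J - card I)}. ?F I) =
         (\<Oplus>\<^bsub>D\<^esub>I\<in>{I. I \<subseteq> J \<and> odd (card J - card I)}. ?F I) \<oplus>\<^bsub>D\<^esub> z" by blast
  from bchoice[OF this] obtain d where
    d: "\<forall>J\<in>Pow N. d J \<in> carrier D \<and> (\<Oplus>\<^bsub>D\<^esub>I\<in>{I. I \<subseteq> J \<and> even (card J - card I)}. ?F I) =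
         (\<Oplus>\<^bsub>D\<^esub>I\<in>{I. I \<subseteq> J \<and> odd (card J - card I)}. ?F I) \<oplus>\<^bsub>D\<^esub> d J" ..
  have "cube_dec D N ?F d"
  proof (rule D.cube_decI_alternating[OF N _ _ D.add_cancel])
    show "?F \<in> Pow N \<rightarrow> carrier D" using Fc by blast
    show "d \<in> Pow N \<rightarrow> carrier D" using d by blast
  qed (assumption | rule d[THEN bspec, THEN conjunct2], erule PowI)+
  then show ?thesis by blast
qed

text \<open>The top difference \<open>d {1..n}\<close> is the element that witnesses the order
  between the odd and the even sum.\<close>

lemma prestableI_cube_dec:
  assumes D: "normed_cone D" and f: "f \<in> cone_ball C \<rightarrow> carrier D"
    and dec: "\<And>(n::nat) x u. x \<in> carrier C \<Longrightarrow> u \<in> {1..n} \<rightarrow> carrier C \<Longrightarrow>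
      x \<oplus>\<^bsub>C\<^esub> (\<Oplus>\<^bsub>C\<^esub>i\<in>{1..n}. u i) \<in> cone_ball C \<Longrightarrow>
      \<exists>d. cube_dec D {1..n} (\<lambda>I. f (x \<oplus>\<^bsub>C\<^esub> (\<Oplus>\<^bsub>C\<^esub>i\<in>I. u i))) d"
  shows "prestable C D f"
  unfolding prestable_def cone_le_def
proof (intro allI impI)
  interpret D: normed_cone D by fact
  fix n :: nat and x u
  assume "x \<in> carrier C" "u \<in> {1..n} \<rightarrow> carrier C" "x \<oplus>\<^bsub>C\<^esub> (\<Oplus>\<^bsub>C\<^esub>i\<in>{1..n}. u i) \<in> cone_ball C"
  from dec[OF this] obtain d where d: "cube_dec D {1..n} (\<lambda>I. f (x \<oplus>\<^bsub>C\<^esub> (\<Oplus>\<^bsub>C\<^esub>i\<in>I. u i))) d" by blast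
  then show "\<exists>z\<in>carrier D. (\<Oplus>\<^bsub>D\<^esub>I\<in>{I. I \<subseteq> {1..n} \<and> even (n - card I)}. f (x \<oplus>\<^bsub>C\<^esub> (\<Oplus>\<^bsub>C\<^esub>i\<in>I. u i))) =
      (\<Oplus>\<^bsub>D\<^esub>I\<in>{I. I \<subseteq> {1..n} \<and> odd (n - card I)}. f (x \<oplus>\<^bsub>C\<^esub> (\<Oplus>\<^bsub>C\<^esub>i\<in>I. u i))) \<oplus>\<^bsub>D\<^esub> z"
    using D.cube_dec_alternating[OF _ d] by (intro bexI[of _ "d {1..n}"]) (auto simp: cube_dec_def)
qed

section \<open>Composition of stable functions\<close>

lemma prestable_compose:
  assumes C: "normed_cone C" and D: "normed_cone D" and E: "normed_cone E"
    and f: "f \<in> cone_ball C \<rightarrow> cone_ball D" "prestable C D f"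
    and g: "g \<in> cone_ball D \<rightarrow> carrier E" "prestable D E g"
  shows "prestable C E (\<lambda>x. g (f x))"
proof (rule prestableI_cube_dec[OF E])
  interpret C: normed_cone C by fact
  interpret D: normed_cone D by fact
  interpret E: normed_cone E by fact
  show "(\<lambda>x. g (f x)) \<in> cone_ball C \<rightarrow> carrier E" using f(1) g(1) by auto
  have f1: "f \<in> cone_ball C \<rightarrow> carrier D" using f by (auto simp: cone_ball_def)
  fix n :: nat and x u
  assume x: "x \<in> carrier C" and u: "u \<in> {1..n} \<rightarrow> carrier C" and b: "x \<oplus>\<^bsub>C\<^esub> (\<Oplus>\<^bsub>C\<^esub>i\<in>{1..n}. u i) \<in> cone_ball C"
  let ?N = "{1..n}"
  let ?F = "\<lambda>I. f (x \<oplus>\<^bsub>C\<^esub> (\<Oplus>\<^bsub>C\<^esub>i\<in>I. u i))"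
  \<comment> \<open>The cube seen by \<open>g\<close> has the nonempty subsets \<open>J\<close> of
    \<open>?N\<close> as directions, with base point \<open>d {}\<close> and increments
    \<open>d J\<close>. The vertex \<open>I\<close> of the original cube becomes its vertex
    \<open>Pow I - {{}}\<close>.\<close>
  let ?K = "Pow ?N - {{}}"
  obtain d where d: "cube_dec D ?N ?F d"
    using prestable_imp_cube_dec[OF C D f1 f(2) _ x u b] by auto
  have dc: "J \<subseteq> ?N \<Longrightarrow> d J \<in> carrier D" for J using d by (auto simp: cube_dec_def)
  have Fd: "?F I = d {} \<oplus>\<^bsub>D\<^esub> (\<Oplus>\<^bsub>D\<^esub>J\<in>Pow I - {{}}. d J)" if I: "I \<subseteq> ?N" for I
  proof -
    have "Pow I = insert {} (Pow I - {{}})" by auto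
    then have "?F I = (\<Oplus>\<^bsub>D\<^esub>J\<in>insert {} (Pow I - {{}}). d J)" using d I by (auto simp: cube_dec_def)
    also have "\<dots> = d {} \<oplus>\<^bsub>D\<^esub> (\<Oplus>\<^bsub>D\<^esub>J\<in>Pow I - {{}}. d J)"
      by (rule D.finsum_insert) (use I dc in \<open>auto intro: finite_subset\<close>)
    finally show ?thesis .
  qed
  have "d {} \<oplus>\<^bsub>D\<^esub> (\<Oplus>\<^bsub>D\<^esub>J\<in>?K. d J) \<in> cone_ball D"
    using funcset_mem[OF f(1) b] Fd[of ?N] by simp
  then obtain e where e: "cube_dec E ?K (\<lambda>S. g (d {} \<oplus>\<^bsub>D\<^esub> (\<Oplus>\<^bsub>D\<^esub>J\<in>S. d J))) e"
    using prestable_imp_cube_dec[OF D E g(1) g(2), of ?K "d {}" d] dc by auto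
  have ec: "S \<subseteq> ?K \<Longrightarrow> e S \<in> carrier E" for S using e by (auto simp: cube_dec_def)
  \<comment> \<open>The increments of the composite are collected according to the union of the index sets.\<close>
  define w where "w J = (\<Oplus>\<^bsub>E\<^esub>S\<in>{S. S \<subseteq> ?K \<and> \<Union>S = J}. e S)" for J
  have "cube_dec E ?N (\<lambda>I. g (?F I)) w"
    unfolding cube_dec_def
  proof (intro conjI allI impI)
    show "w \<in> Pow ?N \<rightarrow> carrier E" unfolding w_def by (intro Pi_I E.finsum_closed) (simp add: ec)
    fix I assume I: "I \<subseteq> ?N"
    have "Pow I - {{}} \<subseteq> ?K" using I by auto
    then have "g (?F I) = (\<Oplus>\<^bsub>E\<^esub>S\<in>Pow (Pow I - {{}}). e S)"
      using e unfolding Fd[OF I] cube_dec_def by blast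
    also have "Pow (Pow I - {{}}) = (\<Union>J\<in>Pow I. {S. S \<subseteq> ?K \<and> \<Union>S = J})"
      using I by auto
    also have "(\<Oplus>\<^bsub>E\<^esub>S\<in>\<dots>. e S) = (\<Oplus>\<^bsub>E\<^esub>J\<in>Pow I. w J)"
      unfolding w_def
      by (rule E.add.finprod_UN_disjoint)
         (use I ec in \<open>auto intro: finite_subset simp: pairwise_def disjnt_def\<close>)
    finally show "g (?F I) = (\<Oplus>\<^bsub>E\<^esub>J\<in>Pow I. w J)" .
  qed
  then show "\<exists>d. cube_dec E ?N (\<lambda>I. g (?F I)) d" by blast
qed

text \<open>The one-dimensional cube, with index set \<open>{()}\<close>: \<open>f y\<close> is
  \<open>f x\<close> plus the difference \<open>d {()}\<close>.\<close>

lemma prestable_mono: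
  assumes C: "normed_cone C" and f: "f \<in> cone_ball C \<rightarrow> carrier D" "prestable C D f" and D: "normed_cone D"
    and xy: "x \<in> carrier C" "y \<in> cone_ball C" "cone_le C x y"
  shows "cone_le D (f x) (f y)"
proof -
  interpret C: normed_cone C by fact
  interpret D: normed_cone D by fact
  obtain z where z: "z \<in> carrier C" "y = x \<oplus>\<^bsub>C\<^esub> z" using xy by (auto simp: cone_le_def)
  have xb: "x \<in> cone_ball C"
    using C.ball_subsum[of "{()}" x "\<lambda>_. z" "{}"] z xy by simp
  obtain d where d: "cube_dec D {()} (\<lambda>I. f (x \<oplus>\<^bsub>C\<^esub> (\<Oplus>\<^bsub>C\<^esub>i\<in>I. z))) d"
    using prestable_imp_cube_dec[OF C D f, of "{()}" x "\<lambda>_. z"] z xy by auto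
  have dc: "d {} \<in> carrier D" "d {()} \<in> carrier D" using d by (auto simp: cube_dec_def)
  have "f x = d {}" "f y = d {} \<oplus>\<^bsub>D\<^esub> d {()}"
    using d[unfolded cube_dec_def, THEN conjunct2, rule_format, of "{}"]
      d[unfolded cube_dec_def, THEN conjunct2, rule_format, of "{()}"] z xy dc
    by (simp_all add: Pow_insert D.a_comm)
  then show ?thesis using dc by (auto simp: cone_le_def)
qed

lemma stable_compose:
  assumes C: "normed_cone C" and D: "normed_cone D" and E: "normed_cone E"
    and f: "f \<in> cone_ball C \<rightarrow> cone_ball D" "stable C D f"
    and g: "stable D E g"
  shows "stable C E (\<lambda>x. g (f x))"
proof -
  have fc: "f \<in> cone_ball C \<rightarrow> carrier D" using f(2) by (simp add: stable_def)
  have inc: "cone_incseq D (\<lambda>n. f (s n))" if "range s \<subseteq> cone_ball C" "cone_incseq C s" for s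
    using that prestable_mono[OF C fc _ D] f(2)
    by (auto simp: cone_incseq_def stable_def cone_ball_def image_subset_iff)
  show ?thesis
    unfolding stable_def
  proof (intro conjI allI ballI impI)
    show "prestable C E (\<lambda>x. g (f x))"
      using f g by (intro prestable_compose[OF C D E]) (auto simp: stable_def)
    show "(\<lambda>x. g (f x)) \<in> cone_ball C \<rightarrow> carrier E" using f g by (auto simp: stable_def Pi_iff)
    obtain M where "\<forall>x\<in>cone_ball D. cnorm E (g x) \<le> M" using g by (auto simp: stable_def)
    then show "\<exists>M. \<forall>x\<in>cone_ball C. cnorm E (g (f x)) \<le> M" using f by (intro exI[of _ M]) auto
    fix s x assume s: "x \<in> cone_ball C" "range s \<subseteq> cone_ball C" "cone_incseq C s" "cone_lub C s x"
    then have "cone_lub D (\<lambda>n. f (s n)) (f x)" using f(2) by (auto simp: stable_def)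
    moreover have "range (\<lambda>n. f (s n)) \<subseteq> cone_ball D" "f x \<in> cone_ball D" using f(1) s by auto
    ultimately show "cone_lub E (\<lambda>n. g (f (s n))) (g (f x))"
      using g inc[OF s(2,3)] by (simp add: stable_def)
  qed
qed

text \<open>Every vertex of an admissible cube is in the ball, so stability depends on the values
  there only. This transfers it to the extensional representatives that serve as morphisms.\<close>

lemma stable_cong:
  assumes "\<And>x. x \<in> cone_ball C \<Longrightarrow> f x = g x" "normed_cone C" "stable C D f" "normed_cone D"
  shows "stable C D g"
proof -
  interpret C: normed_cone C by fact
  interpret D: normed_cone D by fact
  have fc: "f \<in> cone_ball C \<rightarrow> carrier D" "prestable C D f" using assms(3) by (auto simp: stable_def)
  have gc: "g \<in> cone_ball C \<rightarrow> carrier D" using assms(1) funcset_mem[OF fc(1)] by (intro Pi_I) metis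
  have "prestable C D g"
  proof (rule prestableI_cube_dec[OF assms(4) gc])
    fix n :: nat and x u
    assume *: "x \<in> carrier C" "u \<in> {1..n} \<rightarrow> carrier C" "x \<oplus>\<^bsub>C\<^esub> (\<Oplus>\<^bsub>C\<^esub>i\<in>{1..n}. u i) \<in> cone_ball C"
    obtain d where "cube_dec D {1..n} (\<lambda>I. f (x \<oplus>\<^bsub>C\<^esub> (\<Oplus>\<^bsub>C\<^esub>i\<in>I. u i))) d"
      using prestable_imp_cube_dec[OF assms(2,4) fc _ *] by auto
    then show "\<exists>d. cube_dec D {1..n} (\<lambda>I. g (x \<oplus>\<^bsub>C\<^esub> (\<Oplus>\<^bsub>C\<^esub>i\<in>I. u i))) d"
      using C.ball_subsum[OF _ *] assms(1) by (auto simp: cube_dec_def)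
  qed
  moreover have "cone_lub D (\<lambda>n. g (s n)) (g x)" if "x \<in> cone_ball C" "range s \<subseteq> cone_ball C" "cone_incseq C s" "cone_lub C s x" for s x
  proof -
    have "(\<lambda>n. g (s n)) = (\<lambda>n. f (s n))" using assms(1) that(2) by (auto simp: fun_eq_iff image_subset_iff)
    then show ?thesis using assms(1,3) that by (simp add: stable_def)
  qed
  ultimately show ?thesis using assms gc by (simp add: stable_def)
qed

lemma stable_id:
  assumes C: "normed_cone C"
  shows "stable C C (\<lambda>x. x)"
proof -
  interpret C: normed_cone C by fact
  have "prestable C C (\<lambda>x. x)"
    by (rule prestableI_cube_dec[OF C]) (auto simp: cone_ball_def intro!: C.cube_dec_single)
  then show ?thesis by (auto simp: stable_def cone_ball_def)
qed

section \<open>Measurable paths and the category of measurable cones\<close>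

lemma measurable_path_cong:
  assumes eq: "\<And>r. r \<in> space (RR n) \<Longrightarrow> \<gamma> r = \<gamma>' r" and \<gamma>: "measurable_path C n \<gamma>"
  shows "measurable_path C n \<gamma>'"
proof -
  have *: "(\<lambda>(r, s). l r (\<gamma>' s)) \<in> borel_measurable (RR k \<Otimes>\<^sub>M RR n)" if "l \<in> tests C k" for k l
  proof (rule measurable_cong[THEN iffD1])
    show "(\<lambda>(r, s). l r (\<gamma> s)) \<in> borel_measurable (RR k \<Otimes>\<^sub>M RR n)"
      using \<gamma> that unfolding measurable_path_def by blast
  qed (auto simp: space_pair_measure eq)
  show ?thesis
    unfolding measurable_path_def
  proof (intro conjI allI ballI *)
    show "\<gamma>' \<in> space (RR n) \<rightarrow> carrier C" "\<exists>M. \<forall>s\<in>space (RR n). cnorm C (\<gamma>' s) \<le> M"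
      using \<gamma> eq by (auto simp: measurable_path_def Pi_iff)
  qed
qed

lemma cstabm_hom_compose:
  assumes C: "measurable_cone C" "measurable_cone D" "measurable_cone E"
    and fg: "f \<in> cstabm_hom C D" "g \<in> cstabm_hom D E"
  shows "compose (cone_ball C) g f \<in> cstabm_hom C E"
  unfolding cstabm_hom_def
proof (intro CollectI conjI allI impI)
  interpret C: measurable_cone C by (rule C(1))
  interpret D: measurable_cone D by (rule C(2))
  interpret E: measurable_cone E by (rule C(3))
  have f: "f \<in> cone_ball C \<rightarrow> cone_ball D" "stable C D f" and g: "g \<in> cone_ball D \<rightarrow> cone_ball E" "stable D E g"
    using fg by (auto simp: cstabm_hom_def)
  show "stable C E (compose (cone_ball C) g f)"
    by (rule stable_cong[OF _ C.normed_cone_axioms stable_compose[OF C.normed_cone_axioms D.normed_cone_axioms E.normed_cone_axioms f g(2)] E.normed_cone_axioms])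
       (auto simp: compose_def)
  show "compose (cone_ball C) g f \<in> cone_ball C \<rightarrow>\<^sub>E cone_ball E" using f g by (auto simp: compose_def)
  fix n \<gamma> assume \<gamma>: "unitary_path C n \<gamma>"
  \<comment> \<open>\<open>f\<close> maps ball to ball, so the image path is not just measurable but
    unitary, as \<open>g\<close> requires.\<close>
  then have "unitary_path D n (\<lambda>r. f (\<gamma> r))" using fg(1) f(1) by (auto simp: cstabm_hom_def unitary_path_def)
  then have "measurable_path E n (\<lambda>r. g (f (\<gamma> r)))" using fg(2) by (auto simp: cstabm_hom_def)
  then show "measurable_path E n (\<lambda>r. compose (cone_ball C) g f (\<gamma> r))"
    by (rule measurable_path_cong[rotated]) (use \<gamma> in \<open>auto simp: unitary_path_def compose_def\<close>)
qed

lemma is_category_Cstabm: "is_category (Cstabm :: ('c mcone, 'c \<Rightarrow> 'c) category)"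
proof -
  have nc: "normed_cone C" if "measurable_cone C" for C :: "'c mcone"
    using that by (simp add: measurable_cone_def seq_complete_cone_def)
  have id: "(\<lambda>x\<in>cone_ball C. x) \<in> cstabm_hom C C" if C: "measurable_cone C" for C :: "'c mcone"
    unfolding cstabm_hom_def
  proof (intro CollectI conjI allI impI)
    show "stable C C (\<lambda>x\<in>cone_ball C. x)"
      by (rule stable_cong[OF _ nc[OF C] stable_id[OF nc[OF C]] nc[OF C]]) auto
    fix n \<gamma> assume \<gamma>: "unitary_path C n \<gamma>"
    then have "measurable_path C n \<gamma>" by (simp add: unitary_path_def)
    then show "measurable_path C n (\<lambda>r. (\<lambda>x\<in>cone_ball C. x) (\<gamma> r))"
      by (rule measurable_path_cong[rotated]) (use \<gamma> in \<open>auto simp: unitary_path_def\<close>)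
  qed auto
  have idl: "compose (cone_ball C) f (\<lambda>x\<in>cone_ball C. x) = f" "compose (cone_ball C) (\<lambda>x\<in>cone_ball D. x) f = f"
    if "f \<in> cstabm_hom C D" for C D :: "'c mcone" and f
    using that by (auto simp: cstabm_hom_def compose_def PiE_iff fun_eq_iff extensional_def)
  have assoc: "compose (cone_ball C) h (compose (cone_ball C) g f) = compose (cone_ball C) (compose (cone_ball D) h g) f"
    if "f \<in> cstabm_hom C D" for C D :: "'c mcone" and f g h
    using that by (auto simp: cstabm_hom_def compose_def fun_eq_iff)
  show ?thesis
    unfolding is_category_def Cstabm_def category.simps mem_Collect_eq
    by (intro conjI ballI id cstabm_hom_compose[rotated 3] idl assoc) (assumption | erule CollectD)+
qed

section \<open>The measurable cone of a probabilistic coherence space\<close>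

text \<open>A sum in \<open>[0, \<infinity>]\<close> is the supremum of its finite partial sums.
  Polarity thus becomes a family of finite conditions, which survive pointwise limits.\<close>

lemma infsum_ennreal_le_iff:
  fixes f :: "'a \<Rightarrow> real"
  assumes "\<And>a. a \<in> A \<Longrightarrow> 0 \<le> f a"
  shows "(\<Sum>\<^sub>\<infinity>a\<in>A. ennreal (f a)) \<le> 1 \<longleftrightarrow> (\<forall>F. finite F \<longrightarrow> F \<subseteq> A \<longrightarrow> sum f F \<le> 1)"
proof -
  have "(\<Sum>a\<in>F. ennreal (f a)) \<le> 1 \<longleftrightarrow> sum f F \<le> 1" if "F \<subseteq> A" for F
    using assms that by (subst sum_ennreal) auto
  then show ?thesis
    by (subst nonneg_infsum_complete) (auto simp: SUP_le_iff)
qed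

lemma nnvec_nonneg: "u \<in> nnvec A \<Longrightarrow> 0 \<le> u a"
  by (cases "a \<in> A") (auto simp: nnvec_def)

lemma polar_iff:
  assumes "S \<subseteq> nnvec A"
  shows "u \<in> polar A S \<longleftrightarrow> u \<in> nnvec A \<and> (\<forall>v\<in>S. \<forall>F. finite F \<longrightarrow> F \<subseteq> A \<longrightarrow> (\<Sum>a\<in>F. u a * v a) \<le> 1)"
proof -
  have "(\<Sum>\<^sub>\<infinity>a\<in>A. ennreal (u a * v a)) \<le> 1 \<longleftrightarrow> (\<forall>F. finite F \<longrightarrow> F \<subseteq> A \<longrightarrow> (\<Sum>a\<in>F. u a * v a) \<le> 1)"
    if "u \<in> nnvec A" "v \<in> S" for v
    by (rule infsum_ennreal_le_iff) (use that assms in \<open>auto intro!: mult_nonneg_nonneg intro: nnvec_nonneg\<close>)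
  then show ?thesis by (auto simp: polar_def)
qed

lemma polar_subset_nnvec: "polar A S \<subseteq> nnvec A"
  by (auto simp: polar_def)

locale pcspace =
  fixes X :: "'a pcs"
  assumes is_pcs: "is_pcs X"
begin

abbreviation "dual_pts \<equiv> polar (web X) (pts X)"

lemma countable_web: "countable (web X)"
  and pts_nnvec: "pts X \<subseteq> nnvec (web X)"
  and web_unit: "a \<in> web X \<Longrightarrow> \<exists>c>0. (\<lambda>b. if b = a then c else 0) \<in> pts X"
  and web_bounded: "a \<in> web X \<Longrightarrow> \<exists>M. \<forall>u\<in>pts X. u a \<le> M"
  using is_pcs by (auto simp: is_pcs_def)

lemma pts_nonneg: "x \<in> pts X \<Longrightarrow> 0 \<le> x a"
  by (rule nnvec_nonneg[OF subsetD[OF pts_nnvec]])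

lemma pts_outside: "x \<in> pts X \<Longrightarrow> a \<notin> web X \<Longrightarrow> x a = 0"
  using pts_nnvec by (auto simp: nnvec_def)

lemma dual_nonneg: "v \<in> dual_pts \<Longrightarrow> 0 \<le> v a"
  by (rule nnvec_nonneg[OF subsetD[OF polar_subset_nnvec]])

text \<open>The bipolar condition cuts \<open>pts X\<close> out by finite linear inequalities with
  nonnegative coefficients. Downward closure, convexity and closure under pointwise limits are all
  read off from this form.\<close>

lemma pts_iff: "u \<in> pts X \<longleftrightarrow> u \<in> nnvec (web X) \<and>
    (\<forall>v\<in>dual_pts. \<forall>F. finite F \<longrightarrow> F \<subseteq> web X \<longrightarrow> (\<Sum>a\<in>F. u a * v a) \<le> 1)"
proof -
  have "polar (web X) dual_pts = pts X" using is_pcs by (simp add: is_pcs_def)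
  then show ?thesis using polar_iff[of dual_pts "web X" u, OF polar_subset_nnvec] by simp
qed

lemma pts_sum_le: "u \<in> pts X \<Longrightarrow> v \<in> dual_pts \<Longrightarrow> finite F \<Longrightarrow> F \<subseteq> web X \<Longrightarrow> (\<Sum>a\<in>F. u a * v a) \<le> 1"
  using pts_iff by blast

lemma zero_pts: "(\<lambda>_. 0) \<in> pts X"
  by (auto simp: pts_iff nnvec_def)

lemma pts_down:
  assumes "u \<in> pts X" "\<And>a. 0 \<le> v a" "\<And>a. v a \<le> u a"
  shows "v \<in> pts X"
  unfolding pts_iff
proof (intro conjI ballI allI impI)
  show "v \<in> nnvec (web X)"
    using assms pts_outside[OF assms(1)] by (auto simp: nnvec_def) (metis antisym)
  fix w F assume w: "w \<in> dual_pts" "finite F" "F \<subseteq> web X"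
  have "(\<Sum>a\<in>F. v a * w a) \<le> (\<Sum>a\<in>F. u a * w a)"
    using assms dual_nonneg[OF w(1)] by (intro sum_mono mult_right_mono) auto
  then show "(\<Sum>a\<in>F. v a * w a) \<le> 1" using pts_sum_le[OF assms(1) w] by simp
qed

lemma pts_convex:
  assumes "u \<in> pts X" "v \<in> pts X" "0 \<le> s" "0 \<le> t" "s + t \<le> 1"
  shows "(\<lambda>a. s * u a + t * v a) \<in> pts X"
  unfolding pts_iff
proof (intro conjI ballI allI impI)
  show "(\<lambda>a. s * u a + t * v a) \<in> nnvec (web X)"
    using assms by (auto simp: nnvec_def pts_outside pts_nonneg)
  fix w F assume w: "w \<in> dual_pts" "finite F" "F \<subseteq> web X"
  have "(\<Sum>a\<in>F. (s * u a + t * v a) * w a) = s * (\<Sum>a\<in>F. u a * w a) + t * (\<Sum>a\<in>F. v a * w a)"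
    by (simp add: sum_distrib_left sum.distrib algebra_simps)
  also have "\<dots> \<le> s * 1 + t * 1"
    using pts_sum_le[OF _ w] assms by (intro add_mono mult_left_mono) auto
  finally show "(\<Sum>a\<in>F. (s * u a + t * v a) * w a) \<le> 1" using assms by simp
qed

lemma pts_limit:
  assumes "\<And>n. s n \<in> pts X" "\<And>a. (\<lambda>n. s n a) \<longlonglongrightarrow> u a"
  shows "u \<in> pts X"
  unfolding pts_iff
proof (intro conjI ballI allI impI)
  have "0 \<le> u a" for a
    by (rule LIMSEQ_le_const[OF assms(2)]) (use pts_nonneg[OF assms(1)] in auto)
  moreover have "u a = 0" if "a \<notin> web X" for a
  proof -
    have "(\<lambda>n. s n a) = (\<lambda>_. 0)" using pts_outside[OF assms(1) that] by auto
    then show ?thesis using assms(2)[of a] LIMSEQ_unique[OF tendsto_const] by metis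
  qed
  ultimately show "u \<in> nnvec (web X)" by (auto simp: nnvec_def)
  fix w F assume w: "w \<in> dual_pts" "finite F" "F \<subseteq> web X"
  have "(\<lambda>n. \<Sum>a\<in>F. s n a * w a) \<longlonglongrightarrow> (\<Sum>a\<in>F. u a * w a)"
    by (intro tendsto_intros assms)
  then show "(\<Sum>a\<in>F. u a * w a) \<le> 1"
    by (rule LIMSEQ_le_const2) (use pts_sum_le[OF assms(1) w] in auto)
qed

section \<open>The carrier and the norm\<close>

lemma carrier_iff: "x \<in> Fm_carrier X \<longleftrightarrow> (\<exists>r>0. (\<lambda>a. r * x a) \<in> pts X)"
proof
  assume "x \<in> Fm_carrier X"
  then obtain \<alpha> y where x: "x = (\<lambda>a. \<alpha> * y a)" "0 \<le> \<alpha>" "y \<in> pts X" by (auto simp: Fm_carrier_def)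
  show "\<exists>r>0. (\<lambda>a. r * x a) \<in> pts X"
  proof (cases "\<alpha> = 0")
    case True
    then show ?thesis using x zero_pts by (intro exI[of _ 1]) auto
  next
    case False
    then show ?thesis using x by (intro exI[of _ "1 / \<alpha>"]) auto
  qed
next
  assume "\<exists>r>0. (\<lambda>a. r * x a) \<in> pts X"
  then obtain r where r: "r > 0" "(\<lambda>a. r * x a) \<in> pts X" by blast
  then show "x \<in> Fm_carrier X"
    unfolding Fm_carrier_def by (intro CollectI exI[of _ "1/r"] exI[of _ "\<lambda>a. r * x a"]) auto
qed

lemma pts_carrier: "x \<in> pts X \<Longrightarrow> x \<in> Fm_carrier X"
  unfolding carrier_iff by (intro exI[of _ 1]) auto

lemma carrier_nonneg: "x \<in> Fm_carrier X \<Longrightarrow> 0 \<le> x a"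
  by (auto simp: Fm_carrier_def pts_nonneg)

lemma carrier_outside: "x \<in> Fm_carrier X \<Longrightarrow> a \<notin> web X \<Longrightarrow> x a = 0"
  by (auto simp: Fm_carrier_def pts_outside)

lemma carrier_down:
  assumes "u \<in> Fm_carrier X" "\<And>a. 0 \<le> v a" "\<And>a. v a \<le> u a"
  shows "v \<in> Fm_carrier X"
proof -
  obtain r where r: "r > 0" "(\<lambda>a. r * u a) \<in> pts X" using assms carrier_iff by blast
  then have "(\<lambda>a. r * v a) \<in> pts X"
    using assms by (intro pts_down[OF r(2)]) auto
  then show ?thesis using r carrier_iff by blast
qed

lemma carrier_scale:
  assumes "u \<in> Fm_carrier X" "0 \<le> t"
  shows "(\<lambda>a. t * u a) \<in> Fm_carrier X"
proof -
  obtain \<alpha> y where x: "u = (\<lambda>a. \<alpha> * y a)" "0 \<le> \<alpha>" "y \<in> pts X" using assms by (auto simp: Fm_carrier_def)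
  then show ?thesis
    unfolding Fm_carrier_def using assms by (intro CollectI exI[of _ "t * \<alpha>"] exI[of _ y]) (auto simp: mult.assoc)
qed

lemma carrier_add:
  assumes "x \<in> Fm_carrier X" "y \<in> Fm_carrier X"
  shows "(\<lambda>a. x a + y a) \<in> Fm_carrier X"
proof -
  obtain r s where r: "r > 0" "(\<lambda>a. r * x a) \<in> pts X" and s: "s > 0" "(\<lambda>a. s * y a) \<in> pts X"
    using assms carrier_iff by blast
  \<comment> \<open>The weights are chosen so that \<open>x\<close> and \<open>y\<close> receive the
    same factor \<open>r * s / (r + s)\<close>.\<close>
  have "(\<lambda>a. s / (r + s) * (r * x a) + r / (r + s) * (s * y a)) \<in> pts X"
    by (rule pts_convex) (use r s in \<open>auto simp: add_divide_distrib[symmetric] add.commute\<close>)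
  also have "(\<lambda>a. s / (r + s) * (r * x a) + r / (r + s) * (s * y a)) = (\<lambda>a. (r * s / (r + s)) * (x a + y a))"
    by (simp add: fun_eq_iff add_divide_distrib distrib_left mult.assoc mult.left_commute)
  finally show ?thesis unfolding carrier_iff using r s by (intro exI[of _ "r * s / (r + s)"]) auto
qed

definition nrm :: "('a \<Rightarrow> real) \<Rightarrow> real" where
  "nrm x = Inf {1 / r | r. 0 < r \<and> (\<lambda>a. r * x a) \<in> pts X}"

lemma nrm_bdd: "bdd_below {1 / r | r. 0 < r \<and> (\<lambda>a. r * x a) \<in> pts X}"
  by (rule bdd_belowI[of _ 0]) auto

lemma nrm_nonneg: "x \<in> Fm_carrier X \<Longrightarrow> 0 \<le> nrm x"
  unfolding nrm_def carrier_iff by (rule cInf_greatest) auto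

lemma nrm_leI: "0 < t \<Longrightarrow> (\<lambda>a. x a / t) \<in> pts X \<Longrightarrow> nrm x \<le> t"
  unfolding nrm_def by (rule cInf_lower[OF _ nrm_bdd]) (auto intro!: exI[of _ "1/t"])

lemma nrm_lessD:
  assumes "x \<in> Fm_carrier X" "nrm x < t"
  shows "(\<lambda>a. x a / t) \<in> pts X"
proof -
  have ne: "{1 / r | r. 0 < r \<and> (\<lambda>a. r * x a) \<in> pts X} \<noteq> {}" using assms(1) by (auto simp: carrier_iff)
  obtain r where r: "0 < r" "(\<lambda>a. r * x a) \<in> pts X" "1 / r < t"
    using assms(2) unfolding nrm_def cInf_less_iff[OF ne nrm_bdd] by auto
  have t: "0 < t" using nrm_nonneg[OF assms(1)] assms(2) by simp
  show ?thesis
  proof (rule pts_down[OF r(2)])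
    show "0 \<le> x a / t" for a using carrier_nonneg[OF assms(1)] t by simp
    have "1 / t \<le> r" using r t by (simp add: field_simps)
    then show "x a / t \<le> r * x a" for a using mult_right_mono[OF _ carrier_nonneg[OF assms(1)], of "1/t" r] by simp
  qed
qed

text \<open>The infimum in the norm is attained, because \<open>pts X\<close> is closed under
  pointwise limits. Hence the unit ball is exactly \<open>pts X\<close>.\<close>

lemma nrm_le_iff:
  assumes "x \<in> Fm_carrier X" "0 < t"
  shows "nrm x \<le> t \<longleftrightarrow> (\<lambda>a. x a / t) \<in> pts X"
proof
  assume *: "nrm x \<le> t"
  show "(\<lambda>a. x a / t) \<in> pts X"
  proof (rule pts_limit)
    show "(\<lambda>a. x a / (t + 1 / Suc n)) \<in> pts X" for n
      by (rule nrm_lessD[OF assms(1)]) (use * in \<open>simp add: add_pos_pos less_add_same_cancel1 le_less_trans\<close>)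
    have "(\<lambda>n. 1 / real (Suc n)) \<longlonglongrightarrow> 0" using LIMSEQ_inverse_real_of_nat by (simp add: inverse_eq_divide)
    then have "(\<lambda>n. x a / (t + 1 / Suc n)) \<longlonglongrightarrow> x a / (t + 0)" for a
      using assms(2) by (intro tendsto_intros) auto
    then show "(\<lambda>n. x a / (t + 1 / Suc n)) \<longlonglongrightarrow> x a / t" for a by simp
  qed
qed (rule nrm_leI[OF assms(2)])

lemma nrm_le_1_iff: "x \<in> Fm_carrier X \<and> nrm x \<le> 1 \<longleftrightarrow> x \<in> pts X"
  using nrm_le_iff[of x 1] pts_carrier by auto

lemma nrm_mono:
  assumes "y \<in> Fm_carrier X" "\<And>a. 0 \<le> x a" "\<And>a. x a \<le> y a"
  shows "nrm x \<le> nrm y"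
proof (rule dense_ge)
  fix t assume "nrm y < t"
  then have y: "(\<lambda>a. y a / t) \<in> pts X" and t: "t > 0"
    using nrm_lessD[OF assms(1)] nrm_nonneg[OF assms(1)] by auto
  show "nrm x \<le> t"
    by (intro nrm_leI t pts_down[OF y]) (use assms t in \<open>auto intro: divide_right_mono\<close>)
qed

lemma nrm_triangle:
  assumes "x \<in> Fm_carrier X" "y \<in> Fm_carrier X"
  shows "nrm (\<lambda>a. x a + y a) \<le> nrm x + nrm y"
proof (rule field_le_epsilon)
  fix e :: real assume e: "e > 0"
  define s t where "s = nrm x + e / 2" "t = nrm y + e / 2"
  have st: "s > 0" "t > 0" using e nrm_nonneg assms unfolding s_t_def by (simp_all add: add_nonneg_pos)
  have x: "(\<lambda>a. x a / s) \<in> pts X" "(\<lambda>a. y a / t) \<in> pts X"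
    using e by (auto intro!: nrm_lessD assms simp: s_t_def)
  \<comment> \<open>Weights proportional to the approximate norms \<open>s\<close> and
    \<open>t\<close> turn the two normalised points into the normalised sum.\<close>
  have "(\<lambda>a. s / (s + t) * (x a / s) + t / (s + t) * (y a / t)) \<in> pts X"
    by (rule pts_convex[OF x]) (use st in \<open>auto simp: add_divide_distrib[symmetric]\<close>)
  also have "(\<lambda>a. s / (s + t) * (x a / s) + t / (s + t) * (y a / t)) = (\<lambda>a. (x a + y a) / (s + t))"
    using st by (auto simp: add_divide_distrib)
  finally have "nrm (\<lambda>a. x a + y a) \<le> s + t" using st by (intro nrm_leI) auto
  then show "nrm (\<lambda>a. x a + y a) \<le> nrm x + nrm y + e" by (simp add: s_t_def)
qed

lemma nrm_scale_le:
  assumes "x \<in> Fm_carrier X" "0 < \<alpha>"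
  shows "nrm (\<lambda>a. \<alpha> * x a) \<le> \<alpha> * nrm x"
proof (rule field_le_epsilon)
  fix e :: real assume e: "e > 0"
  have t: "nrm x + e / \<alpha> > 0" using e assms nrm_nonneg[OF assms(1)] by (simp add: add_nonneg_pos)
  have "(\<lambda>a. x a / (nrm x + e / \<alpha>)) \<in> pts X" using e assms by (intro nrm_lessD) auto
  also have "(\<lambda>a. x a / (nrm x + e / \<alpha>)) = (\<lambda>a. (\<alpha> * x a) / (\<alpha> * (nrm x + e / \<alpha>)))"
    using assms by simp
  finally have "nrm (\<lambda>a. \<alpha> * x a) \<le> \<alpha> * (nrm x + e / \<alpha>)" using t assms by (intro nrm_leI) auto
  then show "nrm (\<lambda>a. \<alpha> * x a) \<le> \<alpha> * nrm x + e" using assms by (simp add: distrib_left)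
qed

lemma nrm_zero: "nrm (\<lambda>_. 0) = 0"
proof (rule antisym)
  show "nrm (\<lambda>_. 0) \<le> 0"
  proof (rule dense_ge)
    fix t :: real assume "0 < t"
    then show "nrm (\<lambda>_. 0) \<le> t" using zero_pts by (intro nrm_leI) auto
  qed
qed (use nrm_nonneg pts_carrier zero_pts in auto)

lemma nrm_scale:
  assumes "x \<in> Fm_carrier X" "0 \<le> \<alpha>"
  shows "nrm (\<lambda>a. \<alpha> * x a) = \<alpha> * nrm x"
proof (cases "\<alpha> = 0")
  case False
  then have \<alpha>: "\<alpha> > 0" using assms by simp
  have "nrm (\<lambda>a. (1/\<alpha>) * (\<alpha> * x a)) \<le> (1/\<alpha>) * nrm (\<lambda>a. \<alpha> * x a)"
    using \<alpha> by (intro nrm_scale_le carrier_scale[OF assms]) auto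
  then have "\<alpha> * nrm x \<le> nrm (\<lambda>a. \<alpha> * x a)" using \<alpha> by (simp add: field_simps)
  then show ?thesis using nrm_scale_le[OF assms(1) \<alpha>] by simp
qed (simp add: nrm_zero)

lemma nrm_eq_0:
  assumes "x \<in> Fm_carrier X" "nrm x = 0"
  shows "x = (\<lambda>_. 0)"
proof
  fix a
  show "x a = 0"
  proof (cases "a \<in> web X")
    case True
    then obtain M where M: "\<forall>u\<in>pts X. u a \<le> M" using web_bounded by blast
    have "x a \<le> 0"
    proof (rule ccontr)
      assume "\<not> x a \<le> 0"
      then have xa: "x a > 0" by simp
      have M0: "0 \<le> M" using M zero_pts by fastforce
      \<comment> \<open>Norm zero puts every positive multiple of \<open>x\<close> into
        \<open>pts X\<close>; this one has the value \<open>M + 1\<close> at \<open>a\<close>, above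
        the bound \<open>M\<close>.\<close>
      have "(\<lambda>b. x b / (x a / (M + 1))) \<in> pts X"
        using xa M0 assms by (intro nrm_lessD) auto
      then have "x a / (x a / (M + 1)) \<le> M" by (rule M[THEN bspec])
      then show False using xa by simp
    qed
    then show ?thesis using carrier_nonneg[OF assms(1), of a] by simp
  qed (use carrier_outside assms in auto)
qed

section \<open>Order, completeness and measurability in the cone of a probabilistic coherence
  space\<close>

lemma Fm_obj_simps:
  "carrier (Fm_obj X) = Fm_carrier X" "\<zero>\<^bsub>Fm_obj X\<^esub> = (\<lambda>_. 0)"
  "x \<oplus>\<^bsub>Fm_obj X\<^esub> y = (\<lambda>a. x a + y a)" "t \<odot>\<^bsub>Fm_obj X\<^esub> x = (\<lambda>a. t * x a)"
  "cnorm (Fm_obj X) = nrm"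
  by (auto simp: Fm_obj_def nrm_def fun_eq_iff)

lemma cone_ball_Fm_obj: "cone_ball (Fm_obj X) = pts X"
  using nrm_le_1_iff by (auto simp: cone_ball_def Fm_obj_simps)

text \<open>If \<open>x\<close> is pointwise below \<open>y\<close>, the difference is dominated by
  \<open>y\<close> and therefore belongs to the cone.\<close>

lemma cone_le_Fm_obj:
  assumes "x \<in> Fm_carrier X" "y \<in> Fm_carrier X"
  shows "cone_le (Fm_obj X) x y \<longleftrightarrow> (\<forall>a. x a \<le> y a)"
proof
  assume "cone_le (Fm_obj X) x y"
  then show "\<forall>a. x a \<le> y a" using carrier_nonneg by (auto simp: cone_le_def Fm_obj_simps)
next
  assume *: "\<forall>a. x a \<le> y a"
  have "(\<lambda>a. y a - x a) \<in> Fm_carrier X"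
    using * carrier_nonneg[OF assms(1)] by (intro carrier_down[OF assms(2)]) auto
  then show "cone_le (Fm_obj X) x y"
    unfolding cone_le_def by (intro bexI[of _ "\<lambda>a. y a - x a"]) (auto simp: Fm_obj_simps)
qed

lemma normed_cone_Fm_obj: "normed_cone (Fm_obj X)"
proof (rule normed_cone.intro)
  show "abelian_monoid (Fm_obj X)"
    by (rule abelian_monoidI) (auto simp: Fm_obj_simps carrier_add pts_carrier zero_pts add.assoc add.commute)
  show "normed_cone_axioms (Fm_obj X)"
  proof (unfold_locales, unfold Fm_obj_simps)
    fix x y z :: "'a \<Rightarrow> real" assume "(\<lambda>a. x a + y a) = (\<lambda>a. x a + z a)"
    then show "y = z" by (simp add: fun_eq_iff)
  next
    fix x y assume "x \<in> Fm_carrier X" "y \<in> Fm_carrier X"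
    then show "nrm x \<le> nrm (\<lambda>a. x a + y a)"
      by (intro nrm_mono carrier_add) (auto simp: carrier_nonneg)
  qed (simp_all add: carrier_scale distrib_left distrib_right mult.assoc nrm_nonneg nrm_scale nrm_triangle nrm_eq_0)
qed

lemma cone_incseq_iff:
  assumes "range s \<subseteq> Fm_carrier X"
  shows "cone_incseq (Fm_obj X) s \<longleftrightarrow> (\<forall>a. incseq (\<lambda>n. s n a))"
  using assms by (auto simp: cone_incseq_def cone_le_Fm_obj incseq_Suc_iff image_subset_iff)

lemma pts_coord_bdd:
  assumes "range s \<subseteq> pts X"
  shows "bdd_above (range (\<lambda>n. s n a))"
proof (cases "a \<in> web X")
  case True
  then obtain M where M: "\<forall>u\<in>pts X. u a \<le> M" using web_bounded by blast
  then show ?thesis using assms by (intro bdd_aboveI[of _ M]) auto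
next
  case False
  then show ?thesis using assms by (intro bdd_aboveI[of _ 0]) (auto simp: image_subset_iff pts_outside)
qed

lemma pts_sup:
  assumes "range s \<subseteq> pts X" "\<And>a. incseq (\<lambda>n. s n a)"
  shows "(\<lambda>a. SUP n. s n a) \<in> pts X" "(\<lambda>n. s n a) \<longlonglongrightarrow> (SUP n. s n a)"
proof -
  have *: "(\<lambda>n. s n a) \<longlonglongrightarrow> (SUP n. s n a)" for a
    by (rule LIMSEQ_incseq_SUP[OF pts_coord_bdd[OF assms(1)] assms(2)])
  show "(\<lambda>n. s n a) \<longlonglongrightarrow> (SUP n. s n a)" by (rule *)
  show "(\<lambda>a. SUP n. s n a) \<in> pts X"
    by (rule pts_limit[OF _ *]) (use assms(1) in auto)
qed

lemma cone_lub_limit: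
  assumes s: "range s \<subseteq> Fm_carrier X" and x: "x \<in> Fm_carrier X"
    and inc: "\<And>a. incseq (\<lambda>n. s n a)" and lim: "\<And>a. (\<lambda>n. s n a) \<longlonglongrightarrow> x a"
  shows "cone_lub (Fm_obj X) s x"
  unfolding cone_lub_def
proof (intro conjI allI ballI impI)
  have sc: "s n \<in> Fm_carrier X" for n using s by auto
  show "x \<in> carrier (Fm_obj X)" using x by (simp add: Fm_obj_simps)
  show "cone_le (Fm_obj X) (s n) x" for n
    unfolding cone_le_Fm_obj[OF sc x] using incseq_le[OF inc lim] by blast
  fix y assume "y \<in> carrier (Fm_obj X)" and *: "\<forall>n. cone_le (Fm_obj X) (s n) y"
  then have y: "y \<in> Fm_carrier X" by (simp add: Fm_obj_simps)
  show "cone_le (Fm_obj X) x y"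
    unfolding cone_le_Fm_obj[OF x y]
  proof
    fix a show "x a \<le> y a"
      by (rule LIMSEQ_le_const2[OF lim]) (use * in \<open>auto simp: cone_le_Fm_obj[OF sc y]\<close>)
  qed
qed

text \<open>The pointwise supremum lies below the least upper bound \<open>x\<close>, hence is in
  the cone; being an upper bound there, it is also above \<open>x\<close>. So least upper bounds are
  pointwise limits.\<close>

lemma cone_lubD:
  assumes s: "range s \<subseteq> Fm_carrier X" and inc: "cone_incseq (Fm_obj X) s" and lub: "cone_lub (Fm_obj X) s x"
  shows "(\<lambda>n. s n a) \<longlonglongrightarrow> x a" "\<And>n. s n a \<le> x a"
proof -
  have sc: "s n \<in> Fm_carrier X" for n using s by auto
  have inc': "incseq (\<lambda>n. s n a)" for a using inc cone_incseq_iff[OF s] by blast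
  have x: "x \<in> Fm_carrier X" using lub by (simp add: cone_lub_def Fm_obj_simps)
  have le: "s n a \<le> x a" for n a using lub cone_le_Fm_obj[OF sc x] by (simp add: cone_lub_def)
  then show "\<And>n. s n a \<le> x a" .
  have bdd: "bdd_above (range (\<lambda>n. s n a))" for a using le by (intro bdd_aboveI[of _ "x a"]) auto
  have lim: "(\<lambda>n. s n a) \<longlonglongrightarrow> (SUP n. s n a)" for a
    by (rule LIMSEQ_incseq_SUP[OF bdd inc'])
  let ?y = "\<lambda>a. SUP n. s n a"
  have y: "?y \<in> Fm_carrier X"
  proof (rule carrier_down[OF x])
    show "0 \<le> ?y a" for a using carrier_nonneg[OF sc, of 0 a] cSUP_upper[OF _ bdd, of 0 a] by simp
    show "?y a \<le> x a" for a using le by (intro cSUP_least) auto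
  qed
  have "cone_le (Fm_obj X) x ?y"
    using lub y cSUP_upper[OF _ bdd] by (auto simp: cone_lub_def Fm_obj_simps cone_le_Fm_obj[OF sc y])
  then have "x a \<le> ?y a" using cone_le_Fm_obj[OF x y] by blast
  moreover have "?y a \<le> x a" using le by (intro cSUP_least) auto
  ultimately show "(\<lambda>n. s n a) \<longlonglongrightarrow> x a" using lim[of a] by simp
qed

lemma seq_complete_Fm_obj: "seq_complete_cone (Fm_obj X)"
proof -
  interpret normed_cone "Fm_obj X" by (rule normed_cone_Fm_obj)
  show ?thesis
  proof
    fix s assume s: "range s \<subseteq> cone_ball (Fm_obj X)" "cone_incseq (Fm_obj X) s"
    then have sp: "range s \<subseteq> pts X" by (simp add: cone_ball_Fm_obj)
    then have sc: "range s \<subseteq> Fm_carrier X" using pts_carrier by auto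
    have inc: "incseq (\<lambda>n. s n a)" for a using s(2) cone_incseq_iff[OF sc] by blast
    show "\<exists>x\<in>cone_ball (Fm_obj X). cone_lub (Fm_obj X) s x"
      using pts_sup[OF sp inc] pts_carrier inc
      by (intro bexI[of _ "\<lambda>a. SUP n. s n a"] cone_lub_limit[OF sc]) (auto simp: cone_ball_Fm_obj)
  qed
qed

lemma coord_dual: "a \<in> web X \<Longrightarrow> (\<lambda>x\<in>Fm_carrier X. x a) \<in> cone_dual (Fm_obj X)"
  unfolding cone_dual_def
proof (intro CollectI conjI allI ballI impI)
  fix s x assume *: "range s \<subseteq> carrier (Fm_obj X)" "cone_incseq (Fm_obj X) s" "cone_lub (Fm_obj X) s x"
  then have s: "range s \<subseteq> Fm_carrier X" and x: "x \<in> Fm_carrier X" by (auto simp: cone_lub_def Fm_obj_simps)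
  have "incseq (\<lambda>n. s n a)" using * cone_incseq_iff[OF s] by blast
  then have "(\<lambda>n. s n a) \<longlonglongrightarrow> (SUP n. s n a)"
    using cone_lubD(2)[OF s *(2,3)] by (intro LIMSEQ_incseq_SUP bdd_aboveI[of _ "x a"]) auto
  then have "x a = (SUP n. s n a)" using cone_lubD(1)[OF s *(2,3)] LIMSEQ_unique by blast
  moreover have "s n \<in> Fm_carrier X" for n using s by auto
  ultimately show "(\<lambda>x\<in>Fm_carrier X. x a) x = (SUP n. (\<lambda>x\<in>Fm_carrier X. x a) (s n))" using x by simp
qed (auto simp: Fm_obj_simps carrier_nonneg carrier_add carrier_scale)

lemma zero_dual: "(\<lambda>x\<in>Fm_carrier X. 0) \<in> cone_dual (Fm_obj X)"
  by (auto simp: cone_dual_def Fm_obj_simps carrier_add carrier_scale image_subset_iff cone_lub_def)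

lemma tests_Fm_obj: "tests (Fm_obj X) n = {\<lambda>r\<in>space (RR n). \<lambda>x\<in>Fm_carrier X. 0} \<union>
                   {(\<lambda>r\<in>space (RR n). \<lambda>x\<in>Fm_carrier X. x a) | a. a \<in> web X}"
  by (simp add: Fm_obj_def)

lemma measurable_cone_Fm_obj: "measurable_cone (Fm_obj X)"
proof -
  interpret seq_complete_cone "Fm_obj X" by (rule seq_complete_Fm_obj)
  show ?thesis
  proof
    show "tests (Fm_obj X) n \<subseteq> space (RR n) \<rightarrow>\<^sub>E cone_dual (Fm_obj X)" for n
      using coord_dual zero_dual by (auto simp: tests_Fm_obj)
    show "(\<lambda>r\<in>space (RR n). \<lambda>x\<in>carrier (Fm_obj X). 0) \<in> tests (Fm_obj X) n" for n
      by (simp add: tests_Fm_obj Fm_obj_simps)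
    fix l n h p assume l: "l \<in> tests (Fm_obj X) n" and h: "h \<in> RR p \<rightarrow>\<^sub>M RR n"
    \<comment> \<open>Every test is constant in its real parameters, so composing with
      \<open>h\<close> only changes the domain.\<close>
    have "(\<lambda>r\<in>space (RR p). (\<lambda>r\<in>space (RR n). c) (h r)) = (\<lambda>r\<in>space (RR p). c)" for c :: "('a \<Rightarrow> real) \<Rightarrow> real"
      using measurable_space[OF h] by (auto simp: fun_eq_iff)
    then show "(\<lambda>r\<in>space (RR p). l (h r)) \<in> tests (Fm_obj X) p"
      using l by (auto simp: tests_Fm_obj)
  next
    fix l n x assume l: "l \<in> tests (Fm_obj X) n" and x: "x \<in> carrier (Fm_obj X)"
    have "\<exists>c. \<forall>r\<in>space (RR n). l r x = c" using l by (auto simp: tests_Fm_obj)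
    then obtain c where c: "\<And>r. r\<in>space (RR n) \<Longrightarrow> c = l r x" by metis
    have "(\<lambda>_. c) \<in> borel_measurable (RR n)" by simp
    then show "(\<lambda>r. l r x) \<in> borel_measurable (RR n)"
      by (rule measurable_cong[THEN iffD1, rotated]) (rule c)
  qed
qed

text \<open>The tests are zero or coordinates, constant in their parameters, so joint measurability
  reduces to measurability of each coordinate of the path.\<close>

lemma measurable_path_iff:
  "measurable_path (Fm_obj X) n \<gamma> \<longleftrightarrow> \<gamma> \<in> space (RR n) \<rightarrow> Fm_carrier X \<and>
     (\<exists>M. \<forall>s\<in>space (RR n). nrm (\<gamma> s) \<le> M) \<and> (\<forall>a\<in>web X. (\<lambda>s. \<gamma> s a) \<in> borel_measurable (RR n))"
  (is "?L \<longleftrightarrow> ?R")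
proof
  assume L: ?L
  have "(\<lambda>s. \<gamma> s a) \<in> borel_measurable (RR n)" if a: "a \<in> web X" for a
  proof -
    let ?l = "\<lambda>r\<in>space (RR 0). \<lambda>x\<in>Fm_carrier X. x a"
    have "?l \<in> tests (Fm_obj X) 0" using a by (auto simp: tests_Fm_obj)
    then have 1: "(\<lambda>(r, s). ?l r (\<gamma> s)) \<in> borel_measurable (RR 0 \<Otimes>\<^sub>M RR n)"
      using L unfolding measurable_path_def by blast
    \<comment> \<open>The parameter space of arity 0 consists of this single point; fixing it turns
      the joint measurability of \<open>1\<close> into that of the coordinate.\<close>
    have z: "(\<lambda>_. undefined) \<in> space (RR 0)" by (simp add: space_PiM)
    then have "(\<lambda>s. (\<lambda>(r, s). ?l r (\<gamma> s)) ((\<lambda>_. undefined), s)) \<in> borel_measurable (RR n)"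
      by (intro measurable_compose[OF measurable_Pair1' 1])
    then show ?thesis
      by (rule measurable_cong[THEN iffD1, rotated])
         (use L z in \<open>auto simp: measurable_path_def Fm_obj_simps\<close>)
  qed
  then show ?R using L by (auto simp: measurable_path_def Fm_obj_simps)
next
  assume R: ?R
  have "(\<lambda>(r, s). l r (\<gamma> s)) \<in> borel_measurable (RR k \<Otimes>\<^sub>M RR n)" if l: "l \<in> tests (Fm_obj X) k" for l k
    using l unfolding tests_Fm_obj
  proof
    assume "l \<in> {\<lambda>r\<in>space (RR k). \<lambda>x\<in>Fm_carrier X. 0}"
    then have eq: "0 = (\<lambda>(r, s). l r (\<gamma> s)) w" if "w \<in> space (RR k \<Otimes>\<^sub>M RR n)" for w
      using R that by (auto simp: space_pair_measure)
    from measurable_const[of 0 borel] show ?thesis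
      by (rule measurable_cong[THEN iffD1, rotated]) (simp, rule eq)
  next
    assume "l \<in> {(\<lambda>r\<in>space (RR k). \<lambda>x\<in>Fm_carrier X. x a) | a. a \<in> web X}"
    then obtain a where a: "a \<in> web X" "l = (\<lambda>r\<in>space (RR k). \<lambda>x\<in>Fm_carrier X. x a)" by blast
    have eq: "\<gamma> (snd w) a = (\<lambda>(r, s). l r (\<gamma> s)) w" if "w \<in> space (RR k \<Otimes>\<^sub>M RR n)" for w
      using R that a by (auto simp: space_pair_measure)
    have "(\<lambda>s. \<gamma> s a) \<in> borel_measurable (RR n)" using R a by blast
    from measurable_compose[OF measurable_snd this]
    show ?thesis by (rule measurable_cong[THEN iffD1, rotated]) (rule eq)
  qed
  then show ?L using R unfolding measurable_path_def by (simp add: Fm_obj_simps)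
qed

end

section \<open>Power series are stable\<close>

lemma infsum_ennreal_sum:
  fixes d :: "'m \<Rightarrow> 'j \<Rightarrow> ennreal"
  assumes "finite A"
  shows "(\<Sum>\<^sub>\<infinity>\<mu>\<in>M. \<Sum>J\<in>A. d \<mu> J) = (\<Sum>J\<in>A. \<Sum>\<^sub>\<infinity>\<mu>\<in>M. d \<mu> J)"
  using assms by (induction A rule: finite_induct) (simp_all add: infsum_add[OF nonneg_summable_on_complete nonneg_summable_on_complete])

text \<open>One sequence of finite sets serves all summands \<open>f\<close>, so that a countable
  sum of measurable functions becomes a countable supremum of measurable functions.\<close>

lemma infsum_ennreal_exhaust:
  assumes "countable A"
  obtains F :: "nat \<Rightarrow> 'a set" where "\<And>n. finite (F n)" "\<And>n. F n \<subseteq> A"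
    "\<And>f::'a \<Rightarrow> ennreal. infsum f A = (SUP n. sum f (F n))"
proof -
  define F where "F n = {a \<in> A. to_nat_on A a < n}" for n
  have inj: "inj_on (to_nat_on A) A" using assms by (rule inj_on_to_nat_on)
  have fin: "finite (F n)" for n
  proof (rule finite_imageD)
    show "finite (to_nat_on A ` F n)" by (rule finite_subset[of _ "{..<n}"]) (auto simp: F_def)
    show "inj_on (to_nat_on A) (F n)" by (rule inj_on_subset[OF inj]) (auto simp: F_def)
  qed
  have sub: "F n \<subseteq> A" for n by (auto simp: F_def)
  have "infsum f A = (SUP n. sum f (F n))" for f :: "'a \<Rightarrow> ennreal"
  proof -
    have "infsum f A = (SUP G\<in>{G. finite G \<and> G \<subseteq> A}. sum f G)"
      by (rule nonneg_infsum_complete) simp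
    also have "\<dots> = (SUP n. sum f (F n))"
    proof (rule antisym)
      show "(SUP G\<in>{G. finite G \<and> G \<subseteq> A}. sum f G) \<le> (SUP n. sum f (F n))"
      proof (rule SUP_least)
        fix G assume G: "G \<in> {G. finite G \<and> G \<subseteq> A}"
        obtain n where "\<forall>k\<in>to_nat_on A ` G. k < n"
          using G finite_nat_set_iff_bounded[of "to_nat_on A ` G"] by auto
        then have "G \<subseteq> F n" using G by (auto simp: F_def)
        then have "sum f G \<le> sum f (F n)" by (intro sum_mono2 fin) auto
        then show "sum f G \<le> (SUP n. sum f (F n))" by (rule order_trans) (auto intro: SUP_upper)
      qed
      show "(SUP n. sum f (F n)) \<le> (SUP G\<in>{G. finite G \<and> G \<subseteq> A}. sum f G)"
        by (rule SUP_mono) (use fin sub in auto)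
    qed
    finally show ?thesis .
  qed
  with fin sub show ?thesis by (rule that)
qed

lemma borel_measurable_infsum_ennreal:
  fixes f :: "'a \<Rightarrow> 'b \<Rightarrow> ennreal"
  assumes "countable A" "\<And>a. a \<in> A \<Longrightarrow> f a \<in> borel_measurable M"
  shows "(\<lambda>x. \<Sum>\<^sub>\<infinity>a\<in>A. f a x) \<in> borel_measurable M"
proof -
  obtain F :: "nat \<Rightarrow> 'a set" where F: "\<And>n. finite (F n)" "\<And>n. F n \<subseteq> A"
    "\<And>f::'a \<Rightarrow> ennreal. infsum f A = (SUP n. sum f (F n))"
    using infsum_ennreal_exhaust[OF assms(1)] by metis
  show ?thesis
    unfolding F(3) by (intro borel_measurable_SUP borel_measurable_sum assms(2) subsetD[OF F(2)]) auto
qed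

text \<open>Monotone convergence: the sum is a supremum over finite sets, and the two suprema
  commute.\<close>

lemma infsum_ennreal_SUP:
  fixes G :: "nat \<Rightarrow> 'a \<Rightarrow> ennreal"
  assumes "\<And>a. a \<in> A \<Longrightarrow> incseq (\<lambda>n. G n a)"
  shows "(\<Sum>\<^sub>\<infinity>a\<in>A. SUP n. G n a) = (SUP n. \<Sum>\<^sub>\<infinity>a\<in>A. G n a)"
proof -
  let ?\<F> = "{F. finite F \<and> F \<subseteq> A}"
  have *: "infsum f A = (SUP F\<in>?\<F>. sum f F)" for f :: "'a \<Rightarrow> ennreal"
    by (rule nonneg_infsum_complete) simp
  have "(SUP F\<in>?\<F>. \<Sum>a\<in>F. SUP n. G n a) = (SUP F\<in>?\<F>. SUP n. \<Sum>a\<in>F. G n a)"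
    by (intro SUP_cong refl ennreal_SUP_sum[symmetric]) (use assms in auto)
  also have "\<dots> = (SUP n. SUP F\<in>?\<F>. \<Sum>a\<in>F. G n a)" by (rule SUP_commute)
  finally show ?thesis unfolding * .
qed

text \<open>The analogue of \<open>cube_dec\<close> in \<open>[0, \<infinity>]\<close>, where
  nonnegativity is built in and infinite sums always exist. Finiteness is recovered only at the end,
  in \<open>prestable_hat\<close>.\<close>

definition cube_sum :: "'i set \<Rightarrow> ('i set \<Rightarrow> ennreal) \<Rightarrow> bool" where
  "cube_sum N F \<longleftrightarrow> (\<exists>d. \<forall>I. I \<subseteq> N \<longrightarrow> F I = (\<Sum>J\<in>Pow I. d J))"

lemma cube_sum_const:
  assumes "finite N"
  shows "cube_sum N (\<lambda>_. c)"
  unfolding cube_sum_def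
proof (intro exI allI impI)
  fix I assume "I \<subseteq> N"
  then have "finite I" using assms finite_subset by auto
  then show "c = (\<Sum>J\<in>Pow I. if J = {} then c else 0)" by (simp add: sum.delta)
qed

lemma cube_sum_affine:
  assumes "finite N"
  shows "cube_sum N (\<lambda>I. c + (\<Sum>i\<in>I. v i))"
  unfolding cube_sum_def
proof (intro exI allI impI)
  let ?d = "\<lambda>J. if J = {} then c else if is_singleton J then v (the_elem J) else 0"
  fix I assume "I \<subseteq> N"
  then have fI: "finite I" using assms finite_subset by auto
  have "(\<Sum>J\<in>Pow I. ?d J) = (\<Sum>J\<in>insert {} ((\<lambda>i. {i}) ` I). ?d J)"
    by (rule sum.mono_neutral_right) (use fI in \<open>auto simp: is_singleton_def\<close>)
  also have "\<dots> = c + (\<Sum>J\<in>(\<lambda>i. {i}) ` I. ?d J)" using fI by (subst sum.insert) auto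
  also have "(\<Sum>J\<in>(\<lambda>i. {i}) ` I. ?d J) = (\<Sum>i\<in>I. v i)" by (subst sum.reindex) auto
  finally show "c + (\<Sum>i\<in>I. v i) = (\<Sum>J\<in>Pow I. ?d J)" by simp
qed

text \<open>The product of the expansions is a sum over pairs of index sets, grouped by their union
  \<open>L\<close>. A pair with union inside \<open>I\<close> consists of subsets of
  \<open>I\<close>, so the pairs can be taken from \<open>Pow N\<close>, which makes the new
  differences independent of \<open>I\<close>.\<close>

lemma cube_sum_mult:
  assumes N: "finite N" and F: "cube_sum N F" and G: "cube_sum N G"
  shows "cube_sum N (\<lambda>I. F I * G I)"
proof -
  obtain d e where d: "\<And>I. I \<subseteq> N \<Longrightarrow> F I = (\<Sum>J\<in>Pow I. d J)" and e: "\<And>I. I \<subseteq> N \<Longrightarrow> G I = (\<Sum>J\<in>Pow I. e J)"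
    using F G by (auto simp: cube_sum_def)
  have "F I * G I = (\<Sum>L\<in>Pow I. \<Sum>p\<in>{p \<in> Pow N \<times> Pow N. fst p \<union> snd p = L}. d (fst p) * e (snd p))" if I: "I \<subseteq> N" for I
  proof -
    have fI: "finite I" using I N finite_subset by auto
    have "F I * G I = (\<Sum>p\<in>Pow I \<times> Pow I. d (fst p) * e (snd p))"
      by (simp add: d[OF I] e[OF I] sum_product sum.cartesian_product case_prod_beta)
    also have "\<dots> = (\<Sum>L\<in>Pow I. \<Sum>p\<in>{p \<in> Pow I \<times> Pow I. fst p \<union> snd p = L}. d (fst p) * e (snd p))"
      by (rule sum.group[symmetric]) (use fI in auto)
    also have "\<dots> = (\<Sum>L\<in>Pow I. \<Sum>p\<in>{p \<in> Pow N \<times> Pow N. fst p \<union> snd p = L}. d (fst p) * e (snd p))"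
      by (intro sum.cong refl) (use I in auto)
    finally show ?thesis .
  qed
  then show ?thesis by (auto simp: cube_sum_def intro!: exI)
qed

lemma cube_sum_infsum:
  assumes N: "finite N" and F: "\<And>\<mu>. \<mu> \<in> M \<Longrightarrow> cube_sum N (F \<mu>)"
  shows "cube_sum N (\<lambda>I. \<Sum>\<^sub>\<infinity>\<mu>\<in>M. F \<mu> I)"
proof -
  have "\<forall>\<mu>\<in>M. \<exists>d. \<forall>I. I \<subseteq> N \<longrightarrow> F \<mu> I = (\<Sum>J\<in>Pow I. d J)" using F by (simp add: cube_sum_def)
  from bchoice[OF this] obtain d where d: "\<forall>\<mu>\<in>M. \<forall>I. I \<subseteq> N \<longrightarrow> F \<mu> I = (\<Sum>J\<in>Pow I. d \<mu> J)" ..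
  have "(\<Sum>\<^sub>\<infinity>\<mu>\<in>M. F \<mu> I) = (\<Sum>J\<in>Pow I. \<Sum>\<^sub>\<infinity>\<mu>\<in>M. d \<mu> J)" if I: "I \<subseteq> N" for I
  proof -
    have "finite (Pow I)" using I N finite_subset by auto
    then show ?thesis using d I by (subst infsum_ennreal_sum[symmetric]) (auto intro: infsum_cong)
  qed
  then show ?thesis unfolding cube_sum_def by (intro exI[of _ "\<lambda>J. \<Sum>\<^sub>\<infinity>\<mu>\<in>M. d \<mu> J"]) simp
qed

lemma monomial_empty [simp]: "monomial x {#} = 1"
  by (simp add: monomial_def)

lemma monomial_prod_mset: "monomial x \<mu> = (\<Prod>a\<in>#\<mu>. x a)"
  by (simp add: monomial_def image_prod_mset_multiplicity)

lemma monomial_add_mset [simp]: "monomial x (add_mset a \<mu>) = x a * monomial x \<mu>"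
  by (simp add: monomial_prod_mset)

lemma monomial_nonneg: "(\<And>a. 0 \<le> x a) \<Longrightarrow> 0 \<le> monomial x \<mu>"
  by (auto simp: monomial_def intro!: prod_nonneg)

lemma monomial_mono: "(\<And>a. 0 \<le> x a) \<Longrightarrow> (\<And>a. x a \<le> y a) \<Longrightarrow> monomial x \<mu> \<le> monomial y \<mu>"
  by (auto simp: monomial_def intro!: prod_mono power_mono)

lemma tendsto_monomial: "(\<And>a. (\<lambda>n. s n a) \<longlonglongrightarrow> x a) \<Longrightarrow> (\<lambda>n. monomial (s n) \<mu>) \<longlonglongrightarrow> monomial x \<mu>"
  unfolding monomial_def by (intro tendsto_intros)

text \<open>A monomial is a product of coordinates, each of which is affine along the cube.\<close>

lemma cube_sum_monomial:
  assumes N: "finite N" and x: "\<And>a. 0 \<le> x a" and u: "\<And>i a. i \<in> N \<Longrightarrow> 0 \<le> u i a"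
  shows "cube_sum N (\<lambda>I. ennreal (monomial (\<lambda>a. x a + (\<Sum>i\<in>I. u i a)) \<mu>))"
proof (induction \<mu>)
  case empty
  then show ?case using cube_sum_const[OF N] by simp
next
  case (add b \<mu>)
  have "cube_sum N (\<lambda>I. (ennreal (x b) + (\<Sum>i\<in>I. ennreal (u i b))) * ennreal (monomial (\<lambda>a. x a + (\<Sum>i\<in>I. u i a)) \<mu>))"
    by (rule cube_sum_mult[OF N cube_sum_affine[OF N] add])
  moreover have "(ennreal (x b) + (\<Sum>i\<in>I. ennreal (u i b))) * ennreal (monomial (\<lambda>a. x a + (\<Sum>i\<in>I. u i a)) \<mu>) =
     ennreal (monomial (\<lambda>a. x a + (\<Sum>i\<in>I. u i a)) (add_mset b \<mu>))" if "I \<subseteq> N" for I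
  proof -
    have s: "0 \<le> (\<Sum>i\<in>I. u i a)" for a using u that by (intro sum_nonneg) auto
    have "(\<Sum>i\<in>I. ennreal (u i b)) = ennreal (\<Sum>i\<in>I. u i b)" using u that by (intro sum_ennreal) auto
    then show ?thesis
      using x s monomial_nonneg[of "\<lambda>a. x a + (\<Sum>i\<in>I. u i a)" \<mu>]
      by (simp add: ennreal_plus[symmetric] ennreal_mult del: ennreal_plus)
  qed
  ultimately show ?case by (simp add: cube_sum_def)
qed

lemma cube_sum_cong: "cube_sum N F \<Longrightarrow> (\<And>I. I \<subseteq> N \<Longrightarrow> F I = G I) \<Longrightarrow> cube_sum N G"
  by (simp add: cube_sum_def)

lemma countable_mfin:
  assumes "countable A"
  shows "countable (mfin A)"
proof -
  have "mfin A \<subseteq> mset ` lists A"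
  proof
    fix \<mu> assume "\<mu> \<in> mfin A"
    moreover obtain xs where "mset xs = \<mu>" using ex_mset by blast
    ultimately show "\<mu> \<in> mset ` lists A" by (auto simp: mfin_def in_lists_conv_set subset_iff)
  qed
  then show ?thesis by (rule countable_subset) (intro countable_image countable_lists assms)
qed

section \<open>Power series and the map of a matrix\<close>

context pcspace
begin

lemma finsum_Fm_obj:
  assumes "finite I" "u \<in> I \<rightarrow> Fm_carrier X"
  shows "(\<Oplus>\<^bsub>Fm_obj X\<^esub>i\<in>I. u i) = (\<lambda>a. \<Sum>i\<in>I. u i a)"
proof -
  interpret normed_cone "Fm_obj X" by (rule normed_cone_Fm_obj)
  show ?thesis using assms
    by (induction I rule: finite_induct) (auto simp: Fm_obj_simps)
qed

lemma series_mono: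
  assumes "\<And>\<mu>. \<mu> \<in> mfin (web X) \<Longrightarrow> 0 \<le> f \<mu> b" "\<And>a. 0 \<le> x a" "\<And>a. x a \<le> y a"
  shows "series X f x b \<le> series X f y b"
  unfolding series_def
  by (intro infsum_mono nonneg_summable_on_complete) (auto intro!: ennreal_leI mult_left_mono monomial_mono assms)

text \<open>Scott continuity of power series: each term is continuous and increasing along the
  sequence, so monotone convergence applies.\<close>

lemma series_SUP:
  assumes f: "\<And>\<mu>. \<mu> \<in> mfin (web X) \<Longrightarrow> 0 \<le> f \<mu> b" and s: "\<And>n a. 0 \<le> s n a"
    and inc: "\<And>a. incseq (\<lambda>n. s n a)" and lim: "\<And>a. (\<lambda>n. s n a) \<longlonglongrightarrow> x a"
  shows "(\<lambda>n. series X f (s n) b) \<longlonglongrightarrow> series X f x b"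
proof -
  have inc': "incseq (\<lambda>n. ennreal (f \<mu> b * monomial (s n) \<mu>))" if "\<mu> \<in> mfin (web X)" for \<mu>
    using inc by (auto simp: incseq_def intro!: ennreal_leI mult_left_mono monomial_mono f s that)
  have "ennreal (f \<mu> b * monomial x \<mu>) = (SUP n. ennreal (f \<mu> b * monomial (s n) \<mu>))" if "\<mu> \<in> mfin (web X)" for \<mu>
  proof (rule LIMSEQ_unique)
    show "(\<lambda>n. ennreal (f \<mu> b * monomial (s n) \<mu>)) \<longlonglongrightarrow> ennreal (f \<mu> b * monomial x \<mu>)"
      by (intro tendsto_ennrealI tendsto_intros tendsto_monomial lim)
  qed (rule LIMSEQ_SUP[OF inc'[OF that]])
  then have "series X f x b = (\<Sum>\<^sub>\<infinity>\<mu>\<in>mfin (web X). SUP n. ennreal (f \<mu> b * monomial (s n) \<mu>))"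
    unfolding series_def by (intro infsum_cong)
  also have "\<dots> = (SUP n. series X f (s n) b)"
    unfolding series_def by (rule infsum_ennreal_SUP[OF inc'])
  finally have "series X f x b = (SUP n. series X f (s n) b)" .
  moreover have "incseq (\<lambda>n. series X f (s n) b)"
    using inc by (auto simp: incseq_def intro!: series_mono f s)
  ultimately show ?thesis using LIMSEQ_SUP by metis
qed

end

locale pcs_hom = X: pcspace X + Y: pcspace Y
  for X :: "'a pcs" and Y :: "'b pcs" and f :: "'a multiset \<Rightarrow> 'b \<Rightarrow> real" +
  assumes hom: "f \<in> pcoh_hom X Y"
begin

lemma coeff_nonneg: "0 \<le> f \<mu> b"
  using hom by (cases "\<mu> \<in> mfin (web X) \<and> b \<in> web Y") (auto simp: pcoh_hom_def)

lemma hat_pts: "x \<in> pts X \<Longrightarrow> hat X f x \<in> pts Y"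
  using hom by (auto simp: pcoh_hom_def)

lemma series_finite: "x \<in> pts X \<Longrightarrow> series X f x b < \<infinity>"
proof (cases "b \<in> web Y")
  case False
  then have "f \<mu> b = 0" for \<mu> using hom by (auto simp: pcoh_hom_def)
  then show ?thesis by (simp add: series_def)
qed (use hom in \<open>auto simp: pcoh_hom_def\<close>)

lemma ennreal_hat: "x \<in> pts X \<Longrightarrow> ennreal (hat X f x b) = series X f x b"
  using series_finite[of x b] by (simp add: hat_def)

lemma hat_mono:
  assumes "y \<in> pts X" "\<And>a. 0 \<le> x a" "\<And>a. x a \<le> y a"
  shows "hat X f x b \<le> hat X f y b"
  unfolding hat_def
  by (rule enn2real_mono) (use assms X.series_mono[of f b x y] coeff_nonneg series_finite[OF assms(1)] in auto)

lemma prestable_hat: "prestable (Fm_obj X) (Fm_obj Y) (hat X f)"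
proof (rule prestableI_cube_dec[OF Y.normed_cone_Fm_obj])
  show "hat X f \<in> cone_ball (Fm_obj X) \<rightarrow> carrier (Fm_obj Y)"
    using hat_pts Y.pts_carrier by (auto simp: X.cone_ball_Fm_obj Y.Fm_obj_simps)
  fix n :: nat and x u
  assume "x \<in> carrier (Fm_obj X)" "u \<in> {1..n} \<rightarrow> carrier (Fm_obj X)"
  then have x: "x \<in> Fm_carrier X" and u: "u \<in> {1..n} \<rightarrow> Fm_carrier X" by (simp_all only: X.Fm_obj_simps)
  assume b: "x \<oplus>\<^bsub>Fm_obj X\<^esub> (\<Oplus>\<^bsub>Fm_obj X\<^esub>i\<in>{1..n}. u i) \<in> cone_ball (Fm_obj X)"
  define z where "z I = (\<lambda>a. x a + (\<Sum>i\<in>I. u i a))" for I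
  have zI: "x \<oplus>\<^bsub>Fm_obj X\<^esub> (\<Oplus>\<^bsub>Fm_obj X\<^esub>i\<in>I. u i) = z I" if "I \<subseteq> {1..n}" for I
  proof -
    have "finite I" "u \<in> I \<rightarrow> Fm_carrier X" using that u finite_subset by auto
    then show ?thesis by (simp add: X.finsum_Fm_obj X.Fm_obj_simps z_def)
  qed
  have x0: "0 \<le> x a" for a using X.carrier_nonneg[OF x] .
  have u0: "0 \<le> u i a" if "i \<in> {1..n}" for i a using X.carrier_nonneg[OF funcset_mem[OF u that]] .
  have zN: "z {1..n} \<in> pts X" using b zI[of "{1..n}"] by (simp add: X.cone_ball_Fm_obj)
  have zpts: "z I \<in> pts X" if I: "I \<subseteq> {1..n}" for I
  proof (rule X.pts_down[OF zN])
    show "0 \<le> z I a" for a unfolding z_def using I by (intro add_nonneg_nonneg x0 sum_nonneg u0) auto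
    show "z I a \<le> z {1..n} a" for a unfolding z_def using I u0 by (intro add_left_mono sum_mono2) auto
  qed
  have "\<exists>d. \<forall>I. I \<subseteq> {1..n} \<longrightarrow> series X f (z I) b = (\<Sum>J\<in>Pow I. d J)" for b
  proof -
    have c: "cube_sum {1..n} (\<lambda>I. ennreal (f \<mu> b) * ennreal (monomial (z I) \<mu>))" for \<mu>
      unfolding z_def
      by (intro cube_sum_mult cube_sum_const cube_sum_monomial) (auto simp: x0 u0)
    have "cube_sum {1..n} (\<lambda>I. ennreal (f \<mu> b * monomial (z I) \<mu>))" for \<mu>
      by (rule cube_sum_cong[OF c[of \<mu>]])
         (simp add: ennreal_mult coeff_nonneg monomial_nonneg X.pts_nonneg[OF zpts])
    then have "cube_sum {1..n} (\<lambda>I. series X f (z I) b)"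
      unfolding series_def by (intro cube_sum_infsum) auto
    then show ?thesis unfolding cube_sum_def .
  qed
  then obtain d where d: "\<And>b I. I \<subseteq> {1..n} \<Longrightarrow> series X f (z I) b = (\<Sum>J\<in>Pow I. d b J)" by metis
  \<comment> \<open>Each difference is one summand of the value at the top vertex. This gives both
    its finiteness, so that it can be read as a real, and its membership in the cone of
    \<open>Y\<close>.\<close>
  have dle: "d b J \<le> series X f (z {1..n}) b" if "J \<subseteq> {1..n}" for b J
    unfolding d[OF subset_refl] by (rule member_le_sum) (use that in auto)
  have dfin: "d b J < \<infinity>" if "J \<subseteq> {1..n}" for b J
    using dle[OF that] series_finite[OF zN] by (rule le_less_trans)
  have "cube_dec (Fm_obj Y) {1..n} (\<lambda>I. hat X f (x \<oplus>\<^bsub>Fm_obj X\<^esub> (\<Oplus>\<^bsub>Fm_obj X\<^esub>i\<in>I. u i))) (\<lambda>J b. enn2real (d b J))"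
    unfolding cube_dec_def
  proof (intro conjI allI impI)
    have dc: "(\<lambda>b. enn2real (d b J)) \<in> Fm_carrier Y" if "J \<subseteq> {1..n}" for J
    proof (rule Y.carrier_down[OF Y.pts_carrier[OF hat_pts[OF zN]]])
      show "enn2real (d b J) \<le> hat X f (z {1..n}) b" for b
        unfolding hat_def by (rule enn2real_mono[OF dle[OF that]]) (use series_finite[OF zN] in simp)
    qed simp
    then show "(\<lambda>J b. enn2real (d b J)) \<in> Pow {1..n} \<rightarrow> carrier (Fm_obj Y)"
      by (auto simp only: Y.Fm_obj_simps)
    fix I :: "nat set" assume I: "I \<subseteq> {1..n}"
    then have "finite I" using finite_subset by auto
    then have "(\<Oplus>\<^bsub>Fm_obj Y\<^esub>J\<in>Pow I. (\<lambda>b. enn2real (d b J))) = (\<lambda>b. \<Sum>J\<in>Pow I. enn2real (d b J))"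
      using dc I by (intro Y.finsum_Fm_obj) (auto intro: dc)
    also have "\<dots> = hat X f (z I)"
    proof
      fix b
      have "(\<Sum>J\<in>Pow I. enn2real (d b J)) = enn2real (\<Sum>J\<in>Pow I. d b J)"
        using enn2real_sum[of "Pow I" "d b"] dfin I by (simp add: comp_def subset_trans)
      then show "(\<Sum>J\<in>Pow I. enn2real (d b J)) = hat X f (z I) b" by (simp add: hat_def d[OF I])
    qed
    finally show "hat X f (x \<oplus>\<^bsub>Fm_obj X\<^esub> (\<Oplus>\<^bsub>Fm_obj X\<^esub>i\<in>I. u i)) = (\<Oplus>\<^bsub>Fm_obj Y\<^esub>J\<in>Pow I. (\<lambda>b. enn2real (d b J)))"
      by (simp add: zI[OF I])
  qed
  then show "\<exists>d. cube_dec (Fm_obj Y) {1..n} (\<lambda>I. hat X f (x \<oplus>\<^bsub>Fm_obj X\<^esub> (\<Oplus>\<^bsub>Fm_obj X\<^esub>i\<in>I. u i))) d" by blast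
qed

lemma stable_hat: "stable (Fm_obj X) (Fm_obj Y) (hat X f)"
  unfolding stable_def
proof (intro conjI allI ballI impI prestable_hat)
  show "hat X f \<in> cone_ball (Fm_obj X) \<rightarrow> carrier (Fm_obj Y)"
    using hat_pts Y.pts_carrier by (auto simp: X.cone_ball_Fm_obj Y.Fm_obj_simps)
  show "\<exists>M. \<forall>x\<in>cone_ball (Fm_obj X). cnorm (Fm_obj Y) (hat X f x) \<le> M"
    using hat_pts Y.nrm_le_1_iff by (intro exI[of _ 1]) (auto simp: X.cone_ball_Fm_obj Y.Fm_obj_simps)
  fix s x assume x: "x \<in> cone_ball (Fm_obj X)" and s: "range s \<subseteq> cone_ball (Fm_obj X)"
    and inc: "cone_incseq (Fm_obj X) s" and lub: "cone_lub (Fm_obj X) s x"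
  have x: "x \<in> pts X" and s: "s n \<in> pts X" for n using x s by (auto simp: X.cone_ball_Fm_obj)
  have sc: "range s \<subseteq> Fm_carrier X" using s X.pts_carrier by auto
  have inc': "incseq (\<lambda>n. s n a)" for a using inc X.cone_incseq_iff[OF sc] by blast
  show "cone_lub (Fm_obj Y) (\<lambda>n. hat X f (s n)) (hat X f x)"
  proof (rule Y.cone_lub_limit)
    show "range (\<lambda>n. hat X f (s n)) \<subseteq> Fm_carrier Y" "hat X f x \<in> Fm_carrier Y"
      using s x hat_pts Y.pts_carrier by auto
    show "incseq (\<lambda>n. hat X f (s n) b)" for b
      using inc' by (auto simp: incseq_def intro!: hat_mono s X.pts_nonneg[OF s])
    fix b
    have "(\<lambda>n. series X f (s n) b) \<longlonglongrightarrow> series X f x b"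
      by (rule X.series_SUP) (rule coeff_nonneg X.pts_nonneg[OF s] inc' X.cone_lubD(1)[OF sc inc lub])+
    then have "(\<lambda>n. series X f (s n) b) \<longlonglongrightarrow> ennreal (hat X f x b)" by (simp add: ennreal_hat[OF x])
    from tendsto_enn2real[OF this] show "(\<lambda>n. hat X f (s n) b) \<longlonglongrightarrow> hat X f x b"
      by (simp add: hat_def)
  qed
qed

lemma hat_path:
  assumes "unitary_path (Fm_obj X) n \<gamma>"
  shows "measurable_path (Fm_obj Y) n (\<lambda>r. hat X f (\<gamma> r))"
proof -
  have \<gamma>: "\<gamma> r \<in> pts X" if "r \<in> space (RR n)" for r
    using assms that by (auto simp: unitary_path_def X.cone_ball_Fm_obj)
  have m: "(\<lambda>s. \<gamma> s a) \<in> borel_measurable (RR n)" if "a \<in> web X" for a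
    using assms that by (auto simp: unitary_path_def X.measurable_path_iff)
  have "(\<lambda>r. series X f (\<gamma> r) b) \<in> borel_measurable (RR n)" for b
    unfolding series_def
  proof (rule borel_measurable_infsum_ennreal[OF countable_mfin[OF X.countable_web]])
    fix \<mu> assume \<mu>: "\<mu> \<in> mfin (web X)"
    have "(\<lambda>r. monomial (\<gamma> r) \<mu>) \<in> borel_measurable (RR n)"
      unfolding monomial_def using \<mu> by (intro borel_measurable_prod borel_measurable_power m) (auto simp: mfin_def)
    then show "(\<lambda>r. ennreal (f \<mu> b * monomial (\<gamma> r) \<mu>)) \<in> borel_measurable (RR n)" by simp
  qed
  then have "(\<lambda>r. hat X f (\<gamma> r) b) \<in> borel_measurable (RR n)" for b
    unfolding hat_def by simp
  then show ?thesis
    unfolding Y.measurable_path_iff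
    using \<gamma> hat_pts Y.pts_carrier by (auto intro!: exI[of _ 1] Y.nrm_le_1_iff[THEN iffD2, THEN conjunct2])
qed

lemma Fm_mor_hom: "Fm_mor X Y f \<in> cstabm_hom (Fm_obj X) (Fm_obj Y)"
  unfolding cstabm_hom_def
proof (intro CollectI conjI allI impI)
  show "Fm_mor X Y f \<in> cone_ball (Fm_obj X) \<rightarrow>\<^sub>E cone_ball (Fm_obj Y)"
    using hat_pts by (auto simp: Fm_mor_def X.cone_ball_Fm_obj Y.cone_ball_Fm_obj)
  show "stable (Fm_obj X) (Fm_obj Y) (Fm_mor X Y f)"
    by (rule stable_cong[OF _ X.normed_cone_Fm_obj stable_hat Y.normed_cone_Fm_obj])
       (simp add: Fm_mor_def X.cone_ball_Fm_obj)
  fix n \<gamma> assume \<gamma>: "unitary_path (Fm_obj X) n \<gamma>"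
  show "measurable_path (Fm_obj Y) n (\<lambda>r. Fm_mor X Y f (\<gamma> r))"
    by (rule measurable_path_cong[OF _ hat_path[OF \<gamma>]])
       (use \<gamma> in \<open>auto simp: unitary_path_def X.cone_ball_Fm_obj Fm_mor_def\<close>)
qed

end

section \<open>Uniqueness of power series\<close>

text \<open>Otherwise take the first differing coefficient \<open>k\<close> and divide the
  difference series by \<open>s ^ k\<close>: its value tends to the difference of these coefficients
  as \<open>s\<close> tends to 0 from the right, but it is 0. Only positive arguments are available,
  since points have nonnegative coordinates.\<close>

lemma powser_eq_right_imp_eq:
  fixes c d :: "nat \<Rightarrow> real"
  assumes e: "0 < e" and c: "\<And>s. 0 < s \<Longrightarrow> s < e \<Longrightarrow> (\<lambda>k. c k * s ^ k) sums S s"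
    and d: "\<And>s. 0 < s \<Longrightarrow> s < e \<Longrightarrow> (\<lambda>k. d k * s ^ k) sums S s"
  shows "c = d"
proof (rule ccontr)
  assume "c \<noteq> d"
  then have ex: "\<exists>k. c k \<noteq> d k" by auto
  define k where "k = (LEAST k. c k \<noteq> d k)"
  have k: "c k \<noteq> d k" unfolding k_def by (rule LeastI_ex[OF ex])
  have below: "c j = d j" if "j < k" for j using not_less_Least[of j "\<lambda>k. c k \<noteq> d k"] that by (auto simp: k_def)
  define a where "a j = c (j + k) - d (j + k)" for j
  have a: "(\<lambda>j. a j * s ^ j) sums 0" if s: "0 < s" "s < e" for s
  proof -
    have "(\<lambda>j. (c j - d j) * s ^ j) sums 0"
      using sums_diff[OF c[OF s] d[OF s]] by (simp add: algebra_simps)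
    then have "(\<lambda>j. (c (j + k) - d (j + k)) * s ^ (j + k)) sums 0"
      using sums_iff_shift[of "\<lambda>j. (c j - d j) * s ^ j" k 0] below by simp
    then have "(\<lambda>j. (c (j + k) - d (j + k)) * s ^ (j + k) / s ^ k) sums (0 / s ^ k)"
      by (rule sums_divide)
    then show ?thesis using s by (simp add: a_def power_add)
  qed
  \<comment> \<open>Convergence at \<open>e / 2\<close> gives continuity of the sum on a two-sided
    neighbourhood of 0, although it is known to vanish only on the right.\<close>
  have "summable (\<lambda>j. a j * (e / 2) ^ j)" using a[of "e/2"] e by (auto simp: sums_iff)
  then have "(\<lambda>j. a j * x ^ j) sums (\<Sum>j. a j * x ^ j)" if "norm x < e / 2" for x
    using summable_sums[OF powser_inside[of a "e/2" x]] that e by simp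
  then have "((\<lambda>x. \<Sum>j. a j * x ^ j) \<longlongrightarrow> a 0) (at 0)"
    using e by (intro powser_limit_0[of "e/2"]) auto
  then have "((\<lambda>x. \<Sum>j. a j * x ^ j) \<longlongrightarrow> a 0) (at_right 0)" by (rule tendsto_within_subset) auto
  moreover have "\<forall>\<^sub>F x in at_right 0. (\<Sum>j. a j * x ^ j) = 0"
    using e a by (intro eventually_at_rightI[of 0 e]) (auto simp: sums_iff)
  then have "((\<lambda>x. \<Sum>j. a j * x ^ j) \<longlongrightarrow> 0) (at_right (0::real))" by (rule tendsto_eventually)
  ultimately have "a 0 = 0" by (intro tendsto_unique[of "at_right (0::real)"]) auto
  then show False using k by (simp add: a_def)
qed

lemma infsum_real_of_ennreal:
  fixes h :: "'a \<Rightarrow> real"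
  assumes h: "\<And>a. a \<in> A \<Longrightarrow> 0 \<le> h a" and fin: "(\<Sum>\<^sub>\<infinity>a\<in>A. ennreal (h a)) < \<infinity>"
  shows "h summable_on A" "ennreal (infsum h A) = (\<Sum>\<^sub>\<infinity>a\<in>A. ennreal (h a))"
proof -
  have eq: "(\<Sum>\<^sub>\<infinity>a\<in>A. ennreal (h a)) = (SUP F\<in>{F. finite F \<and> F \<subseteq> A}. ennreal (sum h F))"
    using h by (subst nonneg_infsum_complete) (auto intro!: SUP_cong sum_ennreal)
  obtain M where M: "(\<Sum>\<^sub>\<infinity>a\<in>A. ennreal (h a)) = ennreal M" "0 \<le> M"
    using fin by (cases "\<Sum>\<^sub>\<infinity>a\<in>A. ennreal (h a)") auto
  have "sum h F \<le> M" if "finite F" "F \<subseteq> A" for F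
  proof -
    have "ennreal (sum h F) \<le> ennreal M" unfolding M(1)[symmetric] eq by (rule SUP_upper) (use that in auto)
    then show ?thesis using M(2) by simp
  qed
  then show s: "h summable_on A"
    using h by (intro nonneg_bdd_above_summable_on bdd_aboveI[of _ M]) auto
  show "ennreal (infsum h A) = (\<Sum>\<^sub>\<infinity>a\<in>A. ennreal (h a))"
    unfolding eq by (rule infsum_nonneg_is_SUPREMUM_ennreal[OF s h])
qed

lemma monomial_plus: "monomial x (\<mu> + \<nu>) = monomial x \<mu> * monomial x \<nu>"
  by (simp add: monomial_prod_mset)

lemma monomial_replicate: "monomial x (replicate_mset k a) = x a ^ k"
  by (induction k) auto

lemma monomial_cong: "(\<And>a. a \<in># \<mu> \<Longrightarrow> x a = y a) \<Longrightarrow> monomial x \<mu> = monomial y \<mu>"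
  by (simp add: monomial_def)

lemma bij_betw_mfin_insert:
  assumes "a \<notin> A"
  shows "bij_betw (\<lambda>(k, \<nu>). \<nu> + replicate_mset k a) ((UNIV :: nat set) \<times> mfin A) (mfin (insert a A))"
proof (rule bij_betw_byWitness[where f' = "\<lambda>\<mu>. (count \<mu> a, filter_mset (\<lambda>b. b \<noteq> a) \<mu>)"])
  show "\<forall>p\<in>(UNIV :: nat set) \<times> mfin A. (\<lambda>\<mu>. (count \<mu> a, filter_mset (\<lambda>b. b \<noteq> a) \<mu>)) ((\<lambda>(k, \<nu>). \<nu> + replicate_mset k a) p) = p"
  proof (intro ballI)
    fix p assume p: "p \<in> (UNIV :: nat set) \<times> mfin A"
    obtain k \<nu> where p': "p = (k, \<nu>)" by (cases p)
    have "a \<notin># \<nu>" using p p' assms by (auto simp: mfin_def)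
    then show "(\<lambda>\<mu>. (count \<mu> a, filter_mset (\<lambda>b. b \<noteq> a) \<mu>)) ((\<lambda>(k, \<nu>). \<nu> + replicate_mset k a) p) = p"
      unfolding p' by (auto simp: multiset_eq_iff not_in_iff)
  qed
  show "\<forall>\<mu>\<in>mfin (insert a A). (\<lambda>(k, \<nu>). \<nu> + replicate_mset k a) (count \<mu> a, filter_mset (\<lambda>b. b \<noteq> a) \<mu>) = \<mu>"
    by (auto simp: multiset_eq_iff)
  show "(\<lambda>(k, \<nu>). \<nu> + replicate_mset k a) ` (UNIV \<times> mfin A) \<subseteq> mfin (insert a A)"
    by (auto simp: mfin_def split: if_splits)
  show "(\<lambda>\<mu>. (count \<mu> a, filter_mset (\<lambda>b. b \<noteq> a) \<mu>)) ` mfin (insert a A) \<subseteq> UNIV \<times> mfin A"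
    by (auto simp: mfin_def)
qed

text \<open>Fubini for summable families: fixing the other variables, the series is a power series
  in the variable \<open>a\<close>, whose coefficients are series in the variables of
  \<open>A\<close>.\<close>

lemma multi_powser_split:
  fixes f :: "'a multiset \<Rightarrow> real"
  assumes a: "a \<notin> A" and s: "s > 0"
    and sm: "(\<lambda>\<mu>. f \<mu> * monomial (x(a := s)) \<mu>) summable_on mfin (insert a A)"
  shows "(\<lambda>\<nu>. f (\<nu> + replicate_mset k a) * monomial x \<nu>) summable_on mfin A"
    and "(\<lambda>k. (\<Sum>\<^sub>\<infinity>\<nu>\<in>mfin A. f (\<nu> + replicate_mset k a) * monomial x \<nu>) * s ^ k) sums
      (\<Sum>\<^sub>\<infinity>\<mu>\<in>mfin (insert a A). f \<mu> * monomial (x(a := s)) \<mu>)"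
proof -
  let ?h = "\<lambda>k \<nu>. f (\<nu> + replicate_mset k a) * monomial x \<nu> * s ^ k"
  have eq: "f (\<nu> + replicate_mset k a) * monomial (x(a := s)) (\<nu> + replicate_mset k a) = ?h k \<nu>"
    if "\<nu> \<in> mfin A" for k \<nu>
  proof -
    have "monomial (x(a := s)) \<nu> = monomial x \<nu>" using that a by (intro monomial_cong) (auto simp: mfin_def)
    then show ?thesis by (simp add: monomial_plus monomial_replicate)
  qed
  have "(\<lambda>p. f ((\<lambda>(k, \<nu>). \<nu> + replicate_mset k a) p) * monomial (x(a := s)) ((\<lambda>(k, \<nu>). \<nu> + replicate_mset k a) p))
      summable_on (UNIV \<times> mfin A)"
    using sm by (subst summable_on_reindex_bij_betw[OF bij_betw_mfin_insert[OF a]])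
  then have sm2: "(\<lambda>(k, \<nu>). ?h k \<nu>) summable_on (UNIV \<times> mfin A)"
    by (rule summable_on_cong[THEN iffD1, rotated]) (auto simp: eq)
  have tot: "(\<Sum>\<^sub>\<infinity>\<mu>\<in>mfin (insert a A). f \<mu> * monomial (x(a := s)) \<mu>) = (\<Sum>\<^sub>\<infinity>(k, \<nu>)\<in>UNIV \<times> mfin A. ?h k \<nu>)"
    unfolding infsum_reindex_bij_betw[OF bij_betw_mfin_insert[OF a], symmetric, of "\<lambda>\<mu>. f \<mu> * monomial (x(a := s)) \<mu>"]
    by (rule infsum_cong) (auto simp: eq)
  have "(\<lambda>\<nu>. ?h k \<nu>) summable_on mfin A" for k
    using summable_on_SigmaD1[OF sm2, of k] by simp
  then have "(\<lambda>\<nu>. (1 / s ^ k) * ?h k \<nu>) summable_on mfin A" for k by (rule summable_on_cmult_right)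
  then show sk: "(\<lambda>\<nu>. f (\<nu> + replicate_mset k a) * monomial x \<nu>) summable_on mfin A" for k
    using s by simp
  have inner: "(\<Sum>\<^sub>\<infinity>\<nu>\<in>mfin A. ?h k \<nu>) = (\<Sum>\<^sub>\<infinity>\<nu>\<in>mfin A. f (\<nu> + replicate_mset k a) * monomial x \<nu>) * s ^ k" for k
    by (rule infsum_cmult_left) (use sk in auto)
  have "(\<Sum>\<^sub>\<infinity>k. \<Sum>\<^sub>\<infinity>\<nu>\<in>mfin A. ?h k \<nu>) = (\<Sum>\<^sub>\<infinity>\<mu>\<in>mfin (insert a A). f \<mu> * monomial (x(a := s)) \<mu>)"
    unfolding tot by (rule infsum_Sigma'_banach[OF sm2])
  then have "((\<lambda>k. \<Sum>\<^sub>\<infinity>\<nu>\<in>mfin A. ?h k \<nu>) has_sum (\<Sum>\<^sub>\<infinity>\<mu>\<in>mfin (insert a A). f \<mu> * monomial (x(a := s)) \<mu>)) UNIV"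
    using has_sum_infsum[OF summable_on_Sigma_banach[OF sm2]] by simp
  then show "(\<lambda>k. (\<Sum>\<^sub>\<infinity>\<nu>\<in>mfin A. f (\<nu> + replicate_mset k a) * monomial x \<nu>) * s ^ k) sums
      (\<Sum>\<^sub>\<infinity>\<mu>\<in>mfin (insert a A). f \<mu> * monomial (x(a := s)) \<mu>)"
    unfolding inner by (rule has_sum_imp_sums)
qed

text \<open>For fixed values of the variables in \<open>A\<close>, uniqueness in the variable
  \<open>a\<close> identifies the coefficient series; these are then compared by the induction
  hypothesis.\<close>

lemma multi_powser_unique:
  fixes f g :: "'a multiset \<Rightarrow> real"
  assumes "finite A" "\<And>a. a \<in> A \<Longrightarrow> 0 < r a"
    and "\<And>x. (\<And>a. a \<in> A \<Longrightarrow> 0 < x a \<and> x a < r a) \<Longrightarrow>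
      (\<lambda>\<mu>. f \<mu> * monomial x \<mu>) summable_on mfin A \<and> (\<lambda>\<mu>. g \<mu> * monomial x \<mu>) summable_on mfin A \<and>
      (\<Sum>\<^sub>\<infinity>\<mu>\<in>mfin A. f \<mu> * monomial x \<mu>) = (\<Sum>\<^sub>\<infinity>\<mu>\<in>mfin A. g \<mu> * monomial x \<mu>)"
    and "\<mu> \<in> mfin A"
  shows "f \<mu> = g \<mu>"
  using assms
proof (induction A arbitrary: f g \<mu> rule: finite_induct)
  case empty
  have "mfin {} = {{#} :: 'a multiset}" by (auto simp: mfin_def)
  \<comment> \<open>Without variables every \<open>x\<close> is admissible, even
    \<open>undefined\<close>, and the sums consist of the constant term.\<close>
  then show ?case using empty.prems(2)[of undefined] empty.prems(3) by simp
next
  case (insert a A)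
  have "\<mu> \<in> (\<lambda>(k, \<nu>). \<nu> + replicate_mset k a) ` (UNIV \<times> mfin A)"
    using bij_betw_imp_surj_on[OF bij_betw_mfin_insert[OF insert.hyps(2)]] insert.prems(3) by simp
  then obtain k \<nu> where \<mu>: "\<mu> = \<nu> + replicate_mset k a" and \<nu>: "\<nu> \<in> mfin A" by auto
  show ?case
    unfolding \<mu>
  proof (rule insert.IH[OF _ _ \<nu>, where f = "\<lambda>\<nu>. f (\<nu> + replicate_mset k a)" and g = "\<lambda>\<nu>. g (\<nu> + replicate_mset k a)"])
    show "0 < r b" if "b \<in> A" for b using insert.prems(1) that by auto
    fix x assume x: "\<And>b. b \<in> A \<Longrightarrow> 0 < x b \<and> x b < r b"
    have ra: "0 < r a" using insert.prems(1) by auto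
    have *: "(\<lambda>\<mu>. f \<mu> * monomial (x(a := s)) \<mu>) summable_on mfin (insert a A) \<and>
       (\<lambda>\<mu>. g \<mu> * monomial (x(a := s)) \<mu>) summable_on mfin (insert a A) \<and>
      (\<Sum>\<^sub>\<infinity>\<mu>\<in>mfin (insert a A). f \<mu> * monomial (x(a := s)) \<mu>) =
      (\<Sum>\<^sub>\<infinity>\<mu>\<in>mfin (insert a A). g \<mu> * monomial (x(a := s)) \<mu>)" if "0 < s" "s < r a" for s
      by (rule insert.prems(2)) (use x that in auto)
    define S where "S s = (\<Sum>\<^sub>\<infinity>\<mu>\<in>mfin (insert a A). g \<mu> * monomial (x(a := s)) \<mu>)" for s
    have eq: "(\<lambda>k. \<Sum>\<^sub>\<infinity>\<nu>\<in>mfin A. f (\<nu> + replicate_mset k a) * monomial x \<nu>) =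
          (\<lambda>k. \<Sum>\<^sub>\<infinity>\<nu>\<in>mfin A. g (\<nu> + replicate_mset k a) * monomial x \<nu>)"
    proof (rule powser_eq_right_imp_eq[OF ra, where S = S])
      fix s assume s: "0 < s" "s < r a"
      show "(\<lambda>k. (\<Sum>\<^sub>\<infinity>\<nu>\<in>mfin A. f (\<nu> + replicate_mset k a) * monomial x \<nu>) * s ^ k) sums S s"
        using multi_powser_split(2)[OF insert.hyps(2) s(1), of f x] *[OF s] by (simp add: S_def)
      show "(\<lambda>k. (\<Sum>\<^sub>\<infinity>\<nu>\<in>mfin A. g (\<nu> + replicate_mset k a) * monomial x \<nu>) * s ^ k) sums S s"
        using multi_powser_split(2)[OF insert.hyps(2) s(1), of g x] *[OF s] by (simp add: S_def)
    qed
    \<comment> \<open>Summability of the coefficient series is extracted at one admissible value of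
      the variable \<open>a\<close>.\<close>
    have h: "0 < r a / 2" "r a / 2 < r a" using ra by auto
    show "(\<lambda>\<nu>. f (\<nu> + replicate_mset k a) * monomial x \<nu>) summable_on mfin A \<and>
      (\<lambda>\<nu>. g (\<nu> + replicate_mset k a) * monomial x \<nu>) summable_on mfin A \<and>
      (\<Sum>\<^sub>\<infinity>\<nu>\<in>mfin A. f (\<nu> + replicate_mset k a) * monomial x \<nu>) =
      (\<Sum>\<^sub>\<infinity>\<nu>\<in>mfin A. g (\<nu> + replicate_mset k a) * monomial x \<nu>)"
      using multi_powser_split(1)[OF insert.hyps(2) h(1), of f x] multi_powser_split(1)[OF insert.hyps(2) h(1), of g x]
        *[OF h] fun_cong[OF eq, of k] by blast
  qed
qed

text \<open>Average the corner obtained for \<open>A\<close> with the point on the axis of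
  \<open>a\<close>. By downward closure the whole box below the corner is in \<open>pts X\<close>,
  which leaves room to vary finitely many variables independently.\<close>

lemma (in pcspace) pts_box:
  assumes "finite A" "A \<subseteq> web X"
  shows "\<exists>r. (\<forall>a\<in>A. 0 < r a) \<and> (\<lambda>b. if b \<in> A then r b else 0) \<in> pts X"
  using assms
proof (induction A rule: finite_induct)
  case empty
  then show ?case using zero_pts by auto
next
  case (insert a A)
  then obtain r where r: "\<forall>a\<in>A. 0 < r a" "(\<lambda>b. if b \<in> A then r b else 0) \<in> pts X" by auto
  obtain c where c: "0 < c" "(\<lambda>b. if b = a then c else 0) \<in> pts X" using insert.prems web_unit by auto
  have "(\<lambda>b. 1/2 * (if b \<in> A then r b else 0) + 1/2 * (if b = a then c else 0)) \<in> pts X"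
    by (rule pts_convex[OF r(2) c(2)]) auto
  also have "(\<lambda>b. 1/2 * (if b \<in> A then r b else 0) + 1/2 * (if b = a then c else 0)) =
    (\<lambda>b. if b \<in> insert a A then (if b = a then c / 2 else r b / 2) else 0)"
    using insert.hyps by (auto simp: fun_eq_iff)
  finally show ?case using r(1) c(1)
    by (intro exI[of _ "\<lambda>b. if b = a then c / 2 else r b / 2"]) auto
qed

text \<open>Monomials with a variable outside \<open>A\<close> vanish at points supported in
  \<open>A\<close>. This reduces infinitely many variables to finitely many.\<close>

lemma (in pcspace) series_restrict:
  assumes "A \<subseteq> web X"
  shows "series X f (\<lambda>a. if a \<in> A then x a else 0) b = (\<Sum>\<^sub>\<infinity>\<mu>\<in>mfin A. ennreal (f \<mu> b * monomial x \<mu>))"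
  unfolding series_def
proof (rule infsum_cong_neutral)
  fix \<mu> assume "\<mu> \<in> mfin (web X) - mfin A"
  then obtain a where "a \<in># \<mu>" "a \<notin> A" by (auto simp: mfin_def)
  then have "monomial (\<lambda>a. if a \<in> A then x a else 0) \<mu> = 0"
    unfolding monomial_def by (intro prod_zero) (auto intro!: bexI[of _ a] simp: zero_power)
  then show "ennreal (f \<mu> b * monomial (\<lambda>a. if a \<in> A then x a else 0) \<mu>) = 0" by simp
next
  fix \<mu> assume "\<mu> \<in> mfin (web X) \<inter> mfin A"
  then have "monomial (\<lambda>a. if a \<in> A then x a else 0) \<mu> = monomial x \<mu>"
    by (intro monomial_cong) (auto simp: mfin_def)
  then show "ennreal (f \<mu> b * monomial (\<lambda>a. if a \<in> A then x a else 0) \<mu>) = ennreal (f \<mu> b * monomial x \<mu>)" by simp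
qed (use assms in \<open>auto simp: mfin_def\<close>)

lemma hat_inject:
  assumes X: "is_pcs X" and Y: "is_pcs Y" and f: "f \<in> pcoh_hom X Y" and g: "g \<in> pcoh_hom X Y"
    and eq: "\<And>x. x \<in> pts X \<Longrightarrow> hat X f x = hat X g x"
  shows "f = g"
proof (intro ext)
  interpret F: pcs_hom X Y f using X Y f by (simp add: pcs_hom_def pcspace_def pcs_hom_axioms_def)
  interpret G: pcs_hom X Y g using X Y g by (simp add: pcs_hom_def pcspace_def pcs_hom_axioms_def)
  fix \<mu> b
  show "f \<mu> b = g \<mu> b"
  proof (cases "\<mu> \<in> mfin (web X)")
    case False
    then show ?thesis using f g by (simp add: pcoh_hom_def)
  next
    case True
    \<comment> \<open>The coefficient at \<open>\<mu>\<close> is still visible when all variables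
      other than those of \<open>\<mu>\<close> are set to 0.\<close>
    define A where "A = set_mset \<mu>"
    have A: "finite A" "A \<subseteq> web X" using True by (auto simp: A_def mfin_def)
    then obtain r where r: "\<forall>a\<in>A. 0 < r a" "(\<lambda>b. if b \<in> A then r b else 0) \<in> pts X"
      using F.X.pts_box by blast
    show ?thesis
    proof (rule multi_powser_unique[of A r "\<lambda>\<mu>. f \<mu> b" "\<lambda>\<mu>. g \<mu> b"])
      show "\<mu> \<in> mfin A" by (simp add: A_def mfin_def)
      fix x assume x: "\<And>a. a \<in> A \<Longrightarrow> 0 < x a \<and> x a < r a"
      have xp: "(\<lambda>a. if a \<in> A then x a else 0) \<in> pts X"
        by (rule F.X.pts_down[OF r(2)]) (use x in \<open>auto intro: less_imp_le\<close>)
      have m: "0 \<le> monomial x \<mu>" if "\<mu> \<in> mfin A" for \<mu>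
        using that x unfolding monomial_def mfin_def by (intro prod_nonneg) (auto intro!: zero_le_power less_imp_le)
      have 1: "(\<Sum>\<^sub>\<infinity>\<mu>\<in>mfin A. ennreal (f \<mu> b * monomial x \<mu>)) < \<infinity>"
        using F.series_finite[OF xp, of b] by (simp add: F.X.series_restrict[OF A(2)])
      have 2: "(\<Sum>\<^sub>\<infinity>\<mu>\<in>mfin A. ennreal (g \<mu> b * monomial x \<mu>)) < \<infinity>"
        using G.series_finite[OF xp, of b] by (simp add: F.X.series_restrict[OF A(2)])
      note f1 = infsum_real_of_ennreal[OF mult_nonneg_nonneg[OF F.coeff_nonneg m] 1]
      note g1 = infsum_real_of_ennreal[OF mult_nonneg_nonneg[OF G.coeff_nonneg m] 2]
      have "(\<Sum>\<^sub>\<infinity>\<mu>\<in>mfin A. ennreal (f \<mu> b * monomial x \<mu>)) = (\<Sum>\<^sub>\<infinity>\<mu>\<in>mfin A. ennreal (g \<mu> b * monomial x \<mu>))"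
        using F.ennreal_hat[OF xp, of b] G.ennreal_hat[OF xp, of b] eq[OF xp]
        by (simp add: F.X.series_restrict[OF A(2)])
      then have "ennreal (\<Sum>\<^sub>\<infinity>\<mu>\<in>mfin A. f \<mu> b * monomial x \<mu>) = ennreal (\<Sum>\<^sub>\<infinity>\<mu>\<in>mfin A. g \<mu> b * monomial x \<mu>)"
        using f1(2) g1(2) by simp
      then have "(\<Sum>\<^sub>\<infinity>\<mu>\<in>mfin A. f \<mu> b * monomial x \<mu>) = (\<Sum>\<^sub>\<infinity>\<mu>\<in>mfin A. g \<mu> b * monomial x \<mu>)"
        by (subst (asm) ennreal_inj) (auto intro!: infsum_nonneg mult_nonneg_nonneg F.coeff_nonneg G.coeff_nonneg m)
      with f1(1) g1(1) show "(\<lambda>\<mu>. f \<mu> b * monomial x \<mu>) summable_on mfin A \<and> (\<lambda>\<mu>. g \<mu> b * monomial x \<mu>) summable_on mfin A \<and>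
        (\<Sum>\<^sub>\<infinity>\<mu>\<in>mfin A. f \<mu> b * monomial x \<mu>) = (\<Sum>\<^sub>\<infinity>\<mu>\<in>mfin A. g \<mu> b * monomial x \<mu>)" by blast
    qed (use A r in auto)
  qed
qed

section \<open>Newton expansion on multisets\<close>

text \<open>The multi-index binomial coefficient: outside the support of \<open>\<nu>\<close> the
  factors would be \<open>k choose 0 = 1\<close>.\<close>

definition mbinom :: "'a multiset \<Rightarrow> 'a multiset \<Rightarrow> real" where
  "mbinom \<mu> \<nu> = (\<Prod>a\<in>set_mset \<nu>. real (count \<mu> a choose count \<nu> a))"

definition mfact :: "'a multiset \<Rightarrow> real" where
  "mfact \<nu> = (\<Prod>a\<in>set_mset \<nu>. fact (count \<nu> a))"

lemma mbinom_nonneg: "0 \<le> mbinom \<mu> \<nu>"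
  by (auto simp: mbinom_def intro: prod_nonneg)

lemma mbinom_self: "mbinom \<mu> \<mu> = 1"
  by (simp add: mbinom_def)

lemma mbinom_eq_0: "\<not> \<nu> \<subseteq># \<mu> \<Longrightarrow> mbinom \<mu> \<nu> = 0"
proof -
  assume "\<not> \<nu> \<subseteq># \<mu>"
  then obtain a where a: "count \<mu> a < count \<nu> a" by (auto simp: subseteq_mset_def not_le)
  then have "a \<in># \<nu>" by (metis count_eq_zero_iff not_less_zero)
  then show ?thesis unfolding mbinom_def using a by (intro prod_zero) (auto intro!: bexI[of _ a] binomial_eq_0)
qed

lemma mfact_pos: "0 < mfact \<nu>"
  by (auto simp: mfact_def intro: prod_pos)

text \<open>Compare the falling factorials factor by factor: \<open>r * k - i <= r * (k - i)\<close>
  because \<open>r * i <= i\<close>. This is the source of the damping of high degrees.\<close>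

lemma binomial_scale_le:
  assumes "0 \<le> r" "r \<le> 1" "real k' = r * real k"
  shows "real (k' choose j) \<le> r ^ j * real (k choose j)"
proof (cases "j \<le> k'")
  case True
  have "fact j * real (k' choose j) = (\<Prod>i=0..<j. real k' - real i)"
    by (simp add: binomial_gbinomial gbinomial_mult_fact)
  also have "\<dots> \<le> (\<Prod>i=0..<j. r * (real k - real i))"
  proof (rule prod_mono, safe)
    fix i assume "i \<in> {0..<j}"
    then show "0 \<le> real k' - real i" using True by simp
    have "r * real i \<le> 1 * real i" using assms by (intro mult_right_mono) auto
    then show "real k' - real i \<le> r * (real k - real i)" using assms by (simp add: right_diff_distrib)
  qed
  also have "\<dots> = r ^ j * (fact j * real (k choose j))"
    by (simp add: prod.distrib binomial_gbinomial gbinomial_mult_fact)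
  finally show ?thesis by (simp add: mult.left_commute)
next
  case False
  then show ?thesis using assms by (simp add: binomial_eq_0)
qed

lemma power_size_mset: "c ^ size \<nu> = (\<Prod>a\<in>set_mset \<nu>. c ^ count \<nu> a)"
  by (simp add: size_multiset_overloaded_eq power_sum)

lemma mbinom_scale_le:
  assumes r: "0 \<le> r" "r \<le> 1" "\<And>a. real (count \<kappa>' a) = r * real (count \<kappa> a)"
  shows "mbinom \<kappa>' \<nu> \<le> r ^ size \<nu> * mbinom \<kappa> \<nu>"
  unfolding mbinom_def power_size_mset prod.distrib[symmetric]
  by (intro prod_mono) (auto intro!: binomial_scale_le r)

text \<open>The falling factorial divided by \<open>(2 ^ n) ^ j\<close> is a product of
  \<open>j\<close> factors \<open>k / 2 ^ m - i / 2 ^ n\<close>, and the corrections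
  \<open>i / 2 ^ n\<close> tend to 0.\<close>

lemma tendsto_binomial_dyadic:
  "(\<lambda>n. real ((2 ^ (n - m) * k) choose j) * fact j / (2 ^ n) ^ j) \<longlonglongrightarrow> (real k / 2 ^ m) ^ j"
proof -
  have "(\<lambda>n. \<Prod>i=0..<j. real k / 2 ^ m - real i * (1/2) ^ n) \<longlonglongrightarrow> (\<Prod>i=0..<j. real k / 2 ^ m - real i * 0)"
    by (intro tendsto_intros LIMSEQ_realpow_zero) auto
  then have "(\<lambda>n. \<Prod>i=0..<j. real k / 2 ^ m - real i * (1/2) ^ n) \<longlonglongrightarrow> (real k / 2 ^ m) ^ j" by simp
  moreover have "\<forall>\<^sub>F n in sequentially. (\<Prod>i=0..<j. real k / 2 ^ m - real i * (1/2) ^ n) =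
     real ((2 ^ (n - m) * k) choose j) * fact j / (2 ^ n) ^ j"
    using eventually_ge_at_top[of m]
  proof eventually_elim
    case (elim n)
    have "real ((2 ^ (n - m) * k) choose j) * fact j / (2 ^ n) ^ j = (\<Prod>i=0..<j. (real (2 ^ (n - m) * k) - real i) / 2 ^ n)"
      unfolding binomial_gbinomial gbinomial_mult_fact' by (simp add: prod_dividef)
    also have "\<dots> = (\<Prod>i=0..<j. real k / 2 ^ m - real i * (1/2) ^ n)"
    proof (rule prod.cong)
      have "(2::real) ^ n = 2 ^ (n - m) * 2 ^ m" using elim by (simp flip: power_add)
      then have "real (2 ^ (n - m) * k) / 2 ^ n = real k / 2 ^ m" by simp
      then show "(real (2 ^ (n - m) * k) - real i) / 2 ^ n = real k / 2 ^ m - real i * (1/2) ^ n" for i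
        by (simp add: diff_divide_distrib power_one_over)
    qed simp
    finally show ?case by simp
  qed
  ultimately show ?thesis by (rule Lim_transform_eventually)
qed

text \<open>The multiset holds the numerators; finiteness of the support comes for free, and
  Newton's multi-indices are its submultisets.\<close>

definition dyadic :: "nat \<Rightarrow> 'a multiset \<Rightarrow> 'a \<Rightarrow> real" where
  "dyadic n \<kappa> = (\<lambda>a. real (count \<kappa> a) / 2 ^ n)"

lemma dyadic_refine: "m \<le> n \<Longrightarrow> dyadic n (repeat_mset (2 ^ (n - m)) \<kappa>) = dyadic m \<kappa>"
  by (simp add: dyadic_def fun_eq_iff field_simps flip: power_add)

lemma tendsto_mbinom_dyadic:
  "(\<lambda>n. mbinom (repeat_mset (2 ^ (n - m)) \<kappa>) \<nu> * mfact \<nu> / (2 ^ n) ^ size \<nu>) \<longlonglongrightarrow> monomial (dyadic m \<kappa>) \<nu>"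
  unfolding mbinom_def mfact_def monomial_def power_size_mset prod.distrib[symmetric] prod_dividef[symmetric] dyadic_def count_repeat_mset
  by (intro tendsto_prod tendsto_binomial_dyadic)

lemma finite_mfin_size: "finite A \<Longrightarrow> finite {\<nu> \<in> mfin A. size \<nu> \<le> p}"
proof (rule finite_subset)
  show "{\<nu> \<in> mfin A. size \<nu> \<le> p} \<subseteq> mset ` {xs. set xs \<subseteq> A \<and> length xs \<le> p}"
  proof
    fix \<nu> assume \<nu>: "\<nu> \<in> {\<nu> \<in> mfin A. size \<nu> \<le> p}"
    obtain xs where "mset xs = \<nu>" using ex_mset by blast
    then show "\<nu> \<in> mset ` {xs. set xs \<subseteq> A \<and> length xs \<le> p}" using \<nu> by (auto simp: mfin_def)
  qed
qed (simp add: finite_lists_length_le)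

lemma finite_submsets: "finite {\<nu>. \<nu> \<subseteq># \<mu>}"
  by (rule finite_subset[OF _ finite_mfin_size[of "set_mset \<mu>" "size \<mu>"]])
     (auto simp: mfin_def dest: size_mset_mono set_mset_mono)

text \<open>Newton's forward differences at the origin, defined by inverting the Newton expansion.\<close>

function newton :: "('a multiset \<Rightarrow> real) \<Rightarrow> 'a multiset \<Rightarrow> real" where
  "newton \<Phi> \<mu> = \<Phi> \<mu> - (\<Sum>\<nu>\<in>{\<nu>. \<nu> \<subset># \<mu>}. mbinom \<mu> \<nu> * newton \<Phi> \<nu>)"
  by auto
termination
  by (relation "Wellfounded.measure (\<lambda>(\<Phi>, \<mu>). size \<mu>)") (auto simp: mset_subset_size)

declare newton.simps [simp del]

lemma newton_expansion: "\<Phi> \<mu> = (\<Sum>\<nu>\<in>{\<nu>. \<nu> \<subseteq># \<mu>}. mbinom \<mu> \<nu> * newton \<Phi> \<nu>)"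
proof -
  have e: "{\<nu>. \<nu> \<subseteq># \<mu>} = insert \<mu> {\<nu>. \<nu> \<subset># \<mu>}" by (auto simp: subset_mset.le_less)
  have "finite {\<nu>. \<nu> \<subset># \<mu>}" by (rule finite_subset[OF _ finite_submsets[of \<mu>]]) auto
  then show ?thesis unfolding e by (simp add: mbinom_self newton.simps[of \<Phi> \<mu>])
qed

section \<open>From cubes of labelled steps to multi-indices\<close>

text \<open>A pair \<open>(a, i)\<close> stands for the \<open>i\<close>-th unit step in direction
  \<open>a\<close>. Labels turn repeated steps into distinct directions of a cube; the shape forgets
  them again and keeps the number of steps in each direction.\<close>

definition shape :: "('a \<times> nat) set \<Rightarrow> 'a multiset" where
  "shape J = image_mset fst (mset_set J)"

lemma count_shape: "finite J \<Longrightarrow> count (shape J) a = card {i. (a, i) \<in> J}"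
proof -
  assume J: "finite J"
  have "count (shape J) a = card {p \<in> J. fst p = a}"
    unfolding shape_def by (rule count_image_mset_eq_card_vimage[OF J])
  also have "{p \<in> J. fst p = a} = Pair a ` {i. (a, i) \<in> J}" by force
  also have "card \<dots> = card {i. (a, i) \<in> J}" by (rule card_image) (auto simp: inj_on_def)
  finally show ?thesis .
qed

lemma finite_fibre: "finite J \<Longrightarrow> finite {i. (a, i) \<in> J}"
  by (rule finite_subset[of _ "snd ` J"]) force+

lemma shape_mono: "finite J \<Longrightarrow> I \<subseteq> J \<Longrightarrow> shape I \<subseteq># shape J"
  unfolding shape_def by (intro image_mset_subseteq_mono subset_imp_msubset_mset_set)

text \<open>A subset of given shape amounts to an independent choice, for each \<open>a\<close> in
  the support of \<nu>, of a fibre with \<open>count \<nu> a\<close> elements.\<close>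

lemma card_shape:
  assumes J: "finite J"
  shows "real (card {I. I \<subseteq> J \<and> shape I = \<nu>}) = mbinom (shape J) \<nu>"
proof -
  let ?T = "\<lambda>a. {B. B \<subseteq> {i. (a, i) \<in> J} \<and> card B = count \<nu> a}"
  have fin: "finite I" if "I \<subseteq> J" for I using J that finite_subset by auto
  have "bij_betw (\<lambda>I. \<lambda>a\<in>set_mset \<nu>. {i. (a, i) \<in> I}) {I. I \<subseteq> J \<and> shape I = \<nu>} (Pi\<^sub>E (set_mset \<nu>) ?T)"
  proof (rule bij_betw_byWitness[where f' = "\<lambda>h. Sigma (set_mset \<nu>) h"])
    have fst_in: "a \<in># \<nu>" if "I \<subseteq> J" "shape I = \<nu>" "(a, i) \<in> I" for I a i
    proof -
      have "0 < card {i. (a, i) \<in> I}" using that finite_fibre[OF fin[OF that(1)], of a] by (auto simp: card_gt_0_iff)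
      then show ?thesis using count_shape[OF fin[OF that(1)], of a] that(2) by (metis count_greater_zero_iff)
    qed
    show "\<forall>I\<in>{I. I \<subseteq> J \<and> shape I = \<nu>}. Sigma (set_mset \<nu>) (\<lambda>a\<in>set_mset \<nu>. {i. (a, i) \<in> I}) = I"
      using fst_in by auto
    show "\<forall>h\<in>Pi\<^sub>E (set_mset \<nu>) ?T. (\<lambda>a\<in>set_mset \<nu>. {i. (a, i) \<in> Sigma (set_mset \<nu>) h}) = h"
      by (auto simp: fun_eq_iff PiE_iff extensional_def)
    show "(\<lambda>I. \<lambda>a\<in>set_mset \<nu>. {i. (a, i) \<in> I}) ` {I. I \<subseteq> J \<and> shape I = \<nu>} \<subseteq> Pi\<^sub>E (set_mset \<nu>) ?T"
      using count_shape[OF fin] by auto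
    show "Sigma (set_mset \<nu>) ` Pi\<^sub>E (set_mset \<nu>) ?T \<subseteq> {I. I \<subseteq> J \<and> shape I = \<nu>}"
    proof (rule image_subsetI)
      fix h assume h: "h \<in> Pi\<^sub>E (set_mset \<nu>) ?T"
      have sub: "Sigma (set_mset \<nu>) h \<subseteq> J" using h by (auto simp: PiE_iff)
      have "count (shape (Sigma (set_mset \<nu>) h)) a = count \<nu> a" for a
      proof (cases "a \<in># \<nu>")
        case True
        then have "{i. (a, i) \<in> Sigma (set_mset \<nu>) h} = h a" by auto
        then show ?thesis using True h by (auto simp: count_shape[OF fin[OF sub]] PiE_iff)
      next
        case False
        then have "{i. (a, i) \<in> Sigma (set_mset \<nu>) h} = {}" by auto
        then show ?thesis using False by (simp only: count_shape[OF fin[OF sub]] not_in_iff card.empty)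
      qed
      then show "Sigma (set_mset \<nu>) h \<in> {I. I \<subseteq> J \<and> shape I = \<nu>}" using sub by (simp add: multiset_eq_iff)
    qed
  qed
  then have "card {I. I \<subseteq> J \<and> shape I = \<nu>} = card (Pi\<^sub>E (set_mset \<nu>) ?T)" by (rule bij_betw_same_card)
  also have "\<dots> = (\<Prod>a\<in>set_mset \<nu>. card (?T a))" by (rule card_PiE) simp
  also have "\<dots> = (\<Prod>a\<in>set_mset \<nu>. count (shape J) a choose count \<nu> a)"
    by (intro prod.cong refl) (simp add: n_subsets[OF finite_fibre[OF J]] count_shape[OF J])
  finally show ?thesis by (simp add: mbinom_def)
qed

text \<open>Grouping the subsets of \<open>J\<close> by shape turns Newton's expansion at
  \<open>shape J\<close> into a sum over \<open>Pow J\<close>. Thus \<open>newton\<close> and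
  \<open>d\<close> solve the same triangular system, and agree by induction on the
  cardinality.\<close>

lemma newton_eq_cube:
  assumes N: "finite N" and d: "\<And>I. I \<subseteq> N \<Longrightarrow> \<Phi> (shape I) = (\<Sum>J\<in>Pow I. d J)"
  shows "J \<subseteq> N \<Longrightarrow> d J = newton \<Phi> (shape J)"
proof (induction "card J" arbitrary: J rule: less_induct)
  case less
  have J: "finite J" using less.prems N finite_subset by auto
  have "(\<Sum>I\<in>Pow J. newton \<Phi> (shape I)) = (\<Sum>\<nu>\<in>{\<nu>. \<nu> \<subseteq># shape J}. \<Sum>I\<in>{I \<in> Pow J. shape I = \<nu>}. newton \<Phi> (shape I))"
    by (rule sum.group[symmetric]) (use J finite_submsets shape_mono[OF J] in auto)
  also have "\<dots> = (\<Sum>\<nu>\<in>{\<nu>. \<nu> \<subseteq># shape J}. mbinom (shape J) \<nu> * newton \<Phi> \<nu>)"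
    by (intro sum.cong refl) (simp add: card_shape[OF J, symmetric])
  also have "\<dots> = (\<Sum>I\<in>Pow J. d I)" using newton_expansion[of \<Phi> "shape J"] d[OF less.prems] by simp
  finally have *: "(\<Sum>I\<in>Pow J. newton \<Phi> (shape I)) = (\<Sum>I\<in>Pow J. d I)" .
  have P: "Pow J = insert J {I. I \<subset> J}" by auto
  have fin: "finite {I. I \<subset> J}" by (rule finite_subset[of _ "Pow J"]) (use J in auto)
  have "(\<Sum>I\<in>{I. I \<subset> J}. newton \<Phi> (shape I)) = (\<Sum>I\<in>{I. I \<subset> J}. d I)"
    by (intro sum.cong refl less.hyps[symmetric]) (use less.prems psubset_card_mono[OF J] in auto)
  then show ?case using * unfolding P using fin by simp
qed

lemma shape_grid: "shape (Sigma (set_mset \<kappa>) (\<lambda>a. {..<count \<kappa> a})) = \<kappa>"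
proof (rule multiset_eqI)
  fix a
  have "count (shape (Sigma (set_mset \<kappa>) (\<lambda>a. {..<count \<kappa> a}))) a = card {i. a \<in># \<kappa> \<and> i < count \<kappa> a}"
    by (subst count_shape) auto
  also have "{i. a \<in># \<kappa> \<and> i < count \<kappa> a} = {..<count \<kappa> a}" by (auto simp flip: count_greater_zero_iff)
  finally show "count (shape (Sigma (set_mset \<kappa>) (\<lambda>a. {..<count \<kappa> a}))) a = count \<kappa> a" by simp
qed

section \<open>Stable functions are power series\<close>

text \<open>The two properties of a coordinate of a stable map from which its power series is
  derived. Cubes start at the origin, where Newton's differences are taken, and their index type is
  that of labelled steps.\<close>

locale absolutely_monotone = pcspace X for X :: "'a pcs" +
  fixes \<phi> :: "('a \<Rightarrow> real) \<Rightarrow> real"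
  assumes cube: "\<And>(N :: ('a \<times> nat) set) u. finite N \<Longrightarrow> (\<And>i a. i \<in> N \<Longrightarrow> 0 \<le> u i a) \<Longrightarrow>
      (\<lambda>a. \<Sum>i\<in>N. u i a) \<in> pts X \<Longrightarrow>
      \<exists>d. (\<forall>J. J \<subseteq> N \<longrightarrow> 0 \<le> d J) \<and> (\<forall>I. I \<subseteq> N \<longrightarrow> \<phi> (\<lambda>a. \<Sum>i\<in>I. u i a) = (\<Sum>J\<in>Pow I. d J))"
    and cont: "\<And>s x. (\<And>n. s n \<in> pts X) \<Longrightarrow> x \<in> pts X \<Longrightarrow> (\<And>a. incseq (\<lambda>n. s n a)) \<Longrightarrow>
      (\<And>a. (\<lambda>n. s n a) \<longlonglongrightarrow> x a) \<Longrightarrow> (\<lambda>n. \<phi> (s n)) \<longlonglongrightarrow> \<phi> x"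
begin

definition D :: "nat \<Rightarrow> 'a multiset \<Rightarrow> real" where
  "D n = newton (\<lambda>\<kappa>. \<phi> (dyadic n \<kappa>))"

lemma dyadic_expansion: "\<phi> (dyadic n \<kappa>) = (\<Sum>\<nu>\<in>{\<nu>. \<nu> \<subseteq># \<kappa>}. mbinom \<kappa> \<nu> * D n \<nu>)"
  unfolding D_def by (rule newton_expansion)

text \<open>The grid \<open>N\<close> has \<open>count \<kappa> a\<close> steps of length
  \<open>1 / 2 ^ n\<close> in each direction \<open>a\<close>, so its shape is \<kappa>; by
  \<open>newton_eq_cube\<close> the top difference of this cube is
  \<open>D n \<kappa>\<close>.\<close>

lemma D_nonneg:
  assumes "dyadic n \<kappa> \<in> pts X"
  shows "0 \<le> D n \<kappa>"
proof -
  define N where "N = Sigma (set_mset \<kappa>) (\<lambda>a. {..<count \<kappa> a})"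
  define u where "u = (\<lambda>(p :: 'a \<times> nat) a. if a = fst p then 1 / 2 ^ n else (0::real))"
  have N: "finite N" by (auto simp: N_def)
  have sum: "(\<lambda>a. \<Sum>p\<in>I. u p a) = dyadic n (shape I)" if I: "I \<subseteq> N" for I
  proof
    fix a
    have fI: "finite I" using N I finite_subset by auto
    have "(\<Sum>p\<in>I. u p a) = (\<Sum>p\<in>{p \<in> I. fst p = a}. 1 / 2 ^ n)"
      unfolding u_def by (rule sum.mono_neutral_cong_right) (use fI in auto)
    also have "\<dots> = real (card {p \<in> I. fst p = a}) / 2 ^ n" by simp
    also have "card {p \<in> I. fst p = a} = count (shape I) a"
      unfolding shape_def by (rule count_image_mset_eq_card_vimage[OF fI, symmetric])
    finally show "(\<Sum>p\<in>I. u p a) = dyadic n (shape I) a" by (simp add: dyadic_def)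
  qed
  have sN: "shape N = \<kappa>" unfolding N_def by (rule shape_grid)
  have "\<exists>d. (\<forall>J. J \<subseteq> N \<longrightarrow> 0 \<le> d J) \<and> (\<forall>I. I \<subseteq> N \<longrightarrow> \<phi> (\<lambda>a. \<Sum>i\<in>I. u i a) = (\<Sum>J\<in>Pow I. d J))"
    by (rule cube[OF N]) (use sum[of N] sN assms in \<open>auto simp: u_def\<close>)
  then obtain d where d: "\<And>J. J \<subseteq> N \<Longrightarrow> 0 \<le> d J" "\<And>I. I \<subseteq> N \<Longrightarrow> \<phi> (dyadic n (shape I)) = (\<Sum>J\<in>Pow I. d J)"
    using sum by auto
  have "d N = newton (\<lambda>\<kappa>. \<phi> (dyadic n \<kappa>)) (shape N)"
    by (rule newton_eq_cube[OF N d(2)]) auto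
  then show ?thesis using d(1)[of N] by (simp add: D_def sN)
qed

lemma dyadic_down:
  assumes "dyadic n \<kappa> \<in> pts X" "\<nu> \<subseteq># \<kappa>"
  shows "dyadic n \<nu> \<in> pts X"
  by (rule pts_down[OF assms(1)])
     (use assms(2) in \<open>auto simp: dyadic_def intro!: divide_right_mono dest: mset_subset_eq_count\<close>)

lemma dyadic_term_le:
  assumes "dyadic n \<kappa> \<in> pts X"
  shows "mbinom \<kappa> \<nu> * D n \<nu> \<le> \<phi> (dyadic n \<kappa>)"
proof (cases "\<nu> \<subseteq># \<kappa>")
  case True
  then show ?thesis
    unfolding dyadic_expansion
    by (intro member_le_sum finite_submsets)
       (use assms in \<open>auto intro!: mult_nonneg_nonneg mbinom_nonneg D_nonneg dest: dyadic_down\<close>)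
next
  case False
  then have "0 \<le> \<phi> (dyadic n \<kappa>)"
    unfolding dyadic_expansion
    by (intro sum_nonneg) (use assms in \<open>auto intro!: mult_nonneg_nonneg mbinom_nonneg D_nonneg dest: dyadic_down\<close>)
  then show ?thesis using False by (simp add: mbinom_eq_0)
qed

section \<open>Difference quotients and their limits\<close>

text \<open>The difference quotient of order \<nu> at step \<open>1 / 2 ^ n\<close>, divided by the
  factorials: an approximate Taylor coefficient. The complementary weight in \<open>F_weight\<close>
  tends to the monomial, by \<open>tendsto_mbinom_dyadic\<close>.\<close>

definition F :: "nat \<Rightarrow> 'a multiset \<Rightarrow> real" where
  "F n \<nu> = D n \<nu> * (2 ^ n) ^ size \<nu> / mfact \<nu>"

lemma F_weight: "F n \<nu> * (mbinom \<kappa> \<nu> * mfact \<nu> / (2 ^ n) ^ size \<nu>) = mbinom \<kappa> \<nu> * D n \<nu>"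
  using mfact_pos[of \<nu>] by (simp add: F_def)

lemma unit_dyadic:
  assumes A: "finite A" "A \<subseteq> web X"
  obtains m where "dyadic m (mset_set A) \<in> pts X"
proof -
  obtain r where r: "\<forall>a\<in>A. 0 < r a" "(\<lambda>b. if b \<in> A then r b else 0) \<in> pts X"
    using pts_box[OF A] by blast
  \<comment> \<open>Inserting 1 keeps the minimum defined, and positive, when \<open>A\<close> is
    empty.\<close>
  define e where "e = Min (insert 1 (r ` A))"
  have e: "0 < e" "\<And>a. a \<in> A \<Longrightarrow> e \<le> r a" using r(1) A by (auto simp: e_def)
  obtain m where m: "(1/2) ^ m < e" using real_arch_pow_inv[OF e(1), of "1/2"] by auto
  have "dyadic m (mset_set A) \<in> pts X"
  proof (rule pts_down[OF r(2)])
    show "dyadic m (mset_set A) a \<le> (if a \<in> A then r a else 0)" for a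
      using m e(2)[of a] A by (auto simp: dyadic_def power_one_over)
  qed (simp add: dyadic_def)
  then show ?thesis by (rule that)
qed

text \<open>At a point that is positive on the support of \<nu>, the term of index \<nu> is at most
  the value of \<phi> there, while its weight tends to a positive number; so
  \<open>F n \<nu>\<close> is eventually bounded. Nonnegativity holds once the mesh is fine enough
  for \<nu> to fit under that point.\<close>

lemma F_eventually:
  assumes \<nu>: "\<nu> \<in> mfin (web X)"
  shows "\<forall>\<^sub>F n in sequentially. 0 \<le> F n \<nu>" "\<exists>M. \<forall>\<^sub>F n in sequentially. F n \<nu> \<le> M"
proof -
  let ?A = "set_mset \<nu>"
  obtain m where m: "dyadic m (mset_set ?A) \<in> pts X"
    using unit_dyadic[of ?A] \<nu> by (auto simp: mfin_def)
  let ?\<kappa> = "\<lambda>n. repeat_mset (2 ^ (n - m)) (mset_set ?A)"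
  let ?w = "\<lambda>n. mbinom (?\<kappa> n) \<nu> * mfact \<nu> / (2 ^ n) ^ size \<nu>"
  have pt: "dyadic n (?\<kappa> n) \<in> pts X" if "m \<le> n" for n using m by (simp add: dyadic_refine[OF that])
  show "\<forall>\<^sub>F n in sequentially. 0 \<le> F n \<nu>"
    \<comment> \<open>This makes \<nu> fit: each count is at most
      \<open>size \<nu> <= n - m <= 2 ^ (n - m)\<close>.\<close>
    using eventually_ge_at_top[of "m + size \<nu>"]
  proof eventually_elim
    case (elim n)
    have "count \<nu> a \<le> count (?\<kappa> n) a" for a
    proof (cases "a \<in># \<nu>")
      case True
      have "count \<nu> a \<le> size \<nu>" by (rule count_le_size)
      also have "\<dots> \<le> n - m" using elim by simp
      also have "\<dots> \<le> 2 ^ (n - m)" by (simp add: less_imp_le)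
      finally show ?thesis using True by simp
    qed (simp add: not_in_iff)
    then have "\<nu> \<subseteq># ?\<kappa> n" by (simp add: subseteq_mset_def)
    then have "0 \<le> D n \<nu>" using elim by (intro D_nonneg dyadic_down[OF pt]) auto
    then show ?case using mfact_pos[of \<nu>] by (simp add: F_def)
  qed
  note pos = this
  have lim: "?w \<longlonglongrightarrow> monomial (dyadic m (mset_set ?A)) \<nu>" by (rule tendsto_mbinom_dyadic)
  let ?c = "monomial (dyadic m (mset_set ?A)) \<nu>"
  have c: "0 < ?c" unfolding monomial_def by (intro prod_pos) (auto simp: dyadic_def)
  have lower: "\<forall>\<^sub>F n in sequentially. ?c / 2 < ?w n" using order_tendstoD(1)[OF lim, of "?c / 2"] c by simp
  have "\<forall>\<^sub>F n in sequentially. F n \<nu> \<le> 2 * \<phi> (dyadic m (mset_set ?A)) / ?c"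
    using lower pos eventually_ge_at_top[of m]
  proof eventually_elim
    case (elim n)
    then have "F n \<nu> * (?c / 2) \<le> F n \<nu> * ?w n" by (intro mult_left_mono) auto
    also have "\<dots> \<le> \<phi> (dyadic m (mset_set ?A))"
      unfolding F_weight using dyadic_term_le[OF pt, of n \<nu>] elim by (simp add: dyadic_refine)
    finally show ?case using c by (simp add: field_simps)
  qed
  then show "\<exists>M. \<forall>\<^sub>F n in sequentially. F n \<nu> \<le> M" by blast
qed

lemma F_Bseq:
  assumes "\<nu> \<in> mfin (web X)"
  shows "\<exists>M>0. \<forall>n. \<bar>F n \<nu>\<bar> \<le> M"
proof -
  obtain M where M: "\<forall>\<^sub>F n in sequentially. F n \<nu> \<le> M" using F_eventually(2)[OF assms] by blast
  have "Bseq (\<lambda>n. F n \<nu>)"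
    by (rule Bseq_eventually_mono[of _ "\<lambda>_. M"])
       (use eventually_conj[OF M F_eventually(1)[OF assms]] in \<open>auto elim!: eventually_mono\<close>)
  then show ?thesis by (simp add: Bseq_def)
qed

lemma limit_coefficients:
  obtains k f where "strict_mono (k :: nat \<Rightarrow> nat)" "\<And>\<nu>. \<nu> \<in> mfin (web X) \<Longrightarrow> (\<lambda>n. F (k n) \<nu>) \<longlonglongrightarrow> f \<nu>"
    "\<And>\<nu>. 0 \<le> f \<nu>"
proof -
  have "\<forall>\<nu>\<in>mfin (web X). \<exists>M>0. \<forall>n. \<bar>F n \<nu>\<bar> \<le> M" using F_Bseq by blast
  from bchoice[OF this] obtain M where M: "\<forall>\<nu>\<in>mfin (web X). 0 < M \<nu> \<and> (\<forall>n. \<bar>F n \<nu>\<bar> \<le> M \<nu>)" ..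
  \<comment> \<open>The diagonal argument \<open>function_convergent_subsequence\<close> asks for
    one bound valid at all indices, hence the normalisation by \<open>M \<nu>\<close>, undone
    below.\<close>
  obtain k where k: "strict_mono (k :: nat \<Rightarrow> nat)"
    "\<And>\<nu>. \<nu> \<in> mfin (web X) \<Longrightarrow> \<exists>l. (\<lambda>n. F (k n) \<nu> / M \<nu>) \<longlonglongrightarrow> l"
  proof (rule function_convergent_subsequence[OF countable_mfin[OF countable_web], of "\<lambda>n \<nu>. F n \<nu> / M \<nu>" 1])
    show "norm (F n \<nu> / M \<nu>) \<le> 1" if "\<nu> \<in> mfin (web X)" for n \<nu>
    proof -
      have "0 < M \<nu>" "\<bar>F n \<nu>\<bar> \<le> M \<nu>" using M that by auto
      then show ?thesis by simp
    qed
  qed blast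
  have "\<exists>l\<ge>0. (\<lambda>n. F (k n) \<nu>) \<longlonglongrightarrow> l" if \<nu>: "\<nu> \<in> mfin (web X)" for \<nu>
  proof -
    obtain l where "(\<lambda>n. F (k n) \<nu> / M \<nu>) \<longlonglongrightarrow> l" using k(2)[OF \<nu>] by blast
    then have "(\<lambda>n. F (k n) \<nu> / M \<nu> * M \<nu>) \<longlonglongrightarrow> l * M \<nu>" by (intro tendsto_intros)
    moreover have "M \<nu> \<noteq> 0" using M \<nu> by fastforce
    ultimately have l: "(\<lambda>n. F (k n) \<nu>) \<longlonglongrightarrow> l * M \<nu>" by simp
    have "\<forall>\<^sub>F n in sequentially. 0 \<le> F (k n) \<nu>"
      using F_eventually(1)[OF \<nu>] filterlim_subseq[OF k(1)] by (auto simp: filterlim_iff)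
    then have "0 \<le> l * M \<nu>" using tendsto_lowerbound[OF l] by simp
    then show ?thesis using l by blast
  qed
  then have "\<forall>\<nu>\<in>mfin (web X). \<exists>l. 0 \<le> l \<and> (\<lambda>n. F (k n) \<nu>) \<longlonglongrightarrow> l" by blast
  from bchoice[OF this] obtain f where f: "\<forall>\<nu>\<in>mfin (web X). 0 \<le> f \<nu> \<and> (\<lambda>n. F (k n) \<nu>) \<longlonglongrightarrow> f \<nu>" ..
  show ?thesis
    by (rule that[OF k(1), of "\<lambda>\<nu>. if \<nu> \<in> mfin (web X) then f \<nu> else 0"]) (use f in auto)
qed

text \<open>\<open>T\<close> is the part of degree at most \<open>p\<close> of the expansion at the
  point \<open>r\<close> times \<open>dyadic m \<kappa>\<close>, which is dyadic of mesh exponent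
  \<open>m + q\<close>. On the finer mesh \<open>n\<close> the omitted terms are compared with those
  at \<open>dyadic m \<kappa>\<close> itself, whose total is a value of \<phi>. The bounds do not
  depend on \<open>n\<close>.\<close>

lemma truncation_bounds:
  fixes p :: nat
  assumes x: "dyadic m \<kappa> \<in> pts X" and n: "m + q \<le> n"
  defines "\<kappa>' \<equiv> repeat_mset (2 ^ (n - (m + q))) (repeat_mset (2 ^ q - 1) \<kappa>)"
  defines "r \<equiv> 1 - (1/2) ^ q"
  defines "T \<equiv> (\<Sum>\<nu>\<in>{\<nu> \<in> mfin (set_mset \<kappa>). size \<nu> \<le> p}. F n \<nu> * (mbinom \<kappa>' \<nu> * mfact \<nu> / (2 ^ n) ^ size \<nu>))"
  shows "T \<le> \<phi> (dyadic (m + q) (repeat_mset (2 ^ q - 1) \<kappa>))"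
    and "\<phi> (dyadic (m + q) (repeat_mset (2 ^ q - 1) \<kappa>)) - T \<le> r ^ p * \<phi> (dyadic m \<kappa>)"
proof -
  let ?S = "{\<nu> \<in> mfin (set_mset \<kappa>). size \<nu> \<le> p}"
  let ?\<kappa> = "repeat_mset (2 ^ (n - m)) \<kappa>"
  have r: "0 \<le> r" "r \<le> 1" by (auto simp: r_def power_le_one)
  have y: "\<phi> (dyadic (m + q) (repeat_mset (2 ^ q - 1) \<kappa>)) = (\<Sum>\<nu>\<in>{\<nu>. \<nu> \<subseteq># \<kappa>'}. mbinom \<kappa>' \<nu> * D n \<nu>)"
    unfolding dyadic_expansion[symmetric] \<kappa>'_def dyadic_refine[OF n] ..
  have nm: "n - m = (n - (m + q)) + q" using n by simp
  \<comment> \<open>On the common mesh the two numerators carry the factors \<open>2 ^ q - 1\<close>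
    and \<open>2 ^ q\<close>, whose quotient is \<open>r\<close>.\<close>
  have cnt: "real (count \<kappa>' a) = r * real (count ?\<kappa> a)" for a
    unfolding \<kappa>'_def r_def count_repeat_mset nm power_add
    by (simp add: of_nat_diff power_one_over field_simps)
  have "real (count \<kappa>' a) \<le> real (count ?\<kappa> a)" for a
    using mult_right_mono[OF r(2), of "real (count ?\<kappa> a)"] unfolding cnt by simp
  then have sub: "\<kappa>' \<subseteq># ?\<kappa>" unfolding subseteq_mset_def of_nat_le_iff by blast
  have pt: "dyadic n ?\<kappa> \<in> pts X" using x n by (simp add: dyadic_refine)
  have Dn: "0 \<le> D n \<nu>" if "\<nu> \<subseteq># ?\<kappa>" for \<nu> using that by (intro D_nonneg dyadic_down[OF pt])
  have set\<kappa>': "set_mset \<nu> \<subseteq> set_mset \<kappa>" if "\<nu> \<subseteq># \<kappa>'" for \<nu>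
    using set_mset_mono[OF that] unfolding \<kappa>'_def by (auto simp: subset_iff simp flip: count_greater_zero_iff)
  have fin: "finite ?S" by (rule finite_mfin_size) simp
  \<comment> \<open>\<open>T\<close> is indexed by a finite set independent of \<open>n\<close>, to
    allow a termwise limit. Indices not contained in \<open>\<kappa>'\<close> contribute 0, since
    \<open>mbinom\<close> vanishes.\<close>
  have T: "T = (\<Sum>\<nu>\<in>{\<nu>. \<nu> \<subseteq># \<kappa>' \<and> size \<nu> \<le> p}. mbinom \<kappa>' \<nu> * D n \<nu>)"
    unfolding T_def F_weight
    by (rule sum.mono_neutral_right[OF fin]) (use set\<kappa>' mbinom_eq_0[of _ \<kappa>'] in \<open>auto simp: mfin_def\<close>)
  have fin': "finite {\<nu>. \<nu> \<subseteq># \<kappa>' \<and> P \<nu>}" for P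
    by (rule finite_subset[OF _ finite_submsets[of \<kappa>']]) auto
  have "{\<nu>. \<nu> \<subseteq># \<kappa>'} = {\<nu>. \<nu> \<subseteq># \<kappa>' \<and> size \<nu> \<le> p} \<union> {\<nu>. \<nu> \<subseteq># \<kappa>' \<and> p < size \<nu>}" by auto
  then have split: "\<phi> (dyadic (m + q) (repeat_mset (2 ^ q - 1) \<kappa>)) =
      T + (\<Sum>\<nu>\<in>{\<nu>. \<nu> \<subseteq># \<kappa>' \<and> p < size \<nu>}. mbinom \<kappa>' \<nu> * D n \<nu>)"
    unfolding y T by (simp only:) (rule sum.union_disjoint[OF fin' fin'], auto)
  have sub': "\<nu> \<subseteq># \<kappa>' \<Longrightarrow> \<nu> \<subseteq># ?\<kappa>" for \<nu> using sub subset_mset.order_trans by blast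
  have "0 \<le> (\<Sum>\<nu>\<in>{\<nu>. \<nu> \<subseteq># \<kappa>' \<and> p < size \<nu>}. mbinom \<kappa>' \<nu> * D n \<nu>)"
    by (intro sum_nonneg mult_nonneg_nonneg mbinom_nonneg Dn sub') auto
  then show "T \<le> \<phi> (dyadic (m + q) (repeat_mset (2 ^ q - 1) \<kappa>))" unfolding split by simp
  have "(\<Sum>\<nu>\<in>{\<nu>. \<nu> \<subseteq># \<kappa>' \<and> p < size \<nu>}. mbinom \<kappa>' \<nu> * D n \<nu>) \<le>
        (\<Sum>\<nu>\<in>{\<nu>. \<nu> \<subseteq># \<kappa>' \<and> p < size \<nu>}. r ^ p * (mbinom ?\<kappa> \<nu> * D n \<nu>))"
  proof (rule sum_mono)
    fix \<nu> assume \<nu>: "\<nu> \<in> {\<nu>. \<nu> \<subseteq># \<kappa>' \<and> p < size \<nu>}"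
    have "mbinom \<kappa>' \<nu> \<le> r ^ size \<nu> * mbinom ?\<kappa> \<nu>" by (rule mbinom_scale_le[OF r cnt])
    also have "\<dots> \<le> r ^ p * mbinom ?\<kappa> \<nu>"
      using \<nu> r by (intro mult_right_mono power_decreasing mbinom_nonneg) auto
    finally show "mbinom \<kappa>' \<nu> * D n \<nu> \<le> r ^ p * (mbinom ?\<kappa> \<nu> * D n \<nu>)"
      using mult_right_mono[OF _ Dn[OF sub'], of "mbinom \<kappa>' \<nu>" "r ^ p * mbinom ?\<kappa> \<nu>" \<nu>] \<nu> by (simp add: mult.assoc)
  qed
  also have "\<dots> \<le> (\<Sum>\<nu>\<in>{\<nu>. \<nu> \<subseteq># ?\<kappa>}. r ^ p * (mbinom ?\<kappa> \<nu> * D n \<nu>))"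
    by (rule sum_mono2[OF finite_submsets]) (use sub' Dn r in \<open>auto intro!: mult_nonneg_nonneg mbinom_nonneg\<close>)
  also have "\<dots> = r ^ p * \<phi> (dyadic m \<kappa>)"
    using dyadic_expansion[of n ?\<kappa>] n by (simp add: dyadic_refine sum_distrib_left)
  finally show "\<phi> (dyadic (m + q) (repeat_mset (2 ^ q - 1) \<kappa>)) - T \<le> r ^ p * \<phi> (dyadic m \<kappa>)" unfolding split by simp
qed

text \<open>The limit along \<open>k\<close> is taken first, with \<open>p\<close> fixed, where the
  sums are finite; this squeezes the partial sum of degree \<open>p\<close> between
  \<open>\<phi> y - r ^ p * \<phi> (dyadic m \<kappa>)\<close> and \<open>\<phi> y\<close>. Then
  \<open>p\<close> tends to infinity. The output index \<open>b\<close> is a dummy, as \<phi> has a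
  single coordinate but \<open>series\<close> takes a matrix.\<close>

lemma power_series_dyadic:
  fixes q :: nat
  assumes k: "strict_mono (k :: nat \<Rightarrow> nat)" and f: "\<And>\<nu>. \<nu> \<in> mfin (web X) \<Longrightarrow> (\<lambda>n. F (k n) \<nu>) \<longlonglongrightarrow> f \<nu>"
    "\<And>\<nu>. 0 \<le> f \<nu>" and x: "dyadic m \<kappa> \<in> pts X"
  defines "y \<equiv> dyadic (m + q) (repeat_mset (2 ^ q - 1) \<kappa>)"
  shows "series X (\<lambda>\<mu> _. f \<mu>) y b = ennreal (\<phi> y)"
proof -
  define r :: real where "r = 1 - (1/2) ^ q"
  let ?A = "set_mset \<kappa>"
  let ?S = "\<lambda>p. {\<nu> \<in> mfin ?A. size \<nu> \<le> p}"
  have r: "0 \<le> r" "r < 1" by (auto simp: r_def power_le_one)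
  have A: "?A \<subseteq> web X"
  proof
    fix a assume "a \<in># \<kappa>"
    then have "dyadic m \<kappa> a \<noteq> 0" by (simp add: dyadic_def)
    then show "a \<in> web X" using pts_outside[OF x] by blast
  qed
  have y0: "0 \<le> y a" for a by (simp add: y_def dyadic_def)
  have S: "finite (?S p)" for p by (rule finite_mfin_size) simp
  have kge: "\<forall>\<^sub>F j in sequentially. m + q \<le> k j"
    using filterlim_subseq[OF k] by (auto simp: filterlim_at_top)
  let ?T = "\<lambda>n p. \<Sum>\<nu>\<in>?S p. F n \<nu> * (mbinom (repeat_mset (2 ^ (n - (m + q))) (repeat_mset (2 ^ q - 1) \<kappa>)) \<nu> * mfact \<nu> / (2 ^ n) ^ size \<nu>)"
  have lim: "(\<lambda>j. ?T (k j) p) \<longlonglongrightarrow> (\<Sum>\<nu>\<in>?S p. f \<nu> * monomial y \<nu>)" for p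
  proof (intro tendsto_sum tendsto_mult)
    fix \<nu> assume "\<nu> \<in> ?S p"
    then show "(\<lambda>j. F (k j) \<nu>) \<longlonglongrightarrow> f \<nu>" using A by (intro f(1)) (auto simp: mfin_def)
    show "(\<lambda>j. mbinom (repeat_mset (2 ^ (k j - (m + q))) (repeat_mset (2 ^ q - 1) \<kappa>)) \<nu> * mfact \<nu> / (2 ^ k j) ^ size \<nu>) \<longlonglongrightarrow> monomial y \<nu>"
      unfolding y_def using LIMSEQ_subseq_LIMSEQ[OF tendsto_mbinom_dyadic k] unfolding comp_def .
  qed
  have up: "(\<Sum>\<nu>\<in>?S p. f \<nu> * monomial y \<nu>) \<le> \<phi> y" for p
  proof (rule tendsto_upperbound[OF lim])
    show "\<forall>\<^sub>F j in sequentially. ?T (k j) p \<le> \<phi> y"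
      using kge by eventually_elim (unfold y_def, rule truncation_bounds(1)[OF x])
  qed simp
  have low: "\<phi> y - r ^ p * \<phi> (dyadic m \<kappa>) \<le> (\<Sum>\<nu>\<in>?S p. f \<nu> * monomial y \<nu>)" for p
  proof (rule tendsto_lowerbound[OF lim])
    show "\<forall>\<^sub>F j in sequentially. \<phi> y - r ^ p * \<phi> (dyadic m \<kappa>) \<le> ?T (k j) p"
      using kge
    proof eventually_elim
      case (elim j)
      then show ?case using truncation_bounds(2)[OF x elim, of p] by (simp add: y_def r_def)
    qed
  qed simp
  have t0: "0 \<le> f \<nu> * monomial y \<nu>" for \<nu> by (intro mult_nonneg_nonneg f(2) monomial_nonneg y0)
  have "series X (\<lambda>\<mu> _. f \<mu>) y b = (\<Sum>\<^sub>\<infinity>\<nu>\<in>mfin ?A. ennreal (f \<nu> * monomial y \<nu>))"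
  proof -
    have "y a = (if a \<in> ?A then y a else 0)" for a by (simp add: y_def dyadic_def not_in_iff)
    then have "y = (\<lambda>a. if a \<in> ?A then y a else 0)" by blast
    then show ?thesis using series_restrict[OF A, of "\<lambda>\<mu> _. f \<mu>" y b] by simp
  qed
  also have "\<dots> = ennreal (\<phi> y)"
  proof (rule antisym)
    show "(\<Sum>\<^sub>\<infinity>\<nu>\<in>mfin ?A. ennreal (f \<nu> * monomial y \<nu>)) \<le> ennreal (\<phi> y)"
    proof (subst nonneg_infsum_complete, simp, rule SUP_least)
      fix G assume G: "G \<in> {G. finite G \<and> G \<subseteq> mfin ?A}"
      obtain p where "\<forall>n\<in>size ` G. n \<le> p" using G finite_nat_set_iff_bounded_le[of "size ` G"] by auto
      then have "G \<subseteq> ?S p" using G by auto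
      then have "(\<Sum>\<nu>\<in>G. f \<nu> * monomial y \<nu>) \<le> (\<Sum>\<nu>\<in>?S p. f \<nu> * monomial y \<nu>)"
        by (intro sum_mono2 S t0)
      then have "(\<Sum>\<nu>\<in>G. f \<nu> * monomial y \<nu>) \<le> \<phi> y" using up[of p] by simp
      then show "(\<Sum>\<nu>\<in>G. ennreal (f \<nu> * monomial y \<nu>)) \<le> ennreal (\<phi> y)"
        by (subst sum_ennreal) (auto intro!: t0 ennreal_leI)
    qed
    have "(\<lambda>p. ennreal (\<phi> y - r ^ p * \<phi> (dyadic m \<kappa>))) \<longlonglongrightarrow> ennreal (\<phi> y - 0 * \<phi> (dyadic m \<kappa>))"
      using r by (intro tendsto_ennrealI tendsto_intros LIMSEQ_realpow_zero)
    then have "(\<lambda>p. ennreal (\<phi> y - r ^ p * \<phi> (dyadic m \<kappa>))) \<longlonglongrightarrow> ennreal (\<phi> y)" by simp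
    then show "ennreal (\<phi> y) \<le> (\<Sum>\<^sub>\<infinity>\<nu>\<in>mfin ?A. ennreal (f \<nu> * monomial y \<nu>))"
    proof (rule LIMSEQ_le_const2, intro exI allI impI)
      fix p :: nat
      have "ennreal (\<phi> y - r ^ p * \<phi> (dyadic m \<kappa>)) \<le> ennreal (\<Sum>\<nu>\<in>?S p. f \<nu> * monomial y \<nu>)"
        using low by (rule ennreal_leI)
      also have "\<dots> = (\<Sum>\<nu>\<in>?S p. ennreal (f \<nu> * monomial y \<nu>))" by (rule sum_ennreal[symmetric]) (rule t0)
      also have "\<dots> \<le> (\<Sum>\<^sub>\<infinity>\<nu>\<in>mfin ?A. ennreal (f \<nu> * monomial y \<nu>))"
        by (subst nonneg_infsum_complete, simp, rule SUP_upper) (use S in auto)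
      finally show "ennreal (\<phi> y - r ^ p * \<phi> (dyadic m \<kappa>)) \<le> (\<Sum>\<^sub>\<infinity>\<nu>\<in>mfin ?A. ennreal (f \<nu> * monomial y \<nu>))" .
    qed
  qed
  finally show ?thesis .
qed

text \<open>Keep the first \<open>n\<close> variables of an enumeration of the web, round down to
  the mesh \<open>1 / 2 ^ n\<close>, and multiply by \<open>1 - 1 / 2 ^ n\<close>. All three
  operations increase with \<open>n\<close> and disappear in the limit. The last factor gives the
  points the form required by \<open>power_series_dyadic\<close> with
  \<open>m = q = n\<close>.\<close>

lemma dyadic_approximation:
  assumes x: "x \<in> pts X"
  obtains \<kappa> where "\<And>n. dyadic n (\<kappa> n) \<in> pts X"
    "\<And>n a. dyadic (n + n) (repeat_mset (2 ^ n - 1) (\<kappa> n)) a \<le> x a"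
    "\<And>a. incseq (\<lambda>n. dyadic (n + n) (repeat_mset (2 ^ n - 1) (\<kappa> n)) a)"
    "\<And>a. (\<lambda>n. dyadic (n + n) (repeat_mset (2 ^ n - 1) (\<kappa> n)) a) \<longlonglongrightarrow> x a"
proof -
  define A where "A n = {a \<in> web X. to_nat_on (web X) a < n}" for n
  have A: "finite (A n)" for n
  proof (rule finite_imageD)
    show "finite (to_nat_on (web X) ` A n)" by (rule finite_subset[of _ "{..<n}"]) (auto simp: A_def)
    show "inj_on (to_nat_on (web X)) (A n)"
      by (rule inj_on_subset[OF inj_on_to_nat_on[OF countable_web]]) (auto simp: A_def)
  qed
  define \<kappa> where "\<kappa> n = (\<Sum>a\<in>A n. replicate_mset (nat \<lfloor>2 ^ n * x a\<rfloor>) a)" for n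
  have cnt: "count (\<kappa> n) a = (if a \<in> A n then nat \<lfloor>2 ^ n * x a\<rfloor> else 0)" for n a
  proof -
    have "count (\<kappa> n) a = (\<Sum>b\<in>A n. if a = b then nat \<lfloor>2 ^ n * x b\<rfloor> else 0)"
      unfolding \<kappa>_def count_sum by (intro sum.cong) auto
    then show ?thesis using A by simp
  qed
  have x0: "0 \<le> x a" for a by (rule pts_nonneg[OF x])
  define t where "t n a = dyadic n (\<kappa> n) a" for n a
  have t: "t n a = (if a \<in> A n then \<lfloor>2 ^ n * x a\<rfloor> / 2 ^ n else 0)" for n a
    using x0[of a] by (simp add: t_def dyadic_def cnt)
  have t0: "0 \<le> t n a" for n a by (simp add: t_def dyadic_def)
  have tx: "t n a \<le> x a" for n a
  proof -
    have "of_int \<lfloor>2 ^ n * x a\<rfloor> \<le> 2 ^ n * x a" by (rule of_int_floor_le)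
    then show ?thesis using x0[of a] by (auto simp: t field_simps)
  qed
  have tinc: "t n a \<le> t (Suc n) a" for n a
  proof (cases "a \<in> A n")
    case True
    have "2 * \<lfloor>2 ^ n * x a\<rfloor> \<le> \<lfloor>2 ^ Suc n * x a\<rfloor>" unfolding le_floor_iff
      using of_int_floor_le[of "2 ^ n * x a"] by simp
    then have "2 * real_of_int \<lfloor>2 ^ n * x a\<rfloor> \<le> real_of_int \<lfloor>2 ^ Suc n * x a\<rfloor>" by linarith
    then have "real_of_int \<lfloor>2 ^ n * x a\<rfloor> / 2 ^ n \<le> real_of_int \<lfloor>2 ^ Suc n * x a\<rfloor> / 2 ^ Suc n"
      by (simp add: field_simps)
    moreover have "a \<in> A (Suc n)" using True by (auto simp: A_def)
    ultimately show ?thesis using True by (simp add: t)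
  qed (use t0 in \<open>simp add: t\<close>)
  have tlim: "(\<lambda>n. t n a) \<longlonglongrightarrow> x a" for a
  proof (cases "a \<in> web X")
    case True
    have "(\<lambda>n. x a - (1/2) ^ n) \<longlonglongrightarrow> x a - 0" by (intro tendsto_intros LIMSEQ_realpow_zero) auto
    then have l: "(\<lambda>n. x a - (1/2) ^ n) \<longlonglongrightarrow> x a" by simp
    have ev: "\<forall>\<^sub>F n in sequentially. x a - (1/2) ^ n \<le> t n a"
      using eventually_gt_at_top[of "to_nat_on (web X) a"]
    proof eventually_elim
      case (elim n)
      have "2 ^ n * x a - 1 \<le> of_int \<lfloor>2 ^ n * x a\<rfloor>" by linarith
      then have "(2 ^ n * x a - 1) / 2 ^ n \<le> of_int \<lfloor>2 ^ n * x a\<rfloor> / 2 ^ n" by (rule divide_right_mono) simp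
      moreover have "a \<in> A n" using True elim by (simp add: A_def)
      ultimately show ?case by (simp add: t diff_divide_distrib power_one_over)
    qed
    show ?thesis by (rule tendsto_sandwich[OF ev _ l tendsto_const]) (simp add: tx)
  next
    case False
    then have "t n a = 0" for n by (simp add: t A_def)
    then show ?thesis using pts_outside[OF x False] by simp
  qed
  have y: "dyadic (n + n) (repeat_mset (2 ^ n - 1) (\<kappa> n)) a = (1 - (1/2) ^ n) * t n a" for n a
    by (simp add: t_def dyadic_def of_nat_diff power_add power_one_over field_simps)
  show ?thesis
  proof (rule that[of \<kappa>])
    show "dyadic n (\<kappa> n) \<in> pts X" for n
      by (rule pts_down[OF x]) (use t0 tx in \<open>auto simp: t_def\<close>)
    have "(1 - (1/2) ^ n) * t n a \<le> 1 * t n a" for n a using t0 by (intro mult_right_mono) auto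
    then show "dyadic (n + n) (repeat_mset (2 ^ n - 1) (\<kappa> n)) a \<le> x a" for n a
      unfolding y using tx[of n a] by (metis mult_1 order_trans)
    show "incseq (\<lambda>n. dyadic (n + n) (repeat_mset (2 ^ n - 1) (\<kappa> n)) a)" for a
    proof -
      have "(1/2) ^ n \<le> (1::real)" for n by (rule power_le_one) auto
      then have "0 \<le> 1 - (1/2 :: real) ^ Suc n" for n by (simp del: power_Suc)
      moreover have "1 - (1/2) ^ n \<le> 1 - (1/2 :: real) ^ Suc n" for n by simp
      ultimately show ?thesis unfolding y incseq_Suc_iff by (intro allI mult_mono tinc t0)
    qed
    have "(\<lambda>n. (1 - (1/2) ^ n) * t n a) \<longlonglongrightarrow> (1 - 0) * x a" for a
      by (intro tendsto_intros tlim LIMSEQ_realpow_zero) auto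
    then show "(\<lambda>n. dyadic (n + n) (repeat_mset (2 ^ n - 1) (\<kappa> n)) a) \<longlonglongrightarrow> x a" for a
      unfolding y by simp
  qed
qed

theorem power_series:
  obtains f where "\<And>\<nu>. 0 \<le> f \<nu>" "\<And>x b. x \<in> pts X \<Longrightarrow> series X (\<lambda>\<mu> _. f \<mu>) x b = ennreal (\<phi> x)"
proof -
  obtain k f where k: "strict_mono (k :: nat \<Rightarrow> nat)" and f: "\<And>\<nu>. \<nu> \<in> mfin (web X) \<Longrightarrow> (\<lambda>n. F (k n) \<nu>) \<longlonglongrightarrow> f \<nu>"
    "\<And>\<nu>. 0 \<le> f \<nu>" using limit_coefficients by blast
  have "series X (\<lambda>\<mu> _. f \<mu>) x b = ennreal (\<phi> x)" if x: "x \<in> pts X" for x b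
  proof -
    obtain \<kappa> where \<kappa>: "\<And>n. dyadic n (\<kappa> n) \<in> pts X"
      and le: "\<And>n a. dyadic (n + n) (repeat_mset (2 ^ n - 1) (\<kappa> n)) a \<le> x a"
      and inc: "\<And>a. incseq (\<lambda>n. dyadic (n + n) (repeat_mset (2 ^ n - 1) (\<kappa> n)) a)"
      and lim: "\<And>a. (\<lambda>n. dyadic (n + n) (repeat_mset (2 ^ n - 1) (\<kappa> n)) a) \<longlonglongrightarrow> x a"
      by (rule dyadic_approximation[OF x]) blast
    define s where "s n = dyadic (n + n) (repeat_mset (2 ^ n - 1) (\<kappa> n))" for n
    have s0: "0 \<le> s n a" for n a by (simp add: s_def dyadic_def)
    have sp: "s n \<in> pts X" for n by (rule pts_down[OF x]) (use s0 le in \<open>auto simp: s_def\<close>)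
    have "(\<lambda>n. \<phi> (s n)) \<longlonglongrightarrow> \<phi> x"
      by (rule cont[OF sp x]) (use inc lim in \<open>auto simp: s_def\<close>)
    then have "(\<lambda>n. ennreal (\<phi> (s n))) \<longlonglongrightarrow> ennreal (\<phi> x)" by (rule tendsto_ennrealI)
    moreover have "(\<lambda>n. series X (\<lambda>\<mu> _. f \<mu>) (s n) b) \<longlonglongrightarrow> series X (\<lambda>\<mu> _. f \<mu>) x b"
      by (rule series_SUP) (use f(2) s0 inc lim in \<open>auto simp: s_def\<close>)
    moreover have "series X (\<lambda>\<mu> _. f \<mu>) (s n) b = ennreal (\<phi> (s n))" for n
      unfolding s_def by (rule power_series_dyadic[OF k f \<kappa>])
    ultimately show ?thesis using LIMSEQ_unique by fastforce
  qed
  with f(2) show ?thesis by (rule that)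
qed

end

section \<open>The functor\<close>

text \<open>Evaluation at \<open>b\<close> is additive and nonnegative on the cone, so it carries
  cube decompositions to real ones. For continuity, pointwise limits of increasing sequences are
  least upper bounds in the source, and conversely in the target.\<close>

lemma stable_coordinate:
  assumes X: "is_pcs X" and Y: "is_pcs Y" and g: "g \<in> cstabm_hom (Fm_obj X) (Fm_obj Y)"
  shows "absolutely_monotone X (\<lambda>x. g x b)"
proof -
  interpret X: pcspace X by (rule pcspace.intro[OF X])
  interpret Y: pcspace Y by (rule pcspace.intro[OF Y])
  interpret CX: normed_cone "Fm_obj X" by (rule X.normed_cone_Fm_obj)
  have st: "stable (Fm_obj X) (Fm_obj Y) g" using g by (simp add: cstabm_hom_def)
  then have gc: "g \<in> cone_ball (Fm_obj X) \<rightarrow> carrier (Fm_obj Y)" and ps: "prestable (Fm_obj X) (Fm_obj Y) g"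
    by (simp_all add: stable_def)
  show ?thesis
  proof
    fix N :: "('a \<times> nat) set" and u
    assume N: "finite N" and u: "\<And>i a. i \<in> N \<Longrightarrow> 0 \<le> u i a" and p: "(\<lambda>a. \<Sum>i\<in>N. u i a) \<in> pts X"
    have uc: "u \<in> N \<rightarrow> Fm_carrier X"
    proof
      fix i assume "i \<in> N"
      then show "u i \<in> Fm_carrier X"
        using N u by (intro X.carrier_down[OF X.pts_carrier[OF p]]) (auto intro: member_le_sum)
    qed
    have z: "\<zero>\<^bsub>Fm_obj X\<^esub> \<oplus>\<^bsub>Fm_obj X\<^esub> (\<Oplus>\<^bsub>Fm_obj X\<^esub>i\<in>I. u i) = (\<lambda>a. \<Sum>i\<in>I. u i a)" if "I \<subseteq> N" for I
    proof -
      have "finite I" "u \<in> I \<rightarrow> Fm_carrier X" using N uc that finite_subset by auto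
      then show ?thesis by (simp add: X.finsum_Fm_obj X.Fm_obj_simps)
    qed
    have "\<exists>d. cube_dec (Fm_obj Y) N (\<lambda>I. g (\<zero>\<^bsub>Fm_obj X\<^esub> \<oplus>\<^bsub>Fm_obj X\<^esub> (\<Oplus>\<^bsub>Fm_obj X\<^esub>i\<in>I. u i))) d"
      by (rule prestable_imp_cube_dec[OF X.normed_cone_Fm_obj Y.normed_cone_Fm_obj gc ps N])
         (use uc p z[of N] CX.zero_closed in \<open>auto simp: X.cone_ball_Fm_obj X.Fm_obj_simps(1)\<close>)
    then obtain d where d: "cube_dec (Fm_obj Y) N (\<lambda>I. g (\<zero>\<^bsub>Fm_obj X\<^esub> \<oplus>\<^bsub>Fm_obj X\<^esub> (\<Oplus>\<^bsub>Fm_obj X\<^esub>i\<in>I. u i))) d" ..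
    have dc: "d J \<in> Fm_carrier Y" if "J \<subseteq> N" for J
      using d that by (auto simp: cube_dec_def Y.Fm_obj_simps(1))
    have "g (\<lambda>a. \<Sum>i\<in>I. u i a) b = (\<Sum>J\<in>Pow I. d J b)" if I: "I \<subseteq> N" for I
    proof -
      have "finite (Pow I)" "d \<in> Pow I \<rightarrow> Fm_carrier Y" using N I dc by (auto intro: finite_subset)
      then have "(\<Oplus>\<^bsub>Fm_obj Y\<^esub>J\<in>Pow I. d J) = (\<lambda>b. \<Sum>J\<in>Pow I. d J b)" by (rule Y.finsum_Fm_obj)
      moreover have "g (\<zero>\<^bsub>Fm_obj X\<^esub> \<oplus>\<^bsub>Fm_obj X\<^esub> (\<Oplus>\<^bsub>Fm_obj X\<^esub>i\<in>I. u i)) = (\<Oplus>\<^bsub>Fm_obj Y\<^esub>J\<in>Pow I. d J)"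
        using d I unfolding cube_dec_def by blast
      ultimately show ?thesis unfolding z[OF I] by simp
    qed
    then show "\<exists>d. (\<forall>J. J \<subseteq> N \<longrightarrow> 0 \<le> d J) \<and> (\<forall>I. I \<subseteq> N \<longrightarrow> g (\<lambda>a. \<Sum>i\<in>I. u i a) b = (\<Sum>J\<in>Pow I. d J))"
      using Y.carrier_nonneg[OF dc] by (intro exI[of _ "\<lambda>J. d J b"]) auto
  next
    fix s x
    assume s: "\<And>n. s n \<in> pts X" and x: "x \<in> pts X" and inc: "\<And>a. incseq (\<lambda>n. s n a)"
      and lim: "\<And>a. (\<lambda>n. s n a) \<longlonglongrightarrow> x a"
    have sc: "range s \<subseteq> Fm_carrier X" using s X.pts_carrier by auto
    have lub: "cone_lub (Fm_obj X) s x"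
      by (rule X.cone_lub_limit[OF sc X.pts_carrier[OF x] inc lim])
    have ci: "cone_incseq (Fm_obj X) s" using X.cone_incseq_iff[OF sc] inc by blast
    have "range s \<subseteq> cone_ball (Fm_obj X)" "x \<in> cone_ball (Fm_obj X)" using s x by (auto simp: X.cone_ball_Fm_obj)
    then have lub': "cone_lub (Fm_obj Y) (\<lambda>n. g (s n)) (g x)"
      using st ci lub unfolding stable_def by blast
    have gsc: "range (\<lambda>n. g (s n)) \<subseteq> Fm_carrier Y"
      using gc s by (auto simp: X.cone_ball_Fm_obj Y.Fm_obj_simps(1))
    have "cone_incseq (Fm_obj Y) (\<lambda>n. g (s n))"
      using prestable_mono[OF X.normed_cone_Fm_obj gc ps Y.normed_cone_Fm_obj] ci s X.pts_carrier
      by (auto simp: cone_incseq_def X.cone_ball_Fm_obj X.Fm_obj_simps(1))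
    from Y.cone_lubD(1)[OF gsc this lub'] show "(\<lambda>n. g (s n) b) \<longlonglongrightarrow> g x b" .
  qed
qed

lemma Fm_mor_full:
  fixes X :: "'a pcs" and Y :: "'b pcs"
  assumes X: "is_pcs X" and Y: "is_pcs Y" and g: "g \<in> cstabm_hom (Fm_obj X) (Fm_obj Y)"
  shows "\<exists>f\<in>pcoh_hom X Y. Fm_mor X Y f = g"
proof -
  interpret X: pcspace X by (rule pcspace.intro[OF X])
  interpret Y: pcspace Y by (rule pcspace.intro[OF Y])
  have gp: "g \<in> pts X \<rightarrow>\<^sub>E pts Y" using g by (simp add: cstabm_hom_def X.cone_ball_Fm_obj Y.cone_ball_Fm_obj)
  have "\<exists>f. (\<forall>\<nu>. 0 \<le> f \<nu>) \<and> (\<forall>x\<in>pts X. series X (\<lambda>\<mu> _. f \<mu>) x b = ennreal (g x b))" for b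
  proof -
    interpret absolutely_monotone X "\<lambda>x. g x b" by (rule stable_coordinate[OF X Y g])
    show ?thesis
    proof (rule power_series)
      fix f assume "\<And>\<nu>. 0 \<le> f \<nu>" "\<And>x (b' :: 'b). x \<in> pts X \<Longrightarrow> series X (\<lambda>\<mu> _. f \<mu>) x b' = ennreal (g x b)"
      then show ?thesis by (intro exI[of _ f] conjI allI ballI)
    qed
  qed
  then have "\<forall>b. \<exists>f. (\<forall>\<nu>. 0 \<le> f \<nu>) \<and> (\<forall>x\<in>pts X. series X (\<lambda>\<mu> _. f \<mu>) x b = ennreal (g x b))" by blast
  from choice[OF this] obtain f where f0: "\<And>b \<nu>. 0 \<le> f b \<nu>"
    and f: "\<And>b x. x \<in> pts X \<Longrightarrow> series X (\<lambda>\<mu> _. f b \<mu>) x b = ennreal (g x b)" by blast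
  \<comment> \<open>Matrices must vanish outside their index sets. The series is unchanged: it only
    ranges over \<open>mfin (web X)\<close>, and for \<open>b\<close> outside \<open>web Y\<close>
    the value \<open>g x b\<close> is 0 as well.\<close>
  define h where "h \<mu> b = (if \<mu> \<in> mfin (web X) \<and> b \<in> web Y then f b \<mu> else 0)" for \<mu> b
  have ser: "series X h x b = ennreal (g x b)" if x: "x \<in> pts X" for x b
  proof (cases "b \<in> web Y")
    case True
    then have "series X h x b = series X (\<lambda>\<mu> _. f b \<mu>) x b"
      unfolding series_def h_def by (intro infsum_cong) auto
    then show ?thesis using f[OF x] by simp
  next
    case False
    have "g x \<in> pts Y" using gp x by auto
    then show ?thesis using False by (simp add: series_def h_def Y.pts_outside)
  qed
  have hat: "hat X h x = g x" if x: "x \<in> pts X" for x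
  proof
    fix b
    have "0 \<le> g x b" using gp x Y.pts_nonneg by (auto simp: PiE_iff)
    then show "hat X h x b = g x b" by (simp add: hat_def ser[OF x])
  qed
  show ?thesis
  proof
    show "Fm_mor X Y h = g"
      using hat gp by (auto simp: Fm_mor_def fun_eq_iff PiE_iff extensional_def)
    show "h \<in> pcoh_hom X Y"
      using hat gp ser f0 by (auto simp: pcoh_hom_def h_def PiE_iff)
  qed
qed

lemma pcoh_id_hom:
  assumes X: "is_pcs X"
  shows "pcoh_id X \<in> pcoh_hom X X" and "\<And>x. x \<in> pts X \<Longrightarrow> hat X (pcoh_id X) x = x"
proof -
  interpret X: pcspace X by (rule pcspace.intro[OF X])
  have ser: "series X (pcoh_id X) x b = ennreal (x b)" if x: "x \<in> pts X" for x b
  proof -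
    have "series X (pcoh_id X) x b = (\<Sum>\<^sub>\<infinity>\<mu>\<in>(if b \<in> web X then {{#b#}} else {}). ennreal (x b))"
      unfolding series_def
      by (rule infsum_cong_neutral) (auto simp: pcoh_id_def mfin_def split: if_splits)
    then show ?thesis using X.pts_outside[OF x, of b] by simp
  qed
  show hat: "\<And>x. x \<in> pts X \<Longrightarrow> hat X (pcoh_id X) x = x"
    using X.pts_nonneg by (auto simp: hat_def ser fun_eq_iff)
  show "pcoh_id X \<in> pcoh_hom X X"
    using hat ser by (auto simp: pcoh_hom_def pcoh_id_def mfin_def)
qed

text \<open>The composite matrix is obtained from the composite stable map, without rearranging
  multiple series. Its uniqueness is \<open>hat_inject\<close>; together they give meaning to the
  \<open>THE\<close> in \<open>pcoh_comp\<close>.\<close>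

lemma pcoh_comp_hom:
  fixes X Y Z :: "'a pcs"
  assumes X: "is_pcs X" and Y: "is_pcs Y" and Z: "is_pcs Z"
    and f: "f \<in> pcoh_hom X Y" and g: "g \<in> pcoh_hom Y Z"
  shows "pcoh_comp X Y Z g f \<in> pcoh_hom X Z"
    and "\<And>x. x \<in> pts X \<Longrightarrow> hat X (pcoh_comp X Y Z g f) x = hat Y g (hat X f x)"
proof -
  interpret F: pcs_hom X Y f using X Y f by (simp add: pcs_hom_def pcspace_def pcs_hom_axioms_def)
  interpret G: pcs_hom Y Z g using Y Z g by (simp add: pcs_hom_def pcspace_def pcs_hom_axioms_def)
  have "compose (cone_ball (Fm_obj X)) (Fm_mor Y Z g) (Fm_mor X Y f) \<in> cstabm_hom (Fm_obj X) (Fm_obj Z)"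
    by (rule cstabm_hom_compose[OF F.X.measurable_cone_Fm_obj F.Y.measurable_cone_Fm_obj
          G.Y.measurable_cone_Fm_obj F.Fm_mor_hom G.Fm_mor_hom])
  from Fm_mor_full[OF X Z this] obtain h where h: "h \<in> pcoh_hom X Z"
    "Fm_mor X Z h = compose (cone_ball (Fm_obj X)) (Fm_mor Y Z g) (Fm_mor X Y f)" by blast
  have hat: "hat X h x = hat Y g (hat X f x)" if "x \<in> pts X" for x
    using fun_cong[OF h(2), of x] that F.hat_pts[OF that]
    by (simp add: Fm_mor_def compose_def F.X.cone_ball_Fm_obj)
  have "pcoh_comp X Y Z g f \<in> pcoh_hom X Z \<and> (\<forall>x\<in>pts X. hat X (pcoh_comp X Y Z g f) x = hat Y g (hat X f x))"
    unfolding pcoh_comp_def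
  proof (rule theI[of _ h])
    show "h \<in> pcoh_hom X Z \<and> (\<forall>x\<in>pts X. hat X h x = hat Y g (hat X f x))" using h hat by blast
    fix h' assume "h' \<in> pcoh_hom X Z \<and> (\<forall>x\<in>pts X. hat X h' x = hat Y g (hat X f x))"
    then show "h' = h" using hat h(1) by (intro hat_inject[OF X Z]) auto
  qed
  then show "pcoh_comp X Y Z g f \<in> pcoh_hom X Z"
    "\<And>x. x \<in> pts X \<Longrightarrow> hat X (pcoh_comp X Y Z g f) x = hat Y g (hat X f x)" by auto
qed

text \<open>By \<open>hat_inject\<close> the identities between matrices may be checked on the
  associated maps, where they are trivial.\<close>

lemma is_category_Pcoh: "is_category (Pcoh :: ('a pcs, 'a multiset \<Rightarrow> 'a \<Rightarrow> real) category)"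
proof -
  have pts: "hat X f x \<in> pts Y" if "f \<in> pcoh_hom X Y" "x \<in> pts X" for X Y :: "'a pcs" and f x
    using that by (auto simp: pcoh_hom_def)
  have idl: "pcoh_comp A A B f (pcoh_id A) = f" "pcoh_comp A B B (pcoh_id B) f = f"
    if "is_pcs A" "is_pcs B" "f \<in> pcoh_hom A B" for A B :: "'a pcs" and f
    using that by (auto intro!: hat_inject[of A B] simp: pcoh_comp_hom pcoh_id_hom pts[OF that(3)])
  have assoc: "pcoh_comp A C D h (pcoh_comp A B C g f) = pcoh_comp A B D (pcoh_comp B C D h g) f"
    if "is_pcs A" "is_pcs B" "is_pcs C" "is_pcs D" "f \<in> pcoh_hom A B" "g \<in> pcoh_hom B C" "h \<in> pcoh_hom C D"
    for A B C D :: "'a pcs" and f g h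
  proof (rule hat_inject[of A D])
    note gf = pcoh_comp_hom[OF that(1,2,3,5,6)]
    note hg = pcoh_comp_hom[OF that(2,3,4,6,7)]
    note l = pcoh_comp_hom[OF that(1,3,4) gf(1) that(7)]
    note r = pcoh_comp_hom[OF that(1,2,4,5) hg(1)]
    show "pcoh_comp A C D h (pcoh_comp A B C g f) \<in> pcoh_hom A D" by (rule l(1))
    show "pcoh_comp A B D (pcoh_comp B C D h g) f \<in> pcoh_hom A D" by (rule r(1))
    fix x assume "x \<in> pts A"
    then show "hat A (pcoh_comp A C D h (pcoh_comp A B C g f)) x = hat A (pcoh_comp A B D (pcoh_comp B C D h g) f) x"
      by (simp add: l(2) r(2) gf(2) hg(2) pts[OF that(5)])
  qed (use that in auto)
  show ?thesis
    unfolding is_category_def Pcoh_def category.simps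
    by (simp add: pcoh_id_hom(1) pcoh_comp_hom(1) idl assoc)
qed

lemma is_functor_Fm: "is_functor (Pcoh :: ('a pcs, 'a multiset \<Rightarrow> 'a \<Rightarrow> real) category)
      (Cstabm :: (('a \<Rightarrow> real) mcone, ('a \<Rightarrow> real) \<Rightarrow> ('a \<Rightarrow> real)) category) Fm_obj Fm_mor"
proof -
  have obj: "measurable_cone (Fm_obj X)" if "is_pcs X" for X :: "'a pcs"
    using that by (intro pcspace.measurable_cone_Fm_obj pcspace.intro)
  have ball: "cone_ball (Fm_obj X) = pts X" if "is_pcs X" for X :: "'a pcs"
    using that by (intro pcspace.cone_ball_Fm_obj pcspace.intro)
  have mor: "Fm_mor X Y f \<in> cstabm_hom (Fm_obj X) (Fm_obj Y)"
    if "is_pcs X" "is_pcs Y" "f \<in> pcoh_hom X Y" for X Y :: "'a pcs" and f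
    using that by (intro pcs_hom.Fm_mor_hom) (simp add: pcs_hom_def pcspace_def pcs_hom_axioms_def)
  have id: "Fm_mor X X (pcoh_id X) = (\<lambda>x\<in>cone_ball (Fm_obj X). x)" if "is_pcs X" for X :: "'a pcs"
    by (simp add: Fm_mor_def ball[OF that] pcoh_id_hom(2)[OF that] cong: restrict_cong)
  have comp: "Fm_mor X Z (pcoh_comp X Y Z g f) = compose (cone_ball (Fm_obj X)) (Fm_mor Y Z g) (Fm_mor X Y f)"
    if "is_pcs X" "is_pcs Y" "is_pcs Z" "f \<in> pcoh_hom X Y" "g \<in> pcoh_hom Y Z" for X Y Z :: "'a pcs" and f g
  proof -
    have "hat X f x \<in> pts Y" if "x \<in> pts X" for x using \<open>f \<in> pcoh_hom X Y\<close> that by (auto simp: pcoh_hom_def)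
    then show ?thesis
      by (auto simp: Fm_mor_def compose_def ball[OF that(1)] pcoh_comp_hom(2)[OF that] fun_eq_iff)
  qed
  show ?thesis
    unfolding is_functor_def
    using is_category_Pcoh is_category_Cstabm obj mor id comp
    by (simp add: Pcoh_def Cstabm_def)
qed

theorem theorem5p8:
  "is_functor (Pcoh :: ('a pcs, 'a multiset \<Rightarrow> 'a \<Rightarrow> real) category)
      (Cstabm :: (('a \<Rightarrow> real) mcone, ('a \<Rightarrow> real) \<Rightarrow> ('a \<Rightarrow> real)) category) Fm_obj Fm_mor \<and>
   is_full (Pcoh :: ('a pcs, 'a multiset \<Rightarrow> 'a \<Rightarrow> real) category)
      (Cstabm :: (('a \<Rightarrow> real) mcone, ('a \<Rightarrow> real) \<Rightarrow> ('a \<Rightarrow> real)) category) Fm_obj Fm_mor \<and>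
   is_faithful (Pcoh :: ('a pcs, 'a multiset \<Rightarrow> 'a \<Rightarrow> real) category)
      (Fm_mor :: 'a pcs \<Rightarrow> 'a pcs \<Rightarrow> ('a multiset \<Rightarrow> 'a \<Rightarrow> real) \<Rightarrow> ('a \<Rightarrow> real) \<Rightarrow> ('a \<Rightarrow> real))"
proof (intro conjI is_functor_Fm)
  show "is_full (Pcoh :: ('a pcs, 'a multiset \<Rightarrow> 'a \<Rightarrow> real) category)
      (Cstabm :: (('a \<Rightarrow> real) mcone, ('a \<Rightarrow> real) \<Rightarrow> ('a \<Rightarrow> real)) category) Fm_obj Fm_mor"
    unfolding is_full_def Pcoh_def Cstabm_def category.simps using Fm_mor_full by blast
  show "is_faithful (Pcoh :: ('a pcs, 'a multiset \<Rightarrow> 'a \<Rightarrow> real) category)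
      (Fm_mor :: 'a pcs \<Rightarrow> 'a pcs \<Rightarrow> ('a multiset \<Rightarrow> 'a \<Rightarrow> real) \<Rightarrow> ('a \<Rightarrow> real) \<Rightarrow> ('a \<Rightarrow> real))"
    unfolding is_faithful_def Pcoh_def category.simps
  proof (intro ballI inj_onI)
    fix A B :: "'a pcs" and f g assume A: "A \<in> {X. is_pcs X}" "B \<in> {X. is_pcs X}"
      "f \<in> pcoh_hom A B" "g \<in> pcoh_hom A B" and eq: "Fm_mor A B f = Fm_mor A B g"
    have "hat A f x = hat A g x" if "x \<in> pts A" for x
      using fun_cong[OF eq, of x] that by (simp add: Fm_mor_def)
    then show "f = g" using A by (intro hat_inject[of A B]) auto
  qed
qed

end
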